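(* The category $\mathsf{WH}_{\mathsf{fp}}$ of finitely presented Wajsberg hoops with homomorphisms and the category $\mathsf{MV}^{+}$ of positive (finitely presented) MV-algebras with positive homomorphisms are categorically equivalent.
   Context: A Wajsberg hoop is an algebra $(A,\cdot,\to,1)$ with $(A,\cdot,1)$ a commutative monoid satisfying $x\to x=1$, $x\cdot(x\to y)=y\cdot(y\to x)$, $(x\cdot y)\to z=x\to(y\to z)$, and $(x\to y)\to y=(y\to x)\to x$. It is lattice-ordered by $x\le y$ iff $x\to y=1$, with $x\wedge y=x\cdot(x\to y)$ and $x\vee y=(x\to y)\to y$, and is regarded as an algebra in the signature $\{\cdot,\to,\wedge,\vee,1\}$. MV-algebras are (term-equivalently) Wajsberg hoops with an additional constant $0$ that is the least element, in the signature $\{\cdot,\to,\wedge,\vee,0,1\}$; $\neg x:=x\to0$. An algebra in a variety is finitely presented if it is isomorphic to a quotient of a finitely generated free algebra by a finitely generated congruence; $\mathsf{WH}_{\mathsf{fp}}$ is the full subcategory of Wajsberg hoops on the finitely presented ones. The free $n$-generated MV-algebra $\mathcal{F}_{\mathsf{MV}}(n)$ is identified with the algebra of McNaughton functions, i.e. continuous functions $[0,1]^n\to[0,1]$ that are piecewise (affine) linear with integer coefficients, with pointwise operations induced by $x\cdot y=\max\{0,x+y-1\}$, $x\to y=\min\{1,1-x+y\}$, $\min$, $\max$, $0$, $1$ on $[0,1]$; the free generators are the projections. A function in $\mathcal{F}_{\mathsf{MV}}(n)$ is positive if it is the interpretation of a term in the $0$-free signature $\{\cdot,\to,\wedge,\vee,1\}$.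 A rational polyhedron is a finite union of convex hulls of finitely many points with rational coordinates; a polyhedron in $[0,1]^n$ is pointed if it contains $\mathbf 1=(1,\dots,1)$. For $\mathscr P\subseteq[0,1]^n$, $\mathcal{M}(\mathscr P)=\{f_{\restriction\mathscr P}:f\in\mathcal{F}_{\mathsf{MV}}(n)\}$ with pointwise operations. A positive MV-algebra is one of the form $\mathcal{M}(\mathscr P)$ with $\mathscr P\subseteq[0,1]^n$ (for some $n$) a pointed rational polyhedron. For pointed rational polyhedra $\mathscr P\subseteq[0,1]^n$, $\mathscr Q\subseteq[0,1]^m$, an MV-homomorphism $\alpha:\mathcal{M}(\mathscr P)\to\mathcal{M}(\mathscr Q)$ is positive if for every positive $h\in\mathcal{F}_{\mathsf{MV}}(n)$ there is a positive $k\in\mathcal{F}_{\mathsf{MV}}(m)$ with $\alpha(h_{\restriction\mathscr P})=k_{\restriction\mathscr Q}$. $\mathsf{MV}^+$ is the category of positive MV-algebras with positive homomorphisms. *)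

theory Defs
  imports "HOL-Analysis.Function_Topology" "HOL-Algebra.Group"
begin

section \<open>Categories and equivalence of categories\<close>

text \<open>
  Hom-sets of distinct pairs of objects need not be disjoint, so composition and the action of a
  functor on arrows take the objects involved as arguments.  \<open>Comp C X Y Z g f\<close> is the composite
  of \<open>f\<close> from \<open>X\<close> to \<open>Y\<close> followed by \<open>g\<close> from \<open>Y\<close> to \<open>Z\<close>.
\<close>

record ('o, 'm) cat =
  Obj :: "'o set"
  Hom :: "'o \<Rightarrow> 'o \<Rightarrow> 'm set"
  Ident :: "'o \<Rightarrow> 'm"
  Comp :: "'o \<Rightarrow> 'o \<Rightarrow> 'o \<Rightarrow> 'm \<Rightarrow> 'm \<Rightarrow> 'm"

locale category =
  fixes C :: "('o, 'm) cat"
  assumes Ident_in_Hom: "X \<in> Obj C \<Longrightarrow> Ident C X \<in> Hom C X X"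
    and Comp_in_Hom: "\<lbrakk>X \<in> Obj C; Y \<in> Obj C; Z \<in> Obj C; f \<in> Hom C X Y; g \<in> Hom C Y Z\<rbrakk>
      \<Longrightarrow> Comp C X Y Z g f \<in> Hom C X Z"
    and Comp_Ident_left: "\<lbrakk>X \<in> Obj C; Y \<in> Obj C; f \<in> Hom C X Y\<rbrakk>
      \<Longrightarrow> Comp C X Y Y (Ident C Y) f = f"
    and Comp_Ident_right: "\<lbrakk>X \<in> Obj C; Y \<in> Obj C; f \<in> Hom C X Y\<rbrakk>
      \<Longrightarrow> Comp C X X Y f (Ident C X) = f"
    and Comp_assoc: "\<lbrakk>W \<in> Obj C; X \<in> Obj C; Y \<in> Obj C; Z \<in> Obj C;
        f \<in> Hom C W X; g \<in> Hom C X Y; h \<in> Hom C Y Z\<rbrakk>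
      \<Longrightarrow> Comp C W Y Z h (Comp C W X Y g f) = Comp C W X Z (Comp C X Y Z h g) f"

record ('o, 'm, 'p, 'n) ftor =
  on_obj :: "'o \<Rightarrow> 'p"
  on_arr :: "'o \<Rightarrow> 'o \<Rightarrow> 'm \<Rightarrow> 'n"

definition id_ftor :: "('o, 'm, 'o, 'm) ftor" where
  "id_ftor = \<lparr>on_obj = (\<lambda>X. X), on_arr = (\<lambda>X Y f. f)\<rparr>"

definition comp_ftor ::
  "('p, 'n, 'q, 'k) ftor \<Rightarrow> ('o, 'm, 'p, 'n) ftor \<Rightarrow> ('o, 'm, 'q, 'k) ftor" where
  "comp_ftor G F = \<lparr>on_obj = (\<lambda>X. on_obj G (on_obj F X)),
     on_arr = (\<lambda>X Y f. on_arr G (on_obj F X) (on_obj F Y) (on_arr F X Y f))\<rparr>"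

locale cat_functor = C: category C + D: category D
  for C :: "('o, 'm) cat" and D :: "('p, 'n) cat" +
  fixes F :: "('o, 'm, 'p, 'n) ftor"
  assumes on_obj_closed: "X \<in> Obj C \<Longrightarrow> on_obj F X \<in> Obj D"
    and on_arr_closed: "\<lbrakk>X \<in> Obj C; Y \<in> Obj C; f \<in> Hom C X Y\<rbrakk>
      \<Longrightarrow> on_arr F X Y f \<in> Hom D (on_obj F X) (on_obj F Y)"
    and on_arr_Ident: "X \<in> Obj C \<Longrightarrow> on_arr F X X (Ident C X) = Ident D (on_obj F X)"
    and on_arr_Comp: "\<lbrakk>X \<in> Obj C; Y \<in> Obj C; Z \<in> Obj C; f \<in> Hom C X Y; g \<in> Hom C Y Z\<rbrakk>
      \<Longrightarrow> on_arr F X Z (Comp C X Y Z g f) =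
          Comp D (on_obj F X) (on_obj F Y) (on_obj F Z) (on_arr F Y Z g) (on_arr F X Y f)"

definition is_iso :: "('o, 'm) cat \<Rightarrow> 'o \<Rightarrow> 'o \<Rightarrow> 'm \<Rightarrow> bool" where
  "is_iso C X Y f \<longleftrightarrow> f \<in> Hom C X Y \<and>
     (\<exists>g \<in> Hom C Y X. Comp C X Y X g f = Ident C X \<and> Comp C Y X Y f g = Ident C Y)"

locale natural_iso = F: cat_functor C D F + G: cat_functor C D G
  for C :: "('o, 'm) cat" and D :: "('p, 'n) cat" and F G +
  fixes \<eta> :: "'o \<Rightarrow> 'n"
  assumes component_iso: "X \<in> Obj C \<Longrightarrow> is_iso D (on_obj F X) (on_obj G X) (\<eta> X)"
    and natural: "\<lbrakk>X \<in> Obj C; Y \<in> Obj C; f \<in> Hom C X Y\<rbrakk>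
      \<Longrightarrow> Comp D (on_obj F X) (on_obj F Y) (on_obj G Y) (\<eta> Y) (on_arr F X Y f) =
          Comp D (on_obj F X) (on_obj G X) (on_obj G Y) (on_arr G X Y f) (\<eta> X)"

definition categorically_equivalent :: "('o, 'm) cat \<Rightarrow> ('p, 'n) cat \<Rightarrow> bool" where
  "categorically_equivalent C D \<longleftrightarrow> category C \<and> category D \<and>
     (\<exists>F G \<eta> \<epsilon>. cat_functor C D F \<and> cat_functor D C G \<and>
        natural_iso C C id_ftor (comp_ftor G F) \<eta> \<and>
        natural_iso D D (comp_ftor F G) id_ftor \<epsilon>)"


section \<open>Wajsberg hoops\<close>

record 'a hoop = "'a monoid" +
  imp :: "['a, 'a] \<Rightarrow> 'a" (infixr \<open>\<rightharpoonup>\<index>\<close> 65)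
  hmeet :: "['a, 'a] \<Rightarrow> 'a" (infixl \<open>\<curlywedge>\<index>\<close> 70)
  hjoin :: "['a, 'a] \<Rightarrow> 'a" (infixl \<open>\<curlyvee>\<index>\<close> 70)

locale wajsberg_hoop = comm_monoid A for A :: "('a, 'b) hoop_scheme" (structure) +
  assumes imp_closed: "\<lbrakk>x \<in> carrier A; y \<in> carrier A\<rbrakk> \<Longrightarrow> x \<rightharpoonup> y \<in> carrier A"
    and imp_self: "x \<in> carrier A \<Longrightarrow> x \<rightharpoonup> x = \<one>"
    and divisibility: "\<lbrakk>x \<in> carrier A; y \<in> carrier A\<rbrakk> \<Longrightarrow> x \<otimes> (x \<rightharpoonup> y) = y \<otimes> (y \<rightharpoonup> x)"
    and currying: "\<lbrakk>x \<in> carrier A; y \<in> carrier A; z \<in> carrier A\<rbrakk>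
      \<Longrightarrow> (x \<otimes> y) \<rightharpoonup> z = x \<rightharpoonup> (y \<rightharpoonup> z)"
    and wajsberg: "\<lbrakk>x \<in> carrier A; y \<in> carrier A\<rbrakk> \<Longrightarrow> (x \<rightharpoonup> y) \<rightharpoonup> y = (y \<rightharpoonup> x) \<rightharpoonup> x"
    and hmeet_eq: "\<lbrakk>x \<in> carrier A; y \<in> carrier A\<rbrakk> \<Longrightarrow> x \<curlywedge> y = x \<otimes> (x \<rightharpoonup> y)"
    and hjoin_eq: "\<lbrakk>x \<in> carrier A; y \<in> carrier A\<rbrakk> \<Longrightarrow> x \<curlyvee> y = (x \<rightharpoonup> y) \<rightharpoonup> y"

text \<open>
  Homomorphisms are extensional on the carrier, so that equality of arrows is equality of maps.
\<close>

definition hoop_hom :: "('a, 'c) hoop_scheme \<Rightarrow> ('b, 'd) hoop_scheme \<Rightarrow> ('a \<Rightarrow> 'b) set" where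
  "hoop_hom A B = {f \<in> hom A B \<inter> extensional (carrier A).
     f \<one>\<^bsub>A\<^esub> = \<one>\<^bsub>B\<^esub> \<and>
     (\<forall>x \<in> carrier A. \<forall>y \<in> carrier A.
        f (x \<rightharpoonup>\<^bsub>A\<^esub> y) = f x \<rightharpoonup>\<^bsub>B\<^esub> f y \<and>
        f (x \<curlywedge>\<^bsub>A\<^esub> y) = f x \<curlywedge>\<^bsub>B\<^esub> f y \<and>
        f (x \<curlyvee>\<^bsub>A\<^esub> y) = f x \<curlyvee>\<^bsub>B\<^esub> f y)}"

definition hoop_isomorphic :: "('a, 'c) hoop_scheme \<Rightarrow> ('b, 'd) hoop_scheme \<Rightarrow> bool" where
  "hoop_isomorphic A B \<longleftrightarrow> (\<exists>f \<in> hoop_hom A B. bij_betw f (carrier A) (carrier B))"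

definition congruence :: "('a, 'c) hoop_scheme \<Rightarrow> ('a \<times> 'a) set \<Rightarrow> bool" where
  "congruence A \<theta> \<longleftrightarrow> equiv (carrier A) \<theta> \<and>
     (\<forall>(x, x') \<in> \<theta>. \<forall>(y, y') \<in> \<theta>.
        (x \<otimes>\<^bsub>A\<^esub> y, x' \<otimes>\<^bsub>A\<^esub> y') \<in> \<theta> \<and>
        (x \<rightharpoonup>\<^bsub>A\<^esub> y, x' \<rightharpoonup>\<^bsub>A\<^esub> y') \<in> \<theta> \<and>
        (x \<curlywedge>\<^bsub>A\<^esub> y, x' \<curlywedge>\<^bsub>A\<^esub> y') \<in> \<theta> \<and>
        (x \<curlyvee>\<^bsub>A\<^esub> y, x' \<curlyvee>\<^bsub>A\<^esub> y') \<in> \<theta>)"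

definition generated_congruence ::
  "('a, 'c) hoop_scheme \<Rightarrow> ('a \<times> 'a) set \<Rightarrow> ('a \<times> 'a) set" where
  "generated_congruence A R = \<Inter>{\<theta>. congruence A \<theta> \<and> R \<subseteq> \<theta>}"

definition quotient_hoop :: "('a, 'c) hoop_scheme \<Rightarrow> ('a \<times> 'a) set \<Rightarrow> 'a set hoop" where
  "quotient_hoop A \<theta> =
     \<lparr>carrier = carrier A // \<theta>,
      mult = (\<lambda>X Y. \<Union>x \<in> X. \<Union>y \<in> Y. \<theta> `` {x \<otimes>\<^bsub>A\<^esub> y}),
      one = \<theta> `` {\<one>\<^bsub>A\<^esub>},
      imp = (\<lambda>X Y. \<Union>x \<in> X. \<Union>y \<in> Y. \<theta> `` {x \<rightharpoonup>\<^bsub>A\<^esub> y}),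
      hmeet = (\<lambda>X Y. \<Union>x \<in> X. \<Union>y \<in> Y. \<theta> `` {x \<curlywedge>\<^bsub>A\<^esub> y}),
      hjoin = (\<lambda>X Y. \<Union>x \<in> X. \<Union>y \<in> Y. \<theta> `` {x \<curlyvee>\<^bsub>A\<^esub> y})\<rparr>"

datatype hterm = Var nat | One | Mult hterm hterm | Imp hterm hterm
  | Meet hterm hterm | Join hterm hterm

primrec tvars :: "hterm \<Rightarrow> nat set" where
  "tvars (Var i) = {i}"
| "tvars One = {}"
| "tvars (Mult s t) = tvars s \<union> tvars t"
| "tvars (Imp s t) = tvars s \<union> tvars t"
| "tvars (Meet s t) = tvars s \<union> tvars t"
| "tvars (Join s t) = tvars s \<union> tvars t"

primrec teval :: "('a, 'c) hoop_scheme \<Rightarrow> (nat \<Rightarrow> 'a) \<Rightarrow> hterm \<Rightarrow> 'a" where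
  "teval A v (Var i) = v i"
| "teval A v One = \<one>\<^bsub>A\<^esub>"
| "teval A v (Mult s t) = teval A v s \<otimes>\<^bsub>A\<^esub> teval A v t"
| "teval A v (Imp s t) = teval A v s \<rightharpoonup>\<^bsub>A\<^esub> teval A v t"
| "teval A v (Meet s t) = teval A v s \<curlywedge>\<^bsub>A\<^esub> teval A v t"
| "teval A v (Join s t) = teval A v s \<curlyvee>\<^bsub>A\<^esub> teval A v t"

definition term_hoop :: "nat \<Rightarrow> hterm hoop" where
  "term_hoop n = \<lparr>carrier = {t. tvars t \<subseteq> {..<n}}, mult = Mult, one = One,
     imp = Imp, hmeet = Meet, hjoin = Join\<rparr>"

text \<open>
  The free \<open>n\<close>-generated Wajsberg hoop: the term algebra modulo the least congruence whose
  quotient is a Wajsberg hoop.  Its generators are the classes of \<open>Var i\<close> for \<open>i < n\<close>.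
\<close>

definition free_hoop :: "nat \<Rightarrow> hterm set hoop" where
  "free_hoop n = quotient_hoop (term_hoop n)
     (\<Inter>{\<theta>. congruence (term_hoop n) \<theta> \<and> wajsberg_hoop (quotient_hoop (term_hoop n) \<theta>)})"

definition finitely_presented :: "('a, 'c) hoop_scheme \<Rightarrow> bool" where
  "finitely_presented A \<longleftrightarrow>
     (\<exists>n R. finite R \<and> R \<subseteq> carrier (free_hoop n) \<times> carrier (free_hoop n) \<and>
        hoop_isomorphic A (quotient_hoop (free_hoop n) (generated_congruence (free_hoop n) R)))"

text \<open>
  The objects are the algebras carried by subsets of a given type \<open>'a\<close>.  Finitely presented hoops
  are countable, so every one of them has an isomorphic copy here as soon as \<open>'a\<close> is infinite.
\<close>

definition WH_fp :: "('a hoop, 'a \<Rightarrow> 'a) cat" where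
  "WH_fp = \<lparr>Obj = {A. wajsberg_hoop A \<and> finitely_presented A},
     Hom = hoop_hom,
     Ident = (\<lambda>A. \<lambda>x \<in> carrier A. x),
     Comp = (\<lambda>A B C g f. compose (carrier A) g f)\<rparr>"


section \<open>McNaughton functions and positive MV-algebras\<close>

record 'a mv = "'a hoop" +
  mvzero :: 'a

definition mv_hom :: "('a, 'c) mv_scheme \<Rightarrow> ('b, 'd) mv_scheme \<Rightarrow> ('a \<Rightarrow> 'b) set" where
  "mv_hom A B = {f \<in> hoop_hom A B. f (mvzero A) = mvzero B}"

definition standard_mv :: "real mv" where
  "standard_mv = \<lparr>carrier = {0..1}, mult = (\<lambda>x y. max 0 (x + y - 1)), one = 1,
     imp = (\<lambda>x y. min 1 (1 - x + y)), hmeet = min, hjoin = max, mvzero = 0\<rparr>"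

text \<open>
  \<open>pointwise_mv X S\<close> is the set \<open>S\<close> of functions from \<open>X\<close> to the unit interval with the pointwise
  operations; functions on \<open>X\<close> are extensional, i.e. undefined outside \<open>X\<close>.
\<close>

definition pointwise_mv :: "'p set \<Rightarrow> ('p \<Rightarrow> real) set \<Rightarrow> ('p \<Rightarrow> real) mv" where
  "pointwise_mv X S =
     \<lparr>carrier = S,
      mult = (\<lambda>f g. \<lambda>x \<in> X. f x \<otimes>\<^bsub>standard_mv\<^esub> g x),
      one = (\<lambda>x \<in> X. \<one>\<^bsub>standard_mv\<^esub>),
      imp = (\<lambda>f g. \<lambda>x \<in> X. f x \<rightharpoonup>\<^bsub>standard_mv\<^esub> g x),
      hmeet = (\<lambda>f g. \<lambda>x \<in> X. f x \<curlywedge>\<^bsub>standard_mv\<^esub> g x),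
      hjoin = (\<lambda>f g. \<lambda>x \<in> X. f x \<curlyvee>\<^bsub>standard_mv\<^esub> g x),
      mvzero = (\<lambda>x \<in> X. mvzero standard_mv)\<rparr>"

text \<open>
  Points of \<open>n\<close>-space are functions on \<open>nat\<close> vanishing from index \<open>n\<close> on.  The product topology
  on \<open>nat \<Rightarrow> real\<close> restricts to the Euclidean topology on them.
\<close>

type_synonym point = "nat \<Rightarrow> real"

definition space :: "nat \<Rightarrow> point set" where
  "space n = {x. \<forall>i \<ge> n. x i = 0}"

definition cube :: "nat \<Rightarrow> point set" where
  "cube n = {x \<in> space n. \<forall>i < n. x i \<in> {0..1}}"

definition ones :: "nat \<Rightarrow> point" where
  "ones n = (\<lambda>i. if i < n then 1 else 0)"

definition McNaughton :: "nat \<Rightarrow> (point \<Rightarrow> real) set" where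
  "McNaughton n = {f \<in> cube n \<rightarrow>\<^sub>E {0..1}. continuous_on (cube n) f \<and>
     (\<exists>L :: ((nat \<Rightarrow> int) \<times> int) set. finite L \<and>
        (\<forall>x \<in> cube n. \<exists>(a, b) \<in> L. f x = (\<Sum>i<n. of_int (a i) * x i) + of_int b))}"

definition free_mv :: "nat \<Rightarrow> (point \<Rightarrow> real) mv" where
  "free_mv n = pointwise_mv (cube n) (McNaughton n)"

definition proj :: "nat \<Rightarrow> nat \<Rightarrow> point \<Rightarrow> real" where
  "proj n i = (\<lambda>x \<in> cube n. x i)"

definition positive :: "nat \<Rightarrow> (point \<Rightarrow> real) set" where
  "positive n =
     {f \<in> carrier (free_mv n). \<exists>t. tvars t \<subseteq> {..<n} \<and> f = teval (free_mv n) (proj n) t}"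

definition conv_hull :: "point set \<Rightarrow> point set" where
  "conv_hull V = {x. \<exists>w. (\<forall>v \<in> V. 0 \<le> w v) \<and> (\<Sum>v \<in> V. w v) = 1 \<and>
     x = (\<lambda>i. \<Sum>v \<in> V. w v * v i)}"

definition rational_polyhedron :: "nat \<Rightarrow> point set \<Rightarrow> bool" where
  "rational_polyhedron n P \<longleftrightarrow>
     (\<exists>\<V>. finite \<V> \<and> (\<forall>V \<in> \<V>. finite V \<and> (\<forall>v \<in> V. v \<in> space n \<and> (\<forall>i. v i \<in> \<rat>))) \<and>
        P = (\<Union>V \<in> \<V>. conv_hull V))"

definition pointed_rational_polyhedron :: "nat \<Rightarrow> point set \<Rightarrow> bool" where
  "pointed_rational_polyhedron n P \<longleftrightarrow> rational_polyhedron n P \<and> P \<subseteq> cube n \<and> ones n \<in> P"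

definition restrict_mv :: "nat \<Rightarrow> point set \<Rightarrow> (point \<Rightarrow> real) mv" where
  "restrict_mv n P = pointwise_mv P ((\<lambda>f. restrict f P) ` carrier (free_mv n))"

definition positive_mv :: "(point \<Rightarrow> real) mv \<Rightarrow> bool" where
  "positive_mv A \<longleftrightarrow> (\<exists>n P. pointed_rational_polyhedron n P \<and> A = restrict_mv n P)"

text \<open>
  An object of the category is the algebra \<open>restrict_mv n P\<close> itself; it determines \<open>n\<close> and \<open>P\<close>
  (lemma \<open>restrict_mv_inject\<close> below), so positivity of a homomorphism is unambiguous.
\<close>

definition positive_hom ::
  "(point \<Rightarrow> real) mv \<Rightarrow> (point \<Rightarrow> real) mv \<Rightarrow> ((point \<Rightarrow> real) \<Rightarrow> point \<Rightarrow> real) set" where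
  "positive_hom A B = {\<alpha> \<in> mv_hom A B. \<exists>n P m Q.
     pointed_rational_polyhedron n P \<and> A = restrict_mv n P \<and>
     pointed_rational_polyhedron m Q \<and> B = restrict_mv m Q \<and>
     (\<forall>h \<in> positive n. \<exists>k \<in> positive m. \<alpha> (restrict h P) = restrict k Q)}"

definition MV_pos :: "((point \<Rightarrow> real) mv, (point \<Rightarrow> real) \<Rightarrow> point \<Rightarrow> real) cat" where
  "MV_pos = \<lparr>Obj = {A. positive_mv A},
     Hom = positive_hom,
     Ident = (\<lambda>A. \<lambda>x \<in> carrier A. x),
     Comp = (\<lambda>A B C g f. compose (carrier A) g f)\<rparr>"

lemma restrict_mv_inject:
  assumes "pointed_rational_polyhedron n P" "pointed_rational_polyhedron m Q"
    and eq: "restrict_mv n P = restrict_mv m Q"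
  shows "n = m \<and> P = Q"
proof
  have supp: "{x. one (restrict_mv k R) x \<noteq> mvzero (restrict_mv k R) x} = R" for k R
    by (auto simp: restrict_mv_def pointwise_mv_def standard_mv_def)
  show PQ: "P = Q"
    using supp[of n P] supp[of m Q] eq by simp
  have le: "k \<le> l" if "pointed_rational_polyhedron k P" "pointed_rational_polyhedron l P" for k l
  proof (rule ccontr)
    assume "\<not> k \<le> l"
    moreover have "ones k \<in> space l"
      using that by (auto simp: pointed_rational_polyhedron_def cube_def)
    ultimately show False
      by (auto simp: space_def ones_def dest!: spec[of _ l])
  qed
  show "n = m"
    using le assms(1,2) PQ by (auto intro: antisym)
qed

end

theory Submission
  imports Defs "HOL-Library.Multiset"
begin

text \<open>
  A pointed rational polyhedron \<open>P\<close> is sent to the Wajsberg hoop of positive functions restricted to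
  \<open>P\<close>; this is a fully faithful and essentially surjective functor.

  Essential surjectivity rests on completeness: a quasi-identity valid in the unit interval holds in
  every Wajsberg hoop, so the hoop presented by finitely many equations is the hoop of positive
  functions on their solution set.  By prime filters only chains matter; the complements of the
  elements of a chain generate a totally ordered group (the chain glued to itself along \<open>nat\<close>),
  and Fourier--Motzkin elimination maps any finite part of that group to the reals, preserving the
  strict inequalities.  The same elimination, over the reals, turns polyhedra into solution
  sets: every function built from integer affine ones by truncation is positive or the negation of a
  positive function, and the value at the point \<open>ones\<close> decides which.

  A hoop homomorphism between positive functions is substitution along a map of polyhedra with
  positive components, hence extends to all McNaughton functions.  The extension is unique because a
  homomorphism into the unit interval is evaluation at a point.
\<close>

section \<open>Wajsberg hoops and prime filters\<close>

text \<open>Two obstacles shape the argument. The ordered group of a chain need not be archimedean,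
  so in general it does not embed in the reals; a quasi-identity, however, mentions finitely many
  elements, and an integer functional on just those is enough. Complements are used because \<one>
  is the only constant of the signature: it becomes the zero of the group, and a chain without least
  element is treated like one that has it, except that sums never carry. On the MV side, a
  McNaughton function is not known in advance to be a term. Evaluation at a point is therefore
  obtained by squeezing a continuous function against bump functions, which are written with the
  available operations, and not from McNaughton's theorem. Finally, \<open>WH_fp\<close> has
  carriers inside a fixed type while positive functions are functions on points, so the functor
  carries each hoop along a chosen injection, and its quasi-inverse is made of choices as
  well.\<close>

context wajsberg_hoop
begin

section \<open>Order, residuation and prelinearity\<close>

abbreviation hle :: "'a \<Rightarrow> 'a \<Rightarrow> bool" (infix \<open>\<preceq>\<close> 50)
  where "x \<preceq> y \<equiv> x \<rightharpoonup> y = \<one>"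

declare imp_closed [simp] imp_self [simp]

lemma meet_closed [simp]: "\<lbrakk>x \<in> carrier A; y \<in> carrier A\<rbrakk> \<Longrightarrow> x \<curlywedge> y \<in> carrier A"
  by (simp add: hmeet_eq)

lemma join_closed [simp]: "\<lbrakk>x \<in> carrier A; y \<in> carrier A\<rbrakk> \<Longrightarrow> x \<curlyvee> y \<in> carrier A"
  by (simp add: hjoin_eq)

lemma le_antisym:
  assumes "x \<in> carrier A" "y \<in> carrier A" "x \<preceq> y" "y \<preceq> x"
  shows "x = y"
  using divisibility[of x y] assms by simp

lemma one_imp [simp]:
  assumes "x \<in> carrier A"
  shows "\<one> \<rightharpoonup> x = x"
proof (rule le_antisym)
  show "x \<preceq> \<one> \<rightharpoonup> x"
    using currying[of x \<one> x] assms by simp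
  show "\<one> \<rightharpoonup> x \<preceq> x"
    using currying[of "\<one> \<rightharpoonup> x" \<one> x] assms by simp
qed (use assms in auto)

text \<open>With \<open>u = x \<rightharpoonup> \<one>\<close>, divisibility gives
  \<open>x \<otimes> u = x\<close>, and currying then turns \<open>u\<close> into
  \<open>u \<rightharpoonup> u\<close>.\<close>

lemma imp_one [simp]:
  assumes "x \<in> carrier A"
  shows "x \<preceq> \<one>"
proof -
  let ?u = "x \<rightharpoonup> \<one>"
  have "x \<otimes> ?u = x"
    using divisibility[of x \<one>] assms by simp
  then have "?u = (?u \<otimes> x) \<rightharpoonup> \<one>"
    using assms by (simp add: m_comm)
  also have "\<dots> = \<one>"
    using assms currying[of ?u x \<one>] by simp
  finally show ?thesis .
qed

lemma mult_le_left [simp]: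
  assumes "x \<in> carrier A" "y \<in> carrier A"
  shows "x \<otimes> y \<preceq> y"
  using assms by (simp add: currying)

lemma mult_le_right [simp]:
  assumes "x \<in> carrier A" "y \<in> carrier A"
  shows "x \<otimes> y \<preceq> x"
  using mult_le_left[of y x] assms by (simp add: m_comm)

lemma le_imp [simp]:
  assumes "x \<in> carrier A" "y \<in> carrier A"
  shows "y \<preceq> x \<rightharpoonup> y"
  using assms currying[of y x y] by simp

lemma imp_swap:
  assumes "x \<in> carrier A" "y \<in> carrier A" "z \<in> carrier A"
  shows "x \<rightharpoonup> (y \<rightharpoonup> z) = y \<rightharpoonup> (x \<rightharpoonup> z)"
  using assms by (simp add: m_comm flip: currying)

text \<open>Divisibility writes \<open>x\<close> as
  \<open>(y \<rightharpoonup> x) \<otimes> y\<close> once \<open>x \<preceq> y\<close>; currying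
  then leaves an implication with conclusion \<open>y \<rightharpoonup> z\<close>, which is
  \<one>.\<close>

lemma le_trans:
  assumes "x \<in> carrier A" "y \<in> carrier A" "z \<in> carrier A" "x \<preceq> y" "y \<preceq> z"
  shows "x \<preceq> z"
proof -
  have "x = (y \<rightharpoonup> x) \<otimes> y"
    using divisibility[of x y] assms by (simp add: m_comm)
  then have "x \<rightharpoonup> z = (y \<rightharpoonup> x) \<rightharpoonup> (y \<rightharpoonup> z)"
    using assms currying[of "y \<rightharpoonup> x" y z] by simp
  then show ?thesis
    using assms by simp
qed

lemma mp_le [simp]:
  assumes "x \<in> carrier A" "y \<in> carrier A"
  shows "x \<otimes> (x \<rightharpoonup> y) \<preceq> y" "(x \<rightharpoonup> y) \<otimes> x \<preceq> y"
proof -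
  show "(x \<rightharpoonup> y) \<otimes> x \<preceq> y"
    using assms by (subst currying) auto
  then show "x \<otimes> (x \<rightharpoonup> y) \<preceq> y"
    using assms by (simp add: m_comm)
qed

lemma mult_mono1:
  assumes "x \<in> carrier A" "y \<in> carrier A" "z \<in> carrier A" "x \<preceq> y"
  shows "x \<otimes> z \<preceq> y \<otimes> z"
proof -
  have "y \<preceq> z \<rightharpoonup> y \<otimes> z"
    using assms by (simp flip: currying)
  then have "x \<preceq> z \<rightharpoonup> y \<otimes> z"
    using assms le_trans by (metis imp_closed m_closed)
  then show ?thesis
    using assms by (simp add: currying)
qed

lemma imp_mono2:
  assumes "x \<in> carrier A" "y \<in> carrier A" "z \<in> carrier A" "x \<preceq> y"
  shows "z \<rightharpoonup> x \<preceq> z \<rightharpoonup> y"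
proof -
  have "(z \<rightharpoonup> x) \<otimes> z \<preceq> y"
    using assms le_trans[of "(z \<rightharpoonup> x) \<otimes> z" x y] by simp
  then show ?thesis
    using assms by (simp add: currying)
qed

lemma imp_anti1:
  assumes "x \<in> carrier A" "y \<in> carrier A" "z \<in> carrier A" "x \<preceq> y"
  shows "y \<rightharpoonup> z \<preceq> x \<rightharpoonup> z"
proof -
  have "x \<otimes> (y \<rightharpoonup> z) \<preceq> y \<otimes> (y \<rightharpoonup> z)"
    using assms by (simp add: mult_mono1)
  then have "x \<otimes> (y \<rightharpoonup> z) \<preceq> z"
    using assms le_trans[of "x \<otimes> (y \<rightharpoonup> z)" "y \<otimes> (y \<rightharpoonup> z)" z] by simp
  then show ?thesis
    using assms by (simp add: m_comm flip: currying)
qed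

lemma le_imp_imp [simp]:
  assumes "x \<in> carrier A" "y \<in> carrier A"
  shows "x \<preceq> (x \<rightharpoonup> y) \<rightharpoonup> y"
  using assms by (subst imp_swap) auto

lemma imp_imp_eq:
  assumes "x \<in> carrier A" "y \<in> carrier A" "y \<preceq> x"
  shows "(x \<rightharpoonup> y) \<rightharpoonup> y = x"
  using assms wajsberg[of x y] by simp

lemma mult_imp_eq:
  assumes "x \<in> carrier A" "y \<in> carrier A" "y \<preceq> x"
  shows "x \<otimes> (x \<rightharpoonup> y) = y"
  using assms divisibility[of x y] by simp

lemma join_ub1: "\<lbrakk>x \<in> carrier A; y \<in> carrier A\<rbrakk> \<Longrightarrow> x \<preceq> x \<curlyvee> y"
  by (simp add: hjoin_eq)

lemma join_ub2: "\<lbrakk>x \<in> carrier A; y \<in> carrier A\<rbrakk> \<Longrightarrow> y \<preceq> x \<curlyvee> y"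
  by (simp add: hjoin_eq)

text \<open>Antitonicity, used twice, bounds the join by
  \<open>(z \<rightharpoonup> y) \<rightharpoonup> y\<close>, and the Wajsberg law collapses this to
  \<open>z\<close> because \<open>y \<preceq> z\<close>.\<close>

lemma join_lub:
  assumes "x \<in> carrier A" "y \<in> carrier A" "z \<in> carrier A" "x \<preceq> z" "y \<preceq> z"
  shows "x \<curlyvee> y \<preceq> z"
proof -
  have "(x \<rightharpoonup> y) \<rightharpoonup> y \<preceq> (z \<rightharpoonup> y) \<rightharpoonup> y"
    using assms by (simp add: imp_anti1)
  then show ?thesis
    using assms by (simp add: hjoin_eq imp_imp_eq)
qed

lemma imp_meet:
  assumes "x \<in> carrier A" "y \<in> carrier A"
  shows "x \<rightharpoonup> x \<otimes> (x \<rightharpoonup> y) = x \<rightharpoonup> y"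
proof (rule le_antisym)
  have "(x \<rightharpoonup> y) \<otimes> x \<preceq> x \<otimes> (x \<rightharpoonup> y)"
    using assms by (simp add: m_comm)
  then show "x \<rightharpoonup> y \<preceq> x \<rightharpoonup> x \<otimes> (x \<rightharpoonup> y)"
    using assms by (simp add: currying)
qed (use assms in \<open>auto intro: imp_mono2\<close>)

text \<open>Both implications are complements relative to the meet \<open>m\<close>. Swapping
  premises and cancelling a double complement above \<open>m\<close> gives \<open>(x
  \<rightharpoonup> y) \<rightharpoonup> (y \<rightharpoonup> x) = y \<rightharpoonup> x\<close>, so
  the join is an implication from an element to itself.\<close>

lemma prelinear:
  assumes "x \<in> carrier A" "y \<in> carrier A"
  shows "(x \<rightharpoonup> y) \<curlyvee> (y \<rightharpoonup> x) = \<one>"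
proof -
  define m where "m = x \<otimes> (x \<rightharpoonup> y)"
  have m: "m \<in> carrier A" "m \<preceq> x" "m \<preceq> y"
    using assms by (auto simp: m_def)
  have a: "x \<rightharpoonup> y = x \<rightharpoonup> m"
    using assms by (simp add: m_def imp_meet)
  have b: "y \<rightharpoonup> x = y \<rightharpoonup> m"
    using assms imp_meet[of y x] by (simp add: m_def divisibility)
  have "(x \<rightharpoonup> m) \<rightharpoonup> (y \<rightharpoonup> m) = y \<rightharpoonup> ((x \<rightharpoonup> m) \<rightharpoonup> m)"
    using assms m by (simp add: imp_swap)
  also have "\<dots> = y \<rightharpoonup> m"
    using assms m b by (simp add: imp_imp_eq)
  finally have "(x \<rightharpoonup> y) \<rightharpoonup> (y \<rightharpoonup> x) = y \<rightharpoonup> x"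
    by (simp add: a b)
  then show ?thesis
    using assms by (simp add: hjoin_eq)
qed

text \<open>Let \<open>z\<close> be the join in question. Both \<open>p\<close> and \<open>q\<close>
  lie below \<open>r \<rightharpoonup> z\<close>, hence so does \<one>; then \<open>r\<close> as
  well as \<open>p\<close> lies below \<open>z\<close>.\<close>

lemma join_one_mult:
  assumes c: "p \<in> carrier A" "q \<in> carrier A" "r \<in> carrier A"
    and "p \<curlyvee> q = \<one>" "p \<curlyvee> r = \<one>"
  shows "p \<curlyvee> (q \<otimes> r) = \<one>"
proof -
  let ?z = "p \<curlyvee> (q \<otimes> r)"
  have z: "?z \<in> carrier A" "p \<preceq> ?z" "q \<otimes> r \<preceq> ?z"
    using c by (auto simp: join_ub1 join_ub2)
  have "p \<preceq> r \<rightharpoonup> ?z"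
    using le_trans[of p ?z "r \<rightharpoonup> ?z"] z c by simp
  moreover have "q \<preceq> r \<rightharpoonup> ?z"
    using z c by (simp add: currying)
  ultimately have "r \<preceq> ?z"
    using join_lub[of p q "r \<rightharpoonup> ?z"] assms z by simp
  then show ?thesis
    using join_lub[of p r ?z] assms z by simp
qed

lemma join_comm:
  assumes "x \<in> carrier A" "y \<in> carrier A"
  shows "x \<curlyvee> y = y \<curlyvee> x"
  using assms by (simp add: hjoin_eq wajsberg)

lemma join_one_pow:
  fixes k :: nat
  assumes "p \<in> carrier A" "q \<in> carrier A" "p \<curlyvee> q = \<one>"
  shows "p \<curlyvee> (q [^] k) = \<one>"
proof (induction k)
  case 0
  then show ?case
    using assms by (simp add: hjoin_eq)
next
  case (Suc k)
  then show ?case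
    using assms by (simp add: join_one_mult)
qed

lemma join_one_pows:
  fixes k l :: nat
  assumes "p \<in> carrier A" "q \<in> carrier A" "p \<curlyvee> q = \<one>"
  shows "(p [^] k) \<curlyvee> (q [^] l) = \<one>"
  using assms join_one_pow[of p q l] join_one_pow[of "q [^] l" p k] by (simp add: join_comm)

lemma mult_mono:
  assumes "x \<in> carrier A" "y \<in> carrier A" "x' \<in> carrier A" "y' \<in> carrier A" "x \<preceq> x'" "y \<preceq> y'"
  shows "x \<otimes> y \<preceq> x' \<otimes> y'"
proof -
  have "x \<otimes> y \<preceq> x' \<otimes> y"
    using assms by (simp add: mult_mono1)
  moreover have "x' \<otimes> y \<preceq> x' \<otimes> y'"
    using assms mult_mono1[of y y' x'] by (simp add: m_comm)
  ultimately show ?thesis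
    using assms by (meson le_trans m_closed)
qed

section \<open>Implicative filters and prime filters\<close>

definition hfilter :: "'a set \<Rightarrow> bool" where
  "hfilter F \<longleftrightarrow> F \<subseteq> carrier A \<and> \<one> \<in> F \<and>
     (\<forall>x y. x \<in> F \<longrightarrow> y \<in> carrier A \<longrightarrow> x \<rightharpoonup> y \<in> F \<longrightarrow> y \<in> F)"

lemma filter_carrier: "\<lbrakk>hfilter F; x \<in> F\<rbrakk> \<Longrightarrow> x \<in> carrier A"
  unfolding hfilter_def by (elim conjE subsetD)

lemma filter_one: "hfilter F \<Longrightarrow> \<one> \<in> F"
  unfolding hfilter_def by (elim conjE)

lemma filter_mp: "\<lbrakk>hfilter F; x \<in> F; y \<in> carrier A; x \<rightharpoonup> y \<in> F\<rbrakk> \<Longrightarrow> y \<in> F"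
  unfolding hfilter_def by blast

lemma filter_up: "\<lbrakk>hfilter F; x \<in> F; y \<in> carrier A; x \<preceq> y\<rbrakk> \<Longrightarrow> y \<in> F"
  using filter_mp filter_one by metis

lemma filter_mult:
  assumes "hfilter F" "x \<in> F" "y \<in> F"
  shows "x \<otimes> y \<in> F"
proof -
  have c: "x \<in> carrier A" "y \<in> carrier A"
    using assms by (auto intro: filter_carrier)
  have "x \<rightharpoonup> (y \<rightharpoonup> x \<otimes> y) = \<one>"
    using c by (simp flip: currying)
  then have "y \<rightharpoonup> x \<otimes> y \<in> F"
    using filter_up[OF assms(1,2), of "y \<rightharpoonup> x \<otimes> y"] c by simp
  then show ?thesis
    using filter_mp[OF assms(1,3)] c by simp
qed

text \<open>The set is the filter generated by \<open>F\<close> and \<open>p\<close>. Under modus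
  ponens the exponents add, since the two premises consume \<open>k\<close> and \<open>l\<close>
  copies of \<open>p\<close>.\<close>

lemma filter_extend:
  assumes F: "hfilter F" and p: "p \<in> carrier A"
  shows "hfilter {z \<in> carrier A. \<exists>k::nat. p [^] k \<rightharpoonup> z \<in> F}" (is "hfilter ?G")
    and "F \<subseteq> {z \<in> carrier A. \<exists>k::nat. p [^] k \<rightharpoonup> z \<in> F}"
    and "p \<in> {z \<in> carrier A. \<exists>k::nat. p [^] k \<rightharpoonup> z \<in> F}"
proof -
  have Fc: "x \<in> carrier A" if "x \<in> F" for x
    using that F by (simp add: filter_carrier)
  have one: "\<one> \<in> F"
    using F by (rule filter_one)
  show sub: "F \<subseteq> ?G"
  proof
    fix x assume "x \<in> F"
    then have "p [^] (0::nat) \<rightharpoonup> x \<in> F"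
      using Fc by simp
    then show "x \<in> ?G"
      using Fc \<open>x \<in> F\<close> by blast
  qed
  have "p [^] (1::nat) \<rightharpoonup> p \<in> F"
    using p one by simp
  then show "p \<in> ?G"
    using p by blast
  show "hfilter ?G"
    unfolding hfilter_def
  proof (intro conjI allI impI)
    show "\<one> \<in> ?G"
      using one sub by blast
    fix x y
    assume "x \<in> ?G" and y: "y \<in> carrier A" and "x \<rightharpoonup> y \<in> ?G"
    then obtain k l :: nat where x: "x \<in> carrier A" and kl: "p [^] k \<rightharpoonup> x \<in> F" "p [^] l \<rightharpoonup> (x \<rightharpoonup> y) \<in> F"
      by blast
    let ?u = "(p [^] k \<rightharpoonup> x) \<otimes> (p [^] l \<rightharpoonup> (x \<rightharpoonup> y))"
    have u: "?u \<in> F"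
      using kl F by (rule filter_mult[rotated 1])
    have "((p [^] k \<rightharpoonup> x) \<otimes> p [^] k) \<otimes> ((p [^] l \<rightharpoonup> (x \<rightharpoonup> y)) \<otimes> p [^] l) \<preceq> x \<otimes> (x \<rightharpoonup> y)"
      using x y p by (intro mult_mono) auto
    moreover have "((p [^] k \<rightharpoonup> x) \<otimes> p [^] k) \<otimes> ((p [^] l \<rightharpoonup> (x \<rightharpoonup> y)) \<otimes> p [^] l)
        = ?u \<otimes> p [^] (k + l)"
      using x y p by (simp add: m_ac flip: nat_pow_mult)
    ultimately have "?u \<otimes> p [^] (k + l) \<preceq> x \<otimes> (x \<rightharpoonup> y)"
      by simp
    then have "?u \<otimes> p [^] (k + l) \<preceq> y"
      using x y p le_trans[of "?u \<otimes> p [^] (k + l)" "x \<otimes> (x \<rightharpoonup> y)" y] by simp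
    then have "?u \<preceq> p [^] (k + l) \<rightharpoonup> y"
      using x y p by (simp add: currying)
    then have "p [^] (k + l) \<rightharpoonup> y \<in> F"
      using filter_up[OF F u] p y by simp
    then show "y \<in> ?G"
      using y by blast
  qed auto
qed

text \<open>Modulo \<open>F\<close> both powers imply \<open>a\<close>, hence so does their join,
  which is \<one> by \<open>join_one_pows\<close>.\<close>

lemma filter_pows_join:
  fixes k l :: nat
  assumes F: "hfilter F" and c: "p \<in> carrier A" "q \<in> carrier A" "a \<in> carrier A"
    and pq: "p \<curlyvee> q = \<one>" and "p [^] k \<rightharpoonup> a \<in> F" "q [^] l \<rightharpoonup> a \<in> F"
  shows "a \<in> F"
proof -
  let ?u = "(p [^] k \<rightharpoonup> a) \<otimes> (q [^] l \<rightharpoonup> a)"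
  have u: "?u \<in> F"
    using assms by (intro filter_mult) auto
  have "p [^] k \<preceq> ?u \<rightharpoonup> a"
  proof -
    have "?u \<preceq> p [^] k \<rightharpoonup> a"
      using c by simp
    then show ?thesis
      using c by (subst imp_swap) auto
  qed
  moreover have "q [^] l \<preceq> ?u \<rightharpoonup> a"
  proof -
    have "?u \<preceq> q [^] l \<rightharpoonup> a"
      using c by simp
    then show ?thesis
      using c by (subst imp_swap) auto
  qed
  ultimately have "(p [^] k) \<curlyvee> (q [^] l) \<preceq> ?u \<rightharpoonup> a"
    using c by (intro join_lub) auto
  then have "?u \<preceq> a"
    using c pq by (simp add: join_one_pows)
  then show ?thesis
    using filter_up[OF F u] c by simp
qed

text \<open>A filter maximal among those avoiding \<open>a\<close> exists by Zorn's lemma. If it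
  contained neither implication, adjoining either of them would bring in \<open>a\<close>, and then
  \<open>prelinear\<close> would put \<open>a\<close> into the filter already.\<close>

lemma prime_filter_exists:
  assumes a: "a \<in> carrier A" "a \<noteq> \<one>"
  obtains F where "hfilter F" "a \<notin> F"
    "\<And>x y. \<lbrakk>x \<in> carrier A; y \<in> carrier A\<rbrakk> \<Longrightarrow> x \<rightharpoonup> y \<in> F \<or> y \<rightharpoonup> x \<in> F"
proof -
  let ?S = "{F. hfilter F \<and> a \<notin> F}"
  have base: "{\<one>} \<in> ?S"
    using a unfolding hfilter_def by simp
  have "\<exists>U\<in>?S. \<forall>X\<in>C. X \<subseteq> U" if C: "subset.chain ?S C" for C
  proof (cases "C = {}")
    case True
    then show ?thesis
      using base by blast
  next
    case False
    have CS: "hfilter X \<and> a \<notin> X" if "X \<in> C" for X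
      using C that by (auto simp: subset.chain_def)
    have "hfilter (\<Union>C)"
      unfolding hfilter_def
    proof (intro conjI allI impI)
      show "\<Union>C \<subseteq> carrier A"
        using CS filter_carrier by blast
      show "\<one> \<in> \<Union>C"
        using CS False filter_one by blast
      fix x y
      assume "x \<in> \<Union>C" "y \<in> carrier A" "x \<rightharpoonup> y \<in> \<Union>C"
      then obtain X Y where XY: "X \<in> C" "Y \<in> C" "x \<in> X" "x \<rightharpoonup> y \<in> Y"
        by blast
      then have "X \<subseteq> Y \<or> Y \<subseteq> X"
        using C by (auto simp: subset.chain_def)
      then obtain Z where "Z \<in> C" "x \<in> Z" "x \<rightharpoonup> y \<in> Z"
        using XY by blast
      then show "y \<in> \<Union>C"
        using CS \<open>y \<in> carrier A\<close> filter_mp by blast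
    qed
    then show ?thesis
      using CS by blast
  qed
  then obtain M where M: "hfilter M" "a \<notin> M" and max: "\<And>X. \<lbrakk>hfilter X; a \<notin> X; M \<subseteq> X\<rbrakk> \<Longrightarrow> X = M"
    using subset_Zorn[of ?S] by auto
  have "x \<rightharpoonup> y \<in> M \<or> y \<rightharpoonup> x \<in> M" if xy: "x \<in> carrier A" "y \<in> carrier A" for x y
  proof (rule ccontr)
    assume neg: "\<not> (x \<rightharpoonup> y \<in> M \<or> y \<rightharpoonup> x \<in> M)"
    have ext: "\<exists>k::nat. p [^] k \<rightharpoonup> a \<in> M" if p: "p \<in> carrier A" "p \<notin> M" for p
    proof (rule ccontr)
      let ?G = "{z \<in> carrier A. \<exists>k::nat. p [^] k \<rightharpoonup> z \<in> M}"
      assume "\<not> ?thesis"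
      then have "a \<notin> ?G"
        by simp
      then have "?G = M"
        using max filter_extend[OF M(1) p(1)] by blast
      then show False
        using filter_extend(3)[OF M(1) p(1)] p by simp
    qed
    obtain k l :: nat where "(x \<rightharpoonup> y) [^] k \<rightharpoonup> a \<in> M" "(y \<rightharpoonup> x) [^] l \<rightharpoonup> a \<in> M"
      using ext[of "x \<rightharpoonup> y"] ext[of "y \<rightharpoonup> x"] xy neg by auto
    then have "a \<in> M"
      using filter_pows_join[OF M(1) _ _ a(1) prelinear[OF xy]] xy imp_closed by blast
    then show False
      using M by simp
  qed
  then show ?thesis
    using that M by blast
qed

end

section \<open>Wajsberg chains and their ordered groups\<close>

locale wajsberg_chain = wajsberg_hoop +
  assumes total: "\<lbrakk>x \<in> carrier A; y \<in> carrier A\<rbrakk> \<Longrightarrow> x \<rightharpoonup> y = \<one> \<or> y \<rightharpoonup> x = \<one>"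
    and nontrivial: "\<exists>c \<in> carrier A. c \<noteq> \<one>"
begin

text \<open>In terms of complements: the complement is shorter than the unit. At most one element of
  the carrier fails this, and none does in a chain without least element, so both kinds of chain are
  treated together.\<close>

definition nonleast :: "'a \<Rightarrow> bool" where
  "nonleast a \<longleftrightarrow> a \<in> carrier A \<and> (\<exists>c \<in> carrier A. c \<preceq> a \<and> c \<noteq> a)"

lemma nonleast_carrier [simp]: "nonleast a \<Longrightarrow> a \<in> carrier A"
  by (simp add: nonleast_def)

lemma nonleast_one [simp]: "nonleast \<one>"
  using nontrivial imp_one unfolding nonleast_def by blast

lemma least_le:
  assumes "a \<in> carrier A" "c \<in> carrier A" "\<not> nonleast a"
  shows "a \<preceq> c"
  using assms total[of a c] unfolding nonleast_def by auto

lemma least_unique: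
  assumes "a \<in> carrier A" "c \<in> carrier A" "\<not> nonleast a" "\<not> nonleast c"
  shows "a = c"
  using assms by (simp add: le_antisym least_le)

lemma nonleast_up:
  assumes "nonleast a" "b \<in> carrier A" "a \<preceq> b"
  shows "nonleast b"
proof (rule ccontr)
  assume "\<not> nonleast b"
  then have "b \<preceq> a"
    using assms by (simp add: least_le)
  then have "a = b"
    using assms le_antisym[of a b] by simp
  then show False
    using assms \<open>\<not> nonleast b\<close> by simp
qed

text \<open>Below \<open>c\<close> the hoop looks like an MV-algebra; \<open>a \<rightharpoonup> (a \<otimes> b \<squnion> c) = b \<squnion> (a \<rightharpoonup> c)\<close>, and in a chain
  the right-hand side is \<open>b\<close> unless the product is cut off at \<open>c\<close>.\<close>

lemma mult_cancel:
  assumes c: "a \<in> carrier A" "b \<in> carrier A" and "nonleast (a \<otimes> b)"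
  shows "a \<rightharpoonup> a \<otimes> b = b"
proof -
  obtain c where c': "c \<in> carrier A" "c \<preceq> a \<otimes> b" "c \<noteq> a \<otimes> b"
    using assms unfolding nonleast_def by blast
  have "a \<rightharpoonup> a \<otimes> b = a \<rightharpoonup> ((a \<otimes> b \<rightharpoonup> c) \<rightharpoonup> c)"
    using c c' by (simp add: imp_imp_eq)
  also have "\<dots> = (a \<otimes> b \<rightharpoonup> c) \<rightharpoonup> (a \<rightharpoonup> c)"
    using c c' by (simp add: imp_swap)
  also have "\<dots> = (b \<rightharpoonup> (a \<rightharpoonup> c)) \<rightharpoonup> (a \<rightharpoonup> c)"
    using c c' by (simp add: m_comm[of a b] currying)
  finally have eq: "a \<rightharpoonup> a \<otimes> b = (b \<rightharpoonup> (a \<rightharpoonup> c)) \<rightharpoonup> (a \<rightharpoonup> c)" .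
  show ?thesis
  proof (cases "b \<preceq> a \<rightharpoonup> c")
    case True
    then have "a \<otimes> b \<preceq> c"
      using c c' by (simp add: m_comm[of a b] currying)
    then show ?thesis
      using c c' le_antisym[of c "a \<otimes> b"] by simp
  next
    case False
    then have "a \<rightharpoonup> c \<preceq> b"
      using c c' total[of b "a \<rightharpoonup> c"] by auto
    then show ?thesis
      using eq c c' by (simp add: imp_imp_eq)
  qed
qed

lemma mult_inject:
  assumes "a \<in> carrier A" "b \<in> carrier A" "b' \<in> carrier A" "nonleast (a \<otimes> b)" "a \<otimes> b = a \<otimes> b'"
  shows "b = b'"
  using mult_cancel[of a b] mult_cancel[of a b'] assms by simp

text \<open>With \<open>y\<^sub>a = 1 - a\<close>, a state \<open>(k, a)\<close> stands for the number \<open>k + y\<^sub>a\<close>; elements with \<open>y\<^sub>a = 1\<close>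
  are excluded, so that the representation is unique, and \<open>step b\<close> adds \<open>y\<^sub>b\<close>.\<close>

definition step :: "'a \<Rightarrow> nat \<times> 'a \<Rightarrow> nat \<times> 'a" where
  "step b s = (if b \<in> carrier A \<and> nonleast (snd s) then
     (if nonleast (snd s \<otimes> b) then (fst s, snd s \<otimes> b)
      else (Suc (fst s), (snd s \<rightharpoonup> snd s \<otimes> b) \<rightharpoonup> b)) else s)"

text \<open>Complements of nonleast elements are less than 1, so the order of the numbers
  \<open>k + y\<^sub>a\<close> is lexicographic; the second component is reversed because a smaller
  element has a larger complement.\<close>

definition slt :: "nat \<times> 'a \<Rightarrow> nat \<times> 'a \<Rightarrow> bool" where
  "slt s t \<longleftrightarrow> fst s < fst t \<or> fst s = fst t \<and> snd t \<preceq> snd s \<and> snd t \<noteq> snd s"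

text \<open>When \<open>a \<otimes> b\<close> is least,
  \<open>a \<rightharpoonup> a \<otimes> b\<close> is the negation of \<open>a\<close>, and the
  residue is the sum of \<open>a\<close> and \<open>b\<close>, whose complement is
  \<open>y\<^sub>a + y\<^sub>b - 1\<close>. If the residue were least, \<open>b\<close> below it
  would be least too, and the residue would collapse to \<open>a\<close>.\<close>

lemma carry_nonleast:
  assumes a: "nonleast a" and b: "b \<in> carrier A" and l: "\<not> nonleast (a \<otimes> b)"
  shows "nonleast ((a \<rightharpoonup> a \<otimes> b) \<rightharpoonup> b)"
proof (rule ccontr)
  define z where "z = a \<otimes> b"
  have z: "z \<in> carrier A" "\<not> nonleast z"
    using assms by (auto simp: z_def)
  let ?r = "(a \<rightharpoonup> z) \<rightharpoonup> b"
  assume "\<not> nonleast ((a \<rightharpoonup> a \<otimes> b) \<rightharpoonup> b)"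
  then have r: "\<not> nonleast ?r"
    by (simp add: z_def)
  have "b \<preceq> ?r"
    using a b z by simp
  then have "\<not> nonleast b"
    using nonleast_up[of b ?r] a b z r by auto
  then have "b = z"
    using least_unique b z by auto
  then have "?r = a"
    using a z imp_imp_eq[of a z] by (simp add: least_le)
  then show False
    using r a by simp
qed

lemma step_valid: "nonleast (snd s) \<Longrightarrow> nonleast (snd (step b s))"
  by (auto simp: step_def carry_nonleast)

text \<open>If the triple product is nonleast, nothing carries. Otherwise it is the least element
  and supplies a negation \<open>n\<close>, and the cases record which of the two first steps carry;
  both orders represent \<open>k + y\<^sub>a + y\<^sub>b + y\<^sub>c\<close>.\<close>

lemma step_commute: "step c (step b s) = step b (step c s)"
proof (cases "b \<in> carrier A \<and> c \<in> carrier A \<and> nonleast (snd s)")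
  case False
  then show ?thesis
    by (auto simp: step_def)
next
  case True
  obtain k a where s: "s = (k, a)"
    by (cases s)
  have b: "b \<in> carrier A" and c: "c \<in> carrier A" and na: "nonleast a"
    using True s by auto
  have a: "a \<in> carrier A"
    using na by simp
  show ?thesis
  proof (cases "nonleast (a \<otimes> b \<otimes> c)")
    case True
    have "nonleast (a \<otimes> b)"
      using nonleast_up[OF True, of "a \<otimes> b"] a b c by simp
    moreover have "nonleast (a \<otimes> c)"
      using nonleast_up[OF True, of "a \<otimes> c"] a b c mult_le_right[of "a \<otimes> c" b] by (simp add: m_ac)
    moreover have "a \<otimes> b \<otimes> c = a \<otimes> c \<otimes> b"
      using a b c by (simp add: m_ac)
    ultimately show ?thesis
      using True a b c na by (simp add: s step_def)
  next
    case False
    define z where "z = a \<otimes> b \<otimes> c"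
    have z: "z \<in> carrier A" "\<not> nonleast z"
      using False a b c by (auto simp: z_def)
    have zle: "z \<preceq> x" if "x \<in> carrier A" for x
      using that z by (simp add: least_le)
    have eqz: "x = z" if "x \<in> carrier A" "\<not> nonleast x" for x
      using least_unique that z by blast
    \<comment> \<open>Since \<open>z\<close> is the least element, this is an order-reversing
      involution of the whole chain.\<close>
    define n where "n x = x \<rightharpoonup> z" for x
    have n: "n x \<in> carrier A" if "x \<in> carrier A" for x
      using that z by (simp add: n_def)
    have nn: "n (n x) = x" if "x \<in> carrier A" for x
      using that z zle by (simp add: n_def imp_imp_eq)
    have imp_n: "x \<rightharpoonup> y = n (x \<otimes> n y)" if "x \<in> carrier A" "y \<in> carrier A" for x y
      using that z nn[of y] n[of y] by (simp add: n_def currying)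
    have n_anti: "n y \<preceq> n x" if "x \<in> carrier A" "y \<in> carrier A" "x \<preceq> y" for x y
      using that z by (simp add: n_def imp_anti1)
    have n_mult: "n (x \<otimes> y) = x \<rightharpoonup> n y" if "x \<in> carrier A" "y \<in> carrier A" for x y
      using that z by (simp add: n_def currying)
    \<comment> \<open>In numbers, an uncut product means x + y > 1; the next fact,
      \<open>lst\<close>, is the opposite case x + y \<le> 1.\<close>
    have nonl: "n y \<preceq> x" if "x \<in> carrier A" "y \<in> carrier A" "nonleast (x \<otimes> y)" for x y
    proof (rule ccontr)
      assume "\<not> ?thesis"
      then have "x \<preceq> n y"
        using total[of "n y" x] that n by auto
      then have "x \<otimes> y \<preceq> z"
        using that z by (simp add: n_def currying)
      then show False
        using nonleast_up[of "x \<otimes> y" z] that z by simp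
    qed
    have lst: "y \<preceq> n x" if "x \<in> carrier A" "y \<in> carrier A" "\<not> nonleast (x \<otimes> y)" for x y
    proof -
      have "y \<otimes> x \<preceq> z"
        using eqz[of "x \<otimes> y"] that z by (simp add: m_comm)
      then show ?thesis
        using that z by (simp add: n_def currying)
    qed
    have carry: "step y (l, x) = (Suc l, n x \<rightharpoonup> y)"
      if "nonleast x" "y \<in> carrier A" "\<not> nonleast (x \<otimes> y)" for x y l
      using that eqz[of "x \<otimes> y"] by (simp add: step_def n_def)
    have nocarry: "step y (l, x) = (l, x \<otimes> y)"
      if "nonleast x" "y \<in> carrier A" "nonleast (x \<otimes> y)" for x y l
      using that by (simp add: step_def)
    \<comment> \<open>Here \<open>x\<close> carries at once and \<open>y\<close> does not. Because
      \<open>n a = y \<otimes> d\<close>, the residue \<open>r\<close> equals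
      \<open>y \<rightharpoonup> (d \<rightharpoonup> x)\<close>, and divisibility reduces
      \<open>r \<otimes> y\<close> to \<open>d \<rightharpoonup> x\<close>, which is the residue of
      the opposite order.\<close>
    have one_side: "step y (step x s) = step x (step y s)"
      if x: "x \<in> carrier A" "\<not> nonleast (a \<otimes> x)" and y: "y \<in> carrier A" "nonleast (a \<otimes> y)" for x y
    proof -
      define d where "d = a \<rightharpoonup> n y"
      define r where "r = n a \<rightharpoonup> x"
      have d: "d \<in> carrier A" and r: "r \<in> carrier A"
        using a x y n by (auto simp: d_def r_def)
      have ny: "n y \<preceq> a"
        using nonl[of a y] a y by simp
      then have "n a \<preceq> y"
        using n_anti[of "n y" a] nn[of y] a y n by simp
      then have "n a = y \<otimes> (y \<rightharpoonup> n a)"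
        using a y n by (simp add: mult_imp_eq)
      then have na_eq: "n a = y \<otimes> d"
        using a y n_mult[of y a] n_mult[of a y] by (simp add: d_def m_comm)
      have x_le: "x \<preceq> n a"
        using lst a x by simp
      have "d \<rightharpoonup> n a = n (d \<otimes> a)"
        using d a by (simp add: n_mult)
      also have "d \<otimes> a = n y"
        using ny a y n by (simp add: d_def m_comm mult_imp_eq)
      finally have "d \<rightharpoonup> n a = y"
        using nn y by simp
      then have dx: "d \<rightharpoonup> x \<preceq> y"
        using imp_mono2[of x "n a" d] x_le d a x n by simp
      have "r = y \<rightharpoonup> (d \<rightharpoonup> x)"
        using na_eq d x y by (simp add: r_def currying)
      then have ry: "r \<otimes> y = d \<rightharpoonup> x"
        using dx d x y by (simp add: m_comm mult_imp_eq)
      have ayx: "\<not> nonleast (a \<otimes> y \<otimes> x)"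
      proof
        assume "nonleast (a \<otimes> y \<otimes> x)"
        then have "nonleast (a \<otimes> x)"
          using nonleast_up[of "a \<otimes> y \<otimes> x" "a \<otimes> x"] mult_le_right[of "a \<otimes> x" y] a x y
          by (simp add: m_ac)
        then show False
          using x by simp
      qed
      have d_eq: "n (a \<otimes> y) = d"
        using a y by (simp add: n_mult d_def)
      have ndx: "nonleast (d \<rightharpoonup> x)"
        using carry_nonleast[OF y(2) x(1) ayx] eqz[of "a \<otimes> y \<otimes> x"] ayx a x y d_eq
        by (simp add: n_def)
      have nr: "nonleast r"
        using carry_nonleast[OF na x] eqz[of "a \<otimes> x"] a x by (simp add: n_def r_def)
      have "step y (step x s) = step y (Suc k, r)"
        using carry[of a x] na x by (simp add: s r_def)
      also have "\<dots> = (Suc k, d \<rightharpoonup> x)"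
        using nocarry[of r y] nr ry ndx y by simp
      also have "\<dots> = step x (k, a \<otimes> y)"
        using carry[of "a \<otimes> y" x] x y ayx d_eq by simp
      also have "\<dots> = step x (step y s)"
        using nocarry[of a y] na y by (simp add: s)
      finally show ?thesis .
    qed
    show ?thesis
    proof (cases "nonleast (a \<otimes> b)"; cases "nonleast (a \<otimes> c)")
      \<comment> \<open>Each order carries only in its second step; the residues are the negations
        of products that both equal \<open>a \<otimes> (a \<rightharpoonup> n b) \<otimes> (a
        \<rightharpoonup> n c)\<close>.\<close>
      assume ab: "nonleast (a \<otimes> b)" and ac: "nonleast (a \<otimes> c)"
      have acb: "a \<otimes> c \<otimes> b = z"
        using a b c by (simp add: z_def m_ac)
      have "n (a \<otimes> b) \<otimes> n c = (a \<rightharpoonup> n b) \<otimes> (a \<otimes> (a \<rightharpoonup> n c))"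
        using a b c n nonl[of a c] ac by (simp add: n_mult mult_imp_eq)
      also have "\<dots> = (a \<rightharpoonup> n c) \<otimes> (a \<otimes> (a \<rightharpoonup> n b))"
        using a b c n by (simp add: m_ac)
      also have "\<dots> = n (a \<otimes> c) \<otimes> n b"
        using a b c n nonl[of a b] ab by (simp add: n_mult mult_imp_eq)
      finally have "n (a \<otimes> b) \<rightharpoonup> c = n (a \<otimes> c) \<rightharpoonup> b"
        using a b c n by (simp add: imp_n)
      moreover have "step c (step b s) = (Suc k, n (a \<otimes> b) \<rightharpoonup> c)"
        using nocarry[of a b] carry[of "a \<otimes> b" c] na b c ab False by (simp add: s)
      moreover have "step b (step c s) = (Suc k, n (a \<otimes> c) \<rightharpoonup> b)"
        using nocarry[of a c] carry[of "a \<otimes> c" b] na b c ac acb z by (simp add: s)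
      ultimately show ?thesis
        by simp
    next
      \<comment> \<open>Both first steps carry, and a second carry may or may not follow. The
        products after the first carry agree, and so do the residues of a second one.\<close>
      assume ab: "\<not> nonleast (a \<otimes> b)" and ac: "\<not> nonleast (a \<otimes> c)"
      define e where "e = n a"
      define r where "r = e \<rightharpoonup> b"
      define q where "q = e \<rightharpoonup> c"
      have e: "e \<in> carrier A" and r: "r \<in> carrier A" and q: "q \<in> carrier A"
        using a b c n by (auto simp: e_def r_def q_def)
      have nr: "nonleast r" and nq: "nonleast q"
        using carry_nonleast[OF na b ab] carry_nonleast[OF na c ac] eqz[of "a \<otimes> b"] eqz[of "a \<otimes> c"]
          a b c ab ac by (auto simp: e_def r_def q_def n_def)
      have "c = e \<otimes> q" "b = e \<otimes> r"
        using lst[of a b] lst[of a c] a b c ab ac e by (auto simp: q_def r_def mult_imp_eq e_def)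
      then have rc: "r \<otimes> c = q \<otimes> b"
        using e r q by (metis m_assoc m_comm)
      have "n r \<otimes> n c = n q \<otimes> n b"
        using e b c n by (simp add: r_def q_def imp_n nn m_ac)
      then have eq: "n r \<rightharpoonup> c = n q \<rightharpoonup> b"
        using r q b c n by (simp add: imp_n)
      have "step b s = (Suc k, r)" "step c s = (Suc k, q)"
        using carry[of a b] carry[of a c] na b c ab ac by (simp_all add: s r_def q_def e_def)
      moreover have "step c (Suc k, r) = step b (Suc k, q)"
      proof (cases "nonleast (r \<otimes> c)")
        case True
        then show ?thesis
          using nocarry[of r c] nocarry[of q b] nr nq b c rc by simp
      next
        case False
        then show ?thesis
          using carry[of r c] carry[of q b] nr nq b c rc eq by simp
      qed
      ultimately show ?thesis
        by simp
    qed (use one_side[of b c] one_side[of c b] b c in auto)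
  qed
qed

text \<open>Strictness is what later makes the order cancellative. If the smaller state carries into
  the integer part of the larger, its residue is strictly above \<open>b\<close> while the other
  product is at most \<open>b\<close>. If both carry from the same integer part, double implication
  over \<open>b\<close> and then over \<open>z\<close> recovers the original elements, so the
  residues stay different.\<close>

lemma step_mono:
  assumes vs: "nonleast (snd s)" and vt: "nonleast (snd t)" and st: "slt s t"
  shows "slt (step b s) (step b t)"
proof (cases "b \<in> carrier A")
  case False
  then show ?thesis
    using st by (simp add: step_def)
next
  case b: True
  obtain k a l d where s: "s = (k, a)" and t: "t = (l, d)"
    by (cases s, cases t)
  have na: "nonleast a" and nd: "nonleast d"
    using vs vt s t by auto
  then have a: "a \<in> carrier A" and d: "d \<in> carrier A"
    by auto
  have b_carry: "b \<preceq> (x \<rightharpoonup> x \<otimes> b) \<rightharpoonup> b" if "x \<in> carrier A" for x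
    using that b by simp
  have b_carry_neq: "(x \<rightharpoonup> x \<otimes> b) \<rightharpoonup> b \<noteq> b" if x: "nonleast x" "\<not> nonleast (x \<otimes> b)" for x
  proof
    let ?z = "x \<otimes> b"
    assume eq: "(x \<rightharpoonup> ?z) \<rightharpoonup> b = b"
    have "b \<preceq> x \<rightharpoonup> ?z"
      using x b by (simp add: m_comm[of x b] flip: currying)
    then have "x \<rightharpoonup> ?z = ((x \<rightharpoonup> ?z) \<rightharpoonup> b) \<rightharpoonup> b"
      using x b by (simp add: imp_imp_eq)
    then have "x \<preceq> ?z"
      using eq b by simp
    then have "nonleast ?z"
      using nonleast_up[of x ?z] x b by simp
    then show False
      using x by simp
  qed
  show ?thesis
  proof (cases "k < l")
    case True
    show ?thesis
    proof (cases "Suc k = l \<and> \<not> nonleast (a \<otimes> b) \<and> nonleast (d \<otimes> b)")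
      case True
      let ?r = "(a \<rightharpoonup> a \<otimes> b) \<rightharpoonup> b"
      have "d \<otimes> b \<preceq> b" "b \<preceq> ?r"
        using a b d by auto
      then have "d \<otimes> b \<preceq> ?r"
        using a b d le_trans[of "d \<otimes> b" b ?r] by simp
      moreover have "d \<otimes> b \<noteq> ?r"
      proof
        assume "d \<otimes> b = ?r"
        then have "?r = b"
          using le_antisym[of ?r b] a b d by (metis b_carry imp_closed m_closed mult_le_left)
        then show False
          using b_carry_neq na True by blast
      qed
      ultimately show ?thesis
        using True na nd b by (simp add: slt_def step_def s t)
    next
      case False
      then show ?thesis
        using True na nd b by (auto simp: slt_def step_def s t)
    qed
  next
    case False
    then have kl: "k = l" and da: "d \<preceq> a" "d \<noteq> a"
      using st by (auto simp: slt_def s t)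
    have dab: "d \<otimes> b \<preceq> a \<otimes> b"
      using da a b d by (simp add: mult_mono1)
    show ?thesis
    proof (cases "nonleast (d \<otimes> b)")
      case True
      then have "nonleast (a \<otimes> b)"
        using nonleast_up dab a b by blast
      moreover have "d \<otimes> b \<noteq> a \<otimes> b"
        using mult_inject[of b d a] True a b d da by (auto simp: m_comm)
      ultimately show ?thesis
        using True dab na nd b by (simp add: slt_def step_def s t kl)
    next
      case ldb: False
      show ?thesis
      proof (cases "nonleast (a \<otimes> b)")
        case True
        then show ?thesis
          using ldb na nd b by (simp add: slt_def step_def s t kl)
      next
        case False
        define z where "z = a \<otimes> b"
        have z: "z \<in> carrier A" "\<not> nonleast z" "d \<otimes> b = z"
          using False ldb a b d least_unique[of "d \<otimes> b" "a \<otimes> b"] by (simp_all add: z_def)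
        have ad: "a \<rightharpoonup> z \<preceq> d \<rightharpoonup> z"
          using a d z da by (simp add: imp_anti1)
        have ba: "b \<preceq> a \<rightharpoonup> z"
          using a b by (simp add: z_def m_comm[of a b] flip: currying)
        have bd: "b \<preceq> d \<rightharpoonup> z"
          using d b z(1,3) by (simp add: m_comm[of d b] flip: currying)
        have "(d \<rightharpoonup> z) \<rightharpoonup> b \<preceq> (a \<rightharpoonup> z) \<rightharpoonup> b"
          using ad a b d z by (simp add: imp_anti1)
        moreover have "(d \<rightharpoonup> z) \<rightharpoonup> b \<noteq> (a \<rightharpoonup> z) \<rightharpoonup> b"
        proof
          assume eq: "(d \<rightharpoonup> z) \<rightharpoonup> b = (a \<rightharpoonup> z) \<rightharpoonup> b"
          have "((d \<rightharpoonup> z) \<rightharpoonup> b) \<rightharpoonup> b = d \<rightharpoonup> z" "((a \<rightharpoonup> z) \<rightharpoonup> b) \<rightharpoonup> b = a \<rightharpoonup> z"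
            using a b d z ba bd by (intro imp_imp_eq; simp)+
          then have eq': "d \<rightharpoonup> z = a \<rightharpoonup> z"
            using eq by metis
          have "(d \<rightharpoonup> z) \<rightharpoonup> z = d" "(a \<rightharpoonup> z) \<rightharpoonup> z = a"
            using a d z by (intro imp_imp_eq; simp add: least_le)+
          then have "d = a"
            using eq' by metis
          then show False
            using da by simp
        qed
        ultimately show ?thesis
          using False ldb na nd b z by (simp add: slt_def step_def s t kl flip: z_def)
      qed
    qed
  qed
qed

section \<open>Sums of complements over multisets and their ordered group\<close>

definition sle :: "nat \<times> 'a \<Rightarrow> nat \<times> 'a \<Rightarrow> bool" where
  "sle s t \<longleftrightarrow> s = t \<or> slt s t"

lemma slt_trans:
  assumes "nonleast (snd s)" "nonleast (snd t)" "nonleast (snd u)" "slt s t" "slt t u"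
  shows "slt s u"
proof (cases "fst s = fst t \<and> fst t = fst u")
  case True
  then have *: "snd u \<preceq> snd t" "snd t \<preceq> snd s" "snd u \<noteq> snd t"
    using assms by (auto simp: slt_def)
  then have "snd u \<preceq> snd s"
    using assms le_trans[of "snd u" "snd t" "snd s"] by simp
  moreover have "snd u \<noteq> snd s"
    using * assms le_antisym[of "snd t" "snd u"] by auto
  ultimately show ?thesis
    using True by (simp add: slt_def)
next
  case False
  then show ?thesis
    using assms(4,5) unfolding slt_def by linarith
qed

lemma slt_irrefl [simp]: "\<not> slt s s"
  by (simp add: slt_def)

definition msum :: "'a multiset \<Rightarrow> nat \<times> 'a" where
  "msum M = fold_mset step (0, \<one>) M"

lemma msum_empty [simp]: "msum {#} = (0, \<one>)"
  by (simp add: msum_def)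

lemma msum_add [simp]: "msum (add_mset x M) = step x (msum M)"
proof -
  \<comment> \<open>The guards in \<open>step\<close> leave invalid arguments alone, which makes it
    commute on the whole type, as folding over a multiset demands.\<close>
  interpret comp_fun_commute step
    by standard (auto simp: fun_eq_iff step_commute)
  show ?thesis
    by (simp add: msum_def)
qed

lemma msum_valid [simp]: "nonleast (snd (msum M))"
  by (induction M) (auto simp: step_valid)

lemma msum_strict_mono: "slt (msum M) (msum N) \<Longrightarrow> slt (msum (M + K)) (msum (N + K))"
  by (induction K) (auto simp: step_mono)

lemma msum_eq_mono: "msum M = msum N \<Longrightarrow> msum (M + K) = msum (N + K)"
  by (induction K) auto

lemma msum_mono: "sle (msum M) (msum N) \<Longrightarrow> sle (msum (M + K)) (msum (N + K))"
  unfolding sle_def by (blast intro: msum_strict_mono msum_eq_mono)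

lemma msum_sle_trans: "sle (msum M) (msum N) \<Longrightarrow> sle (msum N) (msum K) \<Longrightarrow> sle (msum M) (msum K)"
  unfolding sle_def by (metis slt_trans msum_valid)

text \<open>The positive cone of the totally ordered group presented by the elements of the chain.\<close>

definition cone :: "('a \<Rightarrow> int) set" where
  "cone = {g. \<exists>M N. g = (\<lambda>e. int (count M e) - int (count N e)) \<and> sle (msum N) (msum M)}"

lemma cone_zero: "(\<lambda>e. 0) \<in> cone"
  unfolding cone_def by (auto intro!: exI[of _ "{#}"] simp: sle_def)

lemma coneI: "sle (msum N) (msum M) \<Longrightarrow> (\<lambda>e. int (count M e) - int (count N e)) \<in> cone"
  unfolding cone_def by blast

lemma cone_add:
  assumes "g \<in> cone" "h \<in> cone"
  shows "(\<lambda>e. g e + h e) \<in> cone"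
proof -
  obtain M N where g: "g = (\<lambda>e. int (count M e) - int (count N e))" and MN: "sle (msum N) (msum M)"
    using assms(1) unfolding cone_def by blast
  obtain K L where h: "h = (\<lambda>e. int (count K e) - int (count L e))" and KL: "sle (msum L) (msum K)"
    using assms(2) unfolding cone_def by blast
  have "sle (msum (N + L)) (msum (M + L))"
    using MN by (rule msum_mono)
  moreover have "sle (msum (M + L)) (msum (M + K))"
    using msum_mono[OF KL, of M] by (simp add: add.commute)
  ultimately have "sle (msum (N + L)) (msum (M + K))"
    by (rule msum_sle_trans)
  then have "(\<lambda>e. int (count (M + K) e) - int (count (N + L) e)) \<in> cone"
    by (rule coneI)
  moreover have "(\<lambda>e. int (count (M + K) e) - int (count (N + L) e)) = (\<lambda>e. g e + h e)"
    by (auto simp: g h)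
  ultimately show ?thesis
    by simp
qed

text \<open>A difference of counts comes from many pairs of multisets. Cross-adding turns a second
  representation into an equality of multisets, and strict monotonicity of sums contradicts
  it.\<close>

lemma cone_strict:
  assumes "slt (msum N) (msum M)"
  shows "(\<lambda>e. int (count N e) - int (count M e)) \<notin> cone"
proof
  assume "(\<lambda>e. int (count N e) - int (count M e)) \<in> cone"
  then obtain K L where eq: "(\<lambda>e. int (count N e) - int (count M e)) = (\<lambda>e. int (count K e) - int (count L e))"
    and KL: "sle (msum L) (msum K)"
    unfolding cone_def by blast
  have "int (count (N + L) e) = int (count (M + K) e)" for e
    using fun_cong[OF eq, of e] by simp
  then have NL: "N + L = M + K"
    by (intro multiset_eqI) (metis of_nat_eq_iff)
  have "slt (msum (N + L)) (msum (M + L))"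
    using assms by (rule msum_strict_mono)
  moreover have "sle (msum (M + L)) (msum (M + K))"
    using msum_mono[OF KL, of M] by (simp add: add.commute)
  ultimately show False
    using NL slt_trans[of "msum (N + L)" "msum (M + L)" "msum (M + K)"] by (auto simp: sle_def)
qed

text \<open>A least element has complement exactly 1: it carries immediately and leaves the residue
  \<one>.\<close>

lemma msum_single:
  assumes "a \<in> carrier A"
  shows "msum {#a#} = (if nonleast a then (0, a) else (1, \<one>))"
  using assms by (simp add: step_def)

lemma msum_one [simp]: "step \<one> (msum M) = msum M"
  using msum_valid[of M] by (simp add: step_def del: msum_valid)

lemma msum_mult:
  assumes "a \<in> carrier A" "b \<in> carrier A" "nonleast (a \<otimes> b)"
  shows "msum {#a, b#} = msum {#a \<otimes> b#}"
proof -
  have "nonleast b"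
    using nonleast_up[of "a \<otimes> b" b] assms by simp
  then show ?thesis
    using assms by (simp add: step_def m_comm)
qed

lemma msum_antimono:
  assumes "a \<in> carrier A" "b \<in> carrier A" "b \<preceq> a"
  shows "sle (msum {#a#}) (msum {#b#})" and "b \<noteq> a \<Longrightarrow> slt (msum {#a#}) (msum {#b#})"
proof -
  show *: "slt (msum {#a#}) (msum {#b#})" if "b \<noteq> a"
    using assms that nonleast_up[of b a] least_unique[of a b]
    by (auto simp: msum_single slt_def simp del: msum_add)
  show "sle (msum {#a#}) (msum {#b#})"
    using * by (auto simp: sle_def simp del: msum_add)
qed

text \<open>For \<open>b \<preceq> a\<close> the complement of \<open>b\<close> splits without
  truncation, since \<open>a \<otimes> (a \<rightharpoonup> b) = b\<close>. If \<open>b\<close> is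
  least and \<open>a\<close> is not, the second summand carries, with residue \<open>(a
  \<rightharpoonup> b) \<rightharpoonup> (a \<rightharpoonup> b)\<close>.\<close>

lemma msum_residual:
  assumes "a \<in> carrier A" "b \<in> carrier A" "b \<preceq> a"
  shows "msum {#a, a \<rightharpoonup> b#} = msum {#b#}"
proof (cases "nonleast b")
  case True
  then show ?thesis
    using msum_mult[of a "a \<rightharpoonup> b"] assms by (simp add: mult_imp_eq del: msum_add)
next
  case b: False
  show ?thesis
  proof (cases "nonleast a")
    case True
    have eq: "a \<otimes> (a \<rightharpoonup> b) = b"
      using assms by (simp add: mult_imp_eq)
    have "step a (0, \<one>) = (0, a)"
      using assms True by (simp add: step_def)
    moreover have "step (a \<rightharpoonup> b) (0, a) = (1, \<one>)"
      using assms b True by (simp add: step_def eq)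
    ultimately have "msum {#a, a \<rightharpoonup> b#} = (1, \<one>)"
      by (simp add: step_commute[of a])
    then show ?thesis
      using assms b by (simp add: msum_single del: msum_add)
  next
    case False
    then have "a = b"
      using assms b least_unique by blast
    then show ?thesis
      using assms msum_one[of "{#}"] by simp
  qed
qed

text \<open>A product that hits the least element may have been truncated: the complements add up to
  at least the unit, and only the inequality survives.\<close>

lemma msum_least_mult:
  assumes "a \<in> carrier A" "b \<in> carrier A" "\<not> nonleast (a \<otimes> b)"
  shows "sle (msum {#a \<otimes> b#}) (msum {#a, b#})"
proof -
  have "msum {#a, b#} = step b (msum {#a#})"
    by (simp add: step_commute)
  moreover have "sle (1, \<one>) (step b (msum {#a#}))"
  proof (cases "nonleast a")
    case True
    then show ?thesis
      using assms carry_nonleast[of a b] by (auto simp: step_def sle_def slt_def)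
  next
    case False
    then show ?thesis
      using assms by (auto simp: step_def sle_def slt_def)
  qed
  ultimately show ?thesis
    using assms by (simp add: msum_single del: msum_add)
qed

lemma msum_least_pos:
  assumes "z \<in> carrier A" "\<not> nonleast z"
  shows "slt (msum {#}) (msum {#z#})"
  using assms by (simp add: msum_single slt_def del: msum_add)

lemma msum_nonneg: "a \<in> carrier A \<Longrightarrow> sle (msum {#}) (msum {#a#})"
  using msum_antimono(1)[of \<one> a] msum_one[of "{#}"] by simp

end

section \<open>Finitely generated integer cones\<close>

text \<open>Induction on the generators: the weight \<open>t\<close> of the new generator is removed
  by Fourier--Motzkin elimination, which keeps the coefficients integral. The field is left open
  because chains use \<open>rat\<close>, where denominators can be cleared, and polyhedra use
  \<open>real\<close>.\<close>

lemma generated_cone_halfspaces: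
  fixes W :: "('k \<Rightarrow> int) set"
  assumes I: "finite I" and "finite W"
  shows "\<exists>H :: ('k \<Rightarrow> int) set. finite H \<and> (\<forall>x :: 'k \<Rightarrow> 'f :: linordered_field.
    (\<exists>w. (\<forall>u \<in> W. 0 \<le> w u) \<and> (\<forall>i \<in> I. x i = (\<Sum>u \<in> W. w u * of_int (u i)))) \<longleftrightarrow>
    (\<forall>a \<in> H. 0 \<le> (\<Sum>i \<in> I. of_int (a i) * x i)))"
  using assms(2)
proof (induction W rule: finite_induct)
  case empty
  let ?e = "\<lambda>c i j. if j = i then c else (0::int)"
  let ?H = "(\<lambda>(c, i). ?e c i) ` ({1, -1} \<times> I)"
  have dot: "(\<Sum>j \<in> I. of_int (?e c i j) * x j) = of_int c * x i" if "i \<in> I" for c i and x :: "'k \<Rightarrow> 'f"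
  proof -
    have "(\<Sum>j \<in> I. of_int (?e c i j) * x j) = (\<Sum>j \<in> I. if j = i then of_int c * x j else 0)"
      by (rule sum.cong) auto
    then show ?thesis
      using I that by simp
  qed
  have "(\<forall>i \<in> I. x i = 0) \<longleftrightarrow> (\<forall>a \<in> ?H. 0 \<le> (\<Sum>i \<in> I. of_int (a i) * x i))" for x :: "'k \<Rightarrow> 'f"
  proof
    assume "\<forall>i \<in> I. x i = 0"
    then show "\<forall>a \<in> ?H. 0 \<le> (\<Sum>i \<in> I. of_int (a i) * x i)"
      by simp
  next
    assume *: "\<forall>a \<in> ?H. 0 \<le> (\<Sum>i \<in> I. of_int (a i) * x i)"
    show "\<forall>i \<in> I. x i = 0"
    proof
      fix i assume i: "i \<in> I"
      have "0 \<le> (\<Sum>j \<in> I. of_int (?e c i j) * x j)" if "c \<in> {1, -1}" for c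
        by (rule bspec[OF *], rule image_eqI[of _ _ "(c, i)"]) (use that i in auto)
      then have "0 \<le> of_int c * x i" if "c \<in> {1, -1}" for c
        using that dot[OF i] by metis
      from this[of 1] this[of "-1"] show "x i = 0"
        by simp
    qed
  qed
  then show ?case
    using I by (intro exI[of _ ?H]) simp
next
  case (insert u W)
  then obtain H :: "('k \<Rightarrow> int) set" where H: "finite H"
    and eq: "\<And>x :: 'k \<Rightarrow> 'f.
      (\<exists>w. (\<forall>u \<in> W. 0 \<le> w u) \<and> (\<forall>i \<in> I. x i = (\<Sum>u \<in> W. w u * of_int (u i)))) \<longleftrightarrow>
      (\<forall>a \<in> H. 0 \<le> (\<Sum>i \<in> I. of_int (a i) * x i))"
    by blast
  define L where "L a x = (\<Sum>i \<in> I. of_int (a i) * x i)" for a :: "'k \<Rightarrow> int" and x :: "'k \<Rightarrow> 'f"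
  define c where "c a = (\<Sum>i \<in> I. a i * u i)" for a :: "'k \<Rightarrow> int"
  define comb where "comb = (\<lambda>(a, a') i. c a * a' i - c a' * a i)"
  \<comment> \<open>A constraint with \<open>c a > 0\<close> bounds \<open>t\<close> from above, one
    with \<open>c a < 0\<close> from below. Pairing upper bounds with \<open>0 \<le> t\<close>
    leaves \<open>0 \<le> L a x\<close>, and \<open>comb\<close> pairs them with the other lower
    bounds.\<close>
  let ?H = "{a \<in> H. c a \<ge> 0} \<union> comb ` ({a \<in> H. c a > 0} \<times> {a \<in> H. c a < 0})"
  have L_comb: "L (comb (a, a')) x = of_int (c a) * L a' x - of_int (c a') * L a x" for a a' x
    by (simp add: comb_def L_def sum_distrib_left algebra_simps flip: sum_subtractf)
  have L_shift: "L a (\<lambda>i. x i - t * of_int (u i)) = L a x - t * of_int (c a)" for a x t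
    by (simp add: L_def c_def sum_distrib_left algebra_simps sum_subtractf)
  have split: "(\<exists>w. (\<forall>v \<in> insert u W. 0 \<le> w v) \<and> (\<forall>i \<in> I. x i = (\<Sum>v \<in> insert u W. w v * of_int (v i)))) \<longleftrightarrow>
      (\<exists>t \<ge> 0. \<forall>a \<in> H. 0 \<le> L a x - t * of_int (c a))" for x :: "'k \<Rightarrow> 'f"
  proof -
    have "(\<exists>w. (\<forall>v \<in> insert u W. 0 \<le> w v) \<and> (\<forall>i \<in> I. x i = (\<Sum>v \<in> insert u W. w v * of_int (v i)))) \<longleftrightarrow>
      (\<exists>t \<ge> 0. \<exists>w. (\<forall>v \<in> W. 0 \<le> w v) \<and> (\<forall>i \<in> I. x i - t * of_int (u i) = (\<Sum>v \<in> W. w v * of_int (v i))))"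
      (is "?l \<longleftrightarrow> ?r")
    proof
      assume ?l
      then obtain w where "\<forall>v \<in> insert u W. 0 \<le> w v"
        "\<forall>i \<in> I. x i = (\<Sum>v \<in> insert u W. w v * of_int (v i))"
        by blast
      then show ?r
        using insert.hyps by (intro exI[of _ "w u"] conjI exI[of _ w]) auto
    next
      assume ?r
      then obtain t w where tw: "0 \<le> t" "\<forall>v \<in> W. 0 \<le> w v"
        "\<forall>i \<in> I. x i - t * of_int (u i) = (\<Sum>v \<in> W. w v * of_int (v i))"
        by blast
      have "(\<Sum>v \<in> W. (w(u := t)) v * of_int (v i)) = (\<Sum>v \<in> W. w v * of_int (v i))" for i
        using insert.hyps by (intro sum.cong) auto
      then show ?l
        using tw insert.hyps by (intro exI[of _ "w(u := t)"]) (auto simp: algebra_simps)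
    qed
    also have "\<dots> \<longleftrightarrow> (\<exists>t \<ge> 0. \<forall>a \<in> H. 0 \<le> L a (\<lambda>i. x i - t * of_int (u i)))"
      unfolding L_def using eq[of "\<lambda>i. x i - _ * of_int (u i)"] by simp
    finally show ?thesis
      by (simp only: L_shift)
  qed
  have elim: "(\<exists>t \<ge> 0. \<forall>a \<in> H. 0 \<le> L a x - t * of_int (c a)) \<longleftrightarrow> (\<forall>a \<in> ?H. 0 \<le> L a x)" for x
  proof
    assume "\<exists>t \<ge> 0. \<forall>a \<in> H. 0 \<le> L a x - t * of_int (c a)"
    then obtain t where t: "t \<ge> 0" "\<And>a. a \<in> H \<Longrightarrow> t * of_int (c a) \<le> L a x"
      by force
    show "\<forall>a \<in> ?H. 0 \<le> L a x"
    proof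
      fix a assume "a \<in> ?H"
      then consider "a \<in> H" "c a \<ge> 0"
        | b b' where "a = comb (b, b')" "b \<in> H" "b' \<in> H" "c b > 0" "c b' < 0"
        by blast
      then show "0 \<le> L a x"
      proof cases
        case 1
        then have "0 \<le> t * of_int (c a)"
          using t(1) by simp
        then show ?thesis
          using t(2)[OF 1(1)] by linarith
      next
        case 2
        have "of_int (c b) * (t * of_int (c b')) \<le> of_int (c b) * L b' x"
          using t(2) 2 by (intro mult_left_mono) auto
        moreover have "of_int (c b') * L b x \<le> of_int (c b') * (t * of_int (c b))"
          using t(2) 2 by (intro mult_left_mono_neg) auto
        moreover have "of_int (c b') * (t * of_int (c b)) = of_int (c b) * (t * of_int (c b'))"
          by simp
        ultimately show ?thesis
          unfolding 2(1) L_comb by linarith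
      qed
    qed
  next
    assume *: "\<forall>a \<in> ?H. 0 \<le> L a x"
    define S where "S = insert 0 ((\<lambda>a. L a x / of_int (c a)) ` {a \<in> H. c a < 0})"
    \<comment> \<open>The least value that meets every lower bound; the pairwise constraints then
      say that it meets the upper ones.\<close>
    define t where "t = Max S"
    have fS: "finite S" "S \<noteq> {}"
      using H by (auto simp: S_def)
    have t0: "0 \<le> t"
      using fS by (auto simp: t_def S_def)
    have tS: "t = 0 \<or> (\<exists>b \<in> H. c b < 0 \<and> t = L b x / of_int (c b))"
      using Max_in[OF fS] unfolding t_def[symmetric] by (auto simp: S_def)
    have "0 \<le> L a x - t * of_int (c a)" if a: "a \<in> H" for a
    proof (cases "c a < 0")
      case True
      then have "L a x / of_int (c a) \<in> S"
        using a by (auto simp: S_def)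
      then have "L a x / of_int (c a) \<le> t"
        using fS by (simp add: t_def)
      then show ?thesis
        using True by (simp add: field_simps)
    next
      case False
      then have La: "0 \<le> L a x"
        using * a by auto
      from tS show ?thesis
      proof
        assume "t = 0"
        then show ?thesis
          using La by simp
      next
        assume "\<exists>b \<in> H. c b < 0 \<and> t = L b x / of_int (c b)"
        then obtain b where b: "b \<in> H" "c b < 0" and t: "t = L b x / of_int (c b)"
          by blast
        show ?thesis
        proof (cases "c a = 0")
          case True
          then show ?thesis
            using La by simp
        next
          case F: False
          then have "comb (a, b) \<in> ?H"
            using False a b by auto
          then have "0 \<le> L (comb (a, b)) x"
            using * by blast
          then have "of_int (c b) * L a x \<le> of_int (c a) * L b x"
            by (simp add: L_comb)
          then have "L b x * of_int (c a) / of_int (c b) \<le> L a x"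
            using b by (simp add: field_simps)
          then show ?thesis
            by (simp add: t)
        qed
      qed
    qed
    then show "\<exists>t \<ge> 0. \<forall>a \<in> H. 0 \<le> L a x - t * of_int (c a)"
      using t0 by blast
  qed
  have "finite ?H"
    using H by simp
  then show ?case
    unfolding split elim unfolding L_def by (intro exI[of _ ?H] conjI allI refl)
qed

lemma common_denominator:
  fixes f :: "'x \<Rightarrow> 'f :: field_char_0"
  assumes "finite W" "\<And>u. u \<in> W \<Longrightarrow> f u \<in> \<rat>"
  shows "\<exists>d::nat. d > 0 \<and> (\<forall>u \<in> W. of_nat d * f u \<in> \<int>)"
  using assms
proof (induction W rule: finite_induct)
  case empty
  then show ?case
    by auto
next
  case (insert u W)
  then obtain d :: nat where d: "d > 0" "\<And>v. v \<in> W \<Longrightarrow> of_nat d * f v \<in> \<int>"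
    by auto
  obtain r where r: "f u = of_rat r"
    using insert.prems[of u] by (auto elim: Rats_cases)
  obtain a b where ab: "r = Rat.Fract a b" "b > 0"
    by (cases r) auto
  have fu: "f u = of_int a / of_int b"
    using ab by (simp add: r of_rat_rat)
  have *: "of_nat (d * nat b) * x = (of_nat d * x) * of_int b" for x :: 'f
    using ab by simp
  have "of_nat (d * nat b) * f v \<in> \<int>" if "v \<in> insert u W" for v
  proof (cases "v = u")
    case True
    have "of_nat (d * nat b) * f v = of_int (int d * a)"
      using ab unfolding * by (simp add: True fu)
    then show ?thesis
      by (metis Ints_of_int)
  next
    case False
    then show ?thesis
      using d that unfolding * by simp
  qed
  then show ?case
    using d ab by (intro exI[of _ "d * nat b"]) auto
qed

text \<open>The functional is the sum of all normals of the rational cone over \<open>B\<close>. If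
  none of them were positive on \<open>b\<close>, then \<open>- b\<close> would be a nonnegative
  rational combination of \<open>B\<close>, and clearing denominators would lead to
  \<open>- b\<close> in \<open>C\<close>.\<close>

lemma motzkin_transposition:
  fixes C :: "('k \<Rightarrow> int) set"
  assumes I: "finite I" and zero: "(\<lambda>i. 0) \<in> C"
    and add: "\<And>g h. g \<in> C \<Longrightarrow> h \<in> C \<Longrightarrow> (\<lambda>i. g i + h i) \<in> C"
    and B: "finite B" "B \<subseteq> C" and supp: "\<And>b i. b \<in> B \<Longrightarrow> i \<notin> I \<Longrightarrow> b i = 0"
  shows "\<exists>\<phi> :: 'k \<Rightarrow> int. \<forall>b \<in> B. 0 \<le> (\<Sum>i \<in> I. \<phi> i * b i) \<and>
    ((\<lambda>i. - b i) \<notin> C \<longrightarrow> 0 < (\<Sum>i \<in> I. \<phi> i * b i))"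
proof -
  obtain H :: "('k \<Rightarrow> int) set" where H: "finite H"
    and eq: "\<And>x :: 'k \<Rightarrow> rat.
      (\<exists>w. (\<forall>u \<in> B. 0 \<le> w u) \<and> (\<forall>i \<in> I. x i = (\<Sum>u \<in> B. w u * of_int (u i)))) \<longleftrightarrow>
      (\<forall>a \<in> H. 0 \<le> (\<Sum>i \<in> I. of_int (a i) * x i))"
    using generated_cone_halfspaces[OF I B(1), where ?'f = rat] by blast
  have int_dot: "(0 \<le> (\<Sum>i \<in> I. of_int (a i) * rat_of_int (x i))) \<longleftrightarrow> 0 \<le> (\<Sum>i \<in> I. a i * x i)" for a x
    by (simp flip: of_int_mult of_int_sum)
  have smul: "(\<lambda>i. int n * g i) \<in> C" if "g \<in> C" for g n
  proof (induction n)
    case (Suc n)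
    then show ?case
      using add[OF that Suc] by (simp add: distrib_right)
  qed (use zero in simp)
  have comb: "(\<lambda>i. \<Sum>u \<in> X. int (n u) * u i) \<in> C" if "X \<subseteq> B" for n X
    using finite_subset[OF that B(1)] that
  proof (induction X rule: finite_induct)
    case (insert u X)
    then have "(\<lambda>i. int (n u) * u i) \<in> C"
      using smul B by blast
    then show ?case
      using add insert by simp
  qed (use zero in simp)
  have nonneg: "0 \<le> (\<Sum>i \<in> I. a i * b i)" if "b \<in> B" "a \<in> H" for a b
  proof -
    have "\<forall>i \<in> I. rat_of_int (b i) = (\<Sum>u \<in> B. (if u = b then 1 else 0) * of_int (u i))"
      using B that by (simp add: if_distrib[of "\<lambda>x. x * _"] cong: if_cong)
    then have "\<exists>w. (\<forall>u \<in> B. 0 \<le> w u) \<and> (\<forall>i \<in> I. rat_of_int (b i) = (\<Sum>u \<in> B. w u * of_int (u i)))"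
      by (intro exI[of _ "\<lambda>u. if u = b then 1 else 0"]) simp
    then have "\<forall>a \<in> H. 0 \<le> (\<Sum>i \<in> I. of_int (a i) * rat_of_int (b i))"
      using eq[of "\<lambda>i. rat_of_int (b i)"] by blast
    then show ?thesis
      using that int_dot by blast
  qed
  have strict: "\<exists>a \<in> H. 0 < (\<Sum>i \<in> I. a i * b i)" if b: "b \<in> B" and nb: "(\<lambda>i. - b i) \<notin> C" for b
  proof (rule ccontr)
    assume "\<not> ?thesis"
    then have "\<forall>a \<in> H. 0 \<le> (\<Sum>i \<in> I. a i * (- b i))"
      by (auto simp: sum_negf not_less)
    then have "\<forall>a \<in> H. 0 \<le> (\<Sum>i \<in> I. of_int (a i) * rat_of_int (- b i))"
      using int_dot[of _ "\<lambda>i. - b i"] by simp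
    then obtain w where w: "\<And>u. u \<in> B \<Longrightarrow> 0 \<le> w u"
      "\<And>i. i \<in> I \<Longrightarrow> rat_of_int (- b i) = (\<Sum>u \<in> B. w u * of_int (u i))"
      using eq[of "\<lambda>i. rat_of_int (- b i)"] by blast
    have "w u \<in> \<rat>" for u
      by (simp add: Rats_def of_rat_eq_id)
    then obtain d :: nat where d: "d > 0" "\<And>u. u \<in> B \<Longrightarrow> of_nat d * w u \<in> \<int>"
      using common_denominator[OF B(1), of w] by blast
    define n where "n u = nat \<lfloor>of_nat d * w u\<rfloor>" for u
    have n: "rat_of_int (int (n u)) = of_nat d * w u" if "u \<in> B" for u
    proof -
      have "rat_of_int \<lfloor>of_nat d * w u\<rfloor> = of_nat d * w u"
        using d(2)[OF that] by (simp add: of_int_floor)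
      moreover have "0 \<le> \<lfloor>of_nat d * w u\<rfloor>"
        using w(1)[OF that] by simp
      ultimately show ?thesis
        by (simp add: n_def)
    qed
    have "int d * (- b i) = (\<Sum>u \<in> B. int (n u) * u i)" for i
    proof (cases "i \<in> I")
      case True
      have "rat_of_int (int d * (- b i)) = of_nat d * rat_of_int (- b i)"
        by simp
      also have "\<dots> = (\<Sum>u \<in> B. (of_nat d * w u) * of_int (u i))"
        unfolding w(2)[OF True] by (simp add: sum_distrib_left mult_ac)
      also have "\<dots> = (\<Sum>u \<in> B. rat_of_int (int (n u)) * of_int (u i))"
        using n by (intro sum.cong) auto
      also have "\<dots> = rat_of_int (\<Sum>u \<in> B. int (n u) * u i)"
        by simp
      finally show ?thesis
        by (simp only: of_int_eq_iff)
    next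
      case False
      have "b i = 0" "(\<Sum>u \<in> B. int (n u) * u i) = 0"
        using supp[OF _ False] b by (simp_all add: sum.neutral)
      then show ?thesis
        by simp
    qed
    then have "(\<lambda>i. int d * (- b i)) \<in> C"
      using comb[of B n] by simp
    \<comment> \<open>\<open>C\<close> contains \<open>d\<close> copies of \<open>- b\<close>;
      adding \<open>d - 1\<close> copies of \<open>b\<close> leaves exactly one, without dividing in
      \<open>C\<close>.\<close>
    then have "(\<lambda>i. int d * (- b i) + int (d - 1) * b i) \<in> C"
      using add smul[of b "d - 1"] b B by blast
    moreover have "int d * (- b i) + int (d - 1) * b i = - b i" for i
      using d(1) by (simp add: of_nat_diff algebra_simps)
    ultimately show False
      using nb by simp
  qed
  have dot: "(\<Sum>i \<in> I. (\<Sum>a \<in> H. a i) * b i) = (\<Sum>a \<in> H. \<Sum>i \<in> I. a i * b i)" for b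
    by (simp add: sum_distrib_right sum.swap[of _ I H])
  show ?thesis
  proof (intro exI[of _ "\<lambda>i. \<Sum>a \<in> H. a i"] ballI conjI impI; unfold dot)
    fix b assume b: "b \<in> B"
    show "0 \<le> (\<Sum>a \<in> H. \<Sum>i \<in> I. a i * b i)"
      using nonneg[OF b] by (rule sum_nonneg)
    show "0 < (\<Sum>a \<in> H. \<Sum>i \<in> I. a i * b i)" if nb: "(\<lambda>i. - b i) \<notin> C"
    proof -
      obtain a where a: "a \<in> H" "0 < (\<Sum>i \<in> I. a i * b i)"
        using strict[OF b nb] by blast
      show ?thesis
        by (rule sum_pos2[where f = "\<lambda>a. \<Sum>i \<in> I. a i * b i", OF H a nonneg[OF b]])
    qed
  qed
qed

section \<open>Quotients\<close>

definition closed_ops :: "('a, 'c) hoop_scheme \<Rightarrow> bool" where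
  "closed_ops A \<longleftrightarrow> \<one>\<^bsub>A\<^esub> \<in> carrier A \<and> (\<forall>x \<in> carrier A. \<forall>y \<in> carrier A.
     x \<otimes>\<^bsub>A\<^esub> y \<in> carrier A \<and> x \<rightharpoonup>\<^bsub>A\<^esub> y \<in> carrier A \<and>
     x \<curlywedge>\<^bsub>A\<^esub> y \<in> carrier A \<and> x \<curlyvee>\<^bsub>A\<^esub> y \<in> carrier A)"

lemma closed_opsD:
  assumes "closed_ops A"
  shows "\<one>\<^bsub>A\<^esub> \<in> carrier A"
    and "\<lbrakk>x \<in> carrier A; y \<in> carrier A\<rbrakk> \<Longrightarrow> x \<otimes>\<^bsub>A\<^esub> y \<in> carrier A"
    and "\<lbrakk>x \<in> carrier A; y \<in> carrier A\<rbrakk> \<Longrightarrow> x \<rightharpoonup>\<^bsub>A\<^esub> y \<in> carrier A"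
    and "\<lbrakk>x \<in> carrier A; y \<in> carrier A\<rbrakk> \<Longrightarrow> x \<curlywedge>\<^bsub>A\<^esub> y \<in> carrier A"
    and "\<lbrakk>x \<in> carrier A; y \<in> carrier A\<rbrakk> \<Longrightarrow> x \<curlyvee>\<^bsub>A\<^esub> y \<in> carrier A"
  using assms by (auto simp: closed_ops_def)

lemma (in wajsberg_hoop) closed_ops: "closed_ops A"
  by (simp add: closed_ops_def)

lemma closed_ops_term_hoop: "closed_ops (term_hoop n)"
  by (simp add: closed_ops_def term_hoop_def)

lemma teval_closed:
  assumes "closed_ops A" "\<And>i. i \<in> tvars t \<Longrightarrow> v i \<in> carrier A"
  shows "teval A v t \<in> carrier A"
  using assms(2) by (induction t) (auto intro: closed_opsD[OF assms(1)])

lemma teval_cong: "(\<And>i. i \<in> tvars t \<Longrightarrow> v i = w i) \<Longrightarrow> teval A v t = teval A w t"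
  by (induction t) auto

lemma congruenceD:
  assumes "congruence A \<theta>"
  shows "equiv (carrier A) \<theta>"
    and "\<lbrakk>(x, x') \<in> \<theta>; (y, y') \<in> \<theta>\<rbrakk> \<Longrightarrow> (x \<otimes>\<^bsub>A\<^esub> y, x' \<otimes>\<^bsub>A\<^esub> y') \<in> \<theta>"
    and "\<lbrakk>(x, x') \<in> \<theta>; (y, y') \<in> \<theta>\<rbrakk> \<Longrightarrow> (x \<rightharpoonup>\<^bsub>A\<^esub> y, x' \<rightharpoonup>\<^bsub>A\<^esub> y') \<in> \<theta>"
    and "\<lbrakk>(x, x') \<in> \<theta>; (y, y') \<in> \<theta>\<rbrakk> \<Longrightarrow> (x \<curlywedge>\<^bsub>A\<^esub> y, x' \<curlywedge>\<^bsub>A\<^esub> y') \<in> \<theta>"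
    and "\<lbrakk>(x, x') \<in> \<theta>; (y, y') \<in> \<theta>\<rbrakk> \<Longrightarrow> (x \<curlyvee>\<^bsub>A\<^esub> y, x' \<curlyvee>\<^bsub>A\<^esub> y') \<in> \<theta>"
  using assms unfolding congruence_def by blast+

lemma congruence_class_eq_iff:
  assumes "congruence A \<theta>" "x \<in> carrier A" "y \<in> carrier A"
  shows "\<theta> `` {x} = \<theta> `` {y} \<longleftrightarrow> (x, y) \<in> \<theta>"
  using eq_equiv_class_iff[OF congruenceD(1)[OF assms(1)] assms(2,3)] .

lemma class_op:
  assumes eq: "equiv C \<theta>" and x: "x \<in> C" and y: "y \<in> C"
    and f: "\<And>x x' y y'. \<lbrakk>(x, x') \<in> \<theta>; (y, y') \<in> \<theta>\<rbrakk> \<Longrightarrow> (f x y, f x' y') \<in> \<theta>"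
  shows "(\<Union>x' \<in> \<theta> `` {x}. \<Union>y' \<in> \<theta> `` {y}. \<theta> `` {f x' y'}) = \<theta> `` {f x y}"
proof -
  have "\<theta> `` {f x' y'} = \<theta> `` {f x y}" if "x' \<in> \<theta> `` {x}" "y' \<in> \<theta> `` {y}" for x' y'
    using equiv_class_eq[OF eq f[of x x' y y']] that by simp
  moreover have "x \<in> \<theta> `` {x}" "y \<in> \<theta> `` {y}"
    using equiv_class_self[OF eq] x y by auto
  ultimately show ?thesis
    by blast
qed

lemma quotient_ops:
  assumes "congruence A \<theta>" "x \<in> carrier A" "y \<in> carrier A"
  shows "\<theta> `` {x} \<otimes>\<^bsub>quotient_hoop A \<theta>\<^esub> \<theta> `` {y} = \<theta> `` {x \<otimes>\<^bsub>A\<^esub> y}"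
    and "\<theta> `` {x} \<rightharpoonup>\<^bsub>quotient_hoop A \<theta>\<^esub> \<theta> `` {y} = \<theta> `` {x \<rightharpoonup>\<^bsub>A\<^esub> y}"
    and "\<theta> `` {x} \<curlywedge>\<^bsub>quotient_hoop A \<theta>\<^esub> \<theta> `` {y} = \<theta> `` {x \<curlywedge>\<^bsub>A\<^esub> y}"
    and "\<theta> `` {x} \<curlyvee>\<^bsub>quotient_hoop A \<theta>\<^esub> \<theta> `` {y} = \<theta> `` {x \<curlyvee>\<^bsub>A\<^esub> y}"
  unfolding quotient_hoop_def using assms congruenceD[OF assms(1)]
  by (simp_all add: class_op)

lemma quotient_one: "\<one>\<^bsub>quotient_hoop A \<theta>\<^esub> = \<theta> `` {\<one>\<^bsub>A\<^esub>}"
  by (simp add: quotient_hoop_def)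

lemma quotient_carrier: "carrier (quotient_hoop A \<theta>) = (\<lambda>x. \<theta> `` {x}) ` carrier A"
  by (auto simp: quotient_hoop_def quotient_def)

text \<open>The axioms of the quotient, read modulo \<theta>. In this form they visibly pass to
  intersections of congruences, which is how the free hoop is seen to be a Wajsberg hoop.\<close>

definition wajsberg_identities :: "('a, 'c) hoop_scheme \<Rightarrow> ('a \<times> 'a) set \<Rightarrow> bool" where
  "wajsberg_identities A \<theta> \<longleftrightarrow> (\<forall>x \<in> carrier A. \<forall>y \<in> carrier A. \<forall>z \<in> carrier A.
     (x \<otimes>\<^bsub>A\<^esub> y \<otimes>\<^bsub>A\<^esub> z, x \<otimes>\<^bsub>A\<^esub> (y \<otimes>\<^bsub>A\<^esub> z)) \<in> \<theta> \<and> (x \<otimes>\<^bsub>A\<^esub> y, y \<otimes>\<^bsub>A\<^esub> x) \<in> \<theta> \<and>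
     (\<one>\<^bsub>A\<^esub> \<otimes>\<^bsub>A\<^esub> x, x) \<in> \<theta> \<and> (x \<rightharpoonup>\<^bsub>A\<^esub> x, \<one>\<^bsub>A\<^esub>) \<in> \<theta> \<and>
     (x \<otimes>\<^bsub>A\<^esub> (x \<rightharpoonup>\<^bsub>A\<^esub> y), y \<otimes>\<^bsub>A\<^esub> (y \<rightharpoonup>\<^bsub>A\<^esub> x)) \<in> \<theta> \<and>
     ((x \<otimes>\<^bsub>A\<^esub> y) \<rightharpoonup>\<^bsub>A\<^esub> z, x \<rightharpoonup>\<^bsub>A\<^esub> (y \<rightharpoonup>\<^bsub>A\<^esub> z)) \<in> \<theta> \<and>
     ((x \<rightharpoonup>\<^bsub>A\<^esub> y) \<rightharpoonup>\<^bsub>A\<^esub> y, (y \<rightharpoonup>\<^bsub>A\<^esub> x) \<rightharpoonup>\<^bsub>A\<^esub> x) \<in> \<theta> \<and>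
     (x \<curlywedge>\<^bsub>A\<^esub> y, x \<otimes>\<^bsub>A\<^esub> (x \<rightharpoonup>\<^bsub>A\<^esub> y)) \<in> \<theta> \<and>
     (x \<curlyvee>\<^bsub>A\<^esub> y, (x \<rightharpoonup>\<^bsub>A\<^esub> y) \<rightharpoonup>\<^bsub>A\<^esub> y) \<in> \<theta>)"

lemma quotient_wajsberg_iff:
  assumes cl: "closed_ops A" and co: "congruence A \<theta>"
  shows "wajsberg_hoop (quotient_hoop A \<theta>) \<longleftrightarrow> wajsberg_identities A \<theta>"
proof
  let ?Q = "quotient_hoop A \<theta>"
  note [simp] = closed_opsD[OF cl] quotient_ops[OF co] quotient_one congruence_class_eq_iff[OF co]
  have mem: "x \<in> carrier A \<Longrightarrow> \<theta> `` {x} \<in> carrier ?Q" for x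
    by (simp add: quotient_carrier)
  {
    assume "wajsberg_hoop ?Q"
    then interpret Q: wajsberg_hoop ?Q .
    show "wajsberg_identities A \<theta>"
      unfolding wajsberg_identities_def
    proof (intro ballI)
      fix x y z assume *: "x \<in> carrier A" "y \<in> carrier A" "z \<in> carrier A"
      note m = *[THEN mem]
      show "(x \<otimes>\<^bsub>A\<^esub> y \<otimes>\<^bsub>A\<^esub> z, x \<otimes>\<^bsub>A\<^esub> (y \<otimes>\<^bsub>A\<^esub> z)) \<in> \<theta> \<and> (x \<otimes>\<^bsub>A\<^esub> y, y \<otimes>\<^bsub>A\<^esub> x) \<in> \<theta> \<and>
        (\<one>\<^bsub>A\<^esub> \<otimes>\<^bsub>A\<^esub> x, x) \<in> \<theta> \<and> (x \<rightharpoonup>\<^bsub>A\<^esub> x, \<one>\<^bsub>A\<^esub>) \<in> \<theta> \<and>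
        (x \<otimes>\<^bsub>A\<^esub> (x \<rightharpoonup>\<^bsub>A\<^esub> y), y \<otimes>\<^bsub>A\<^esub> (y \<rightharpoonup>\<^bsub>A\<^esub> x)) \<in> \<theta> \<and>
        ((x \<otimes>\<^bsub>A\<^esub> y) \<rightharpoonup>\<^bsub>A\<^esub> z, x \<rightharpoonup>\<^bsub>A\<^esub> (y \<rightharpoonup>\<^bsub>A\<^esub> z)) \<in> \<theta> \<and>
        ((x \<rightharpoonup>\<^bsub>A\<^esub> y) \<rightharpoonup>\<^bsub>A\<^esub> y, (y \<rightharpoonup>\<^bsub>A\<^esub> x) \<rightharpoonup>\<^bsub>A\<^esub> x) \<in> \<theta> \<and>
        (x \<curlywedge>\<^bsub>A\<^esub> y, x \<otimes>\<^bsub>A\<^esub> (x \<rightharpoonup>\<^bsub>A\<^esub> y)) \<in> \<theta> \<and>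
        (x \<curlyvee>\<^bsub>A\<^esub> y, (x \<rightharpoonup>\<^bsub>A\<^esub> y) \<rightharpoonup>\<^bsub>A\<^esub> y) \<in> \<theta>"
        by (intro conjI; (use Q.m_assoc[OF m] * in \<open>simp; fail\<close>
          | use Q.m_comm[OF m(1,2)] * in \<open>simp; fail\<close>
          | use Q.l_one[OF m(1)] * in \<open>simp; fail\<close>
          | use Q.imp_self[OF m(1)] * in \<open>simp; fail\<close>
          | use Q.divisibility[OF m(1,2)] * in \<open>simp; fail\<close>
          | use Q.currying[OF m] * in \<open>simp; fail\<close>
          | use Q.wajsberg[OF m(1,2)] * in \<open>simp; fail\<close>
          | use Q.hmeet_eq[OF m(1,2)] * in \<open>simp; fail\<close>
          | use Q.hjoin_eq[OF m(1,2)] * in \<open>simp; fail\<close>))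
    qed
  }
  {
    assume "wajsberg_identities A \<theta>"
    note id = this[unfolded wajsberg_identities_def, rule_format]
    have ex: "\<exists>x \<in> carrier A. X = \<theta> `` {x}" if "X \<in> carrier ?Q" for X
      using that by (auto simp: quotient_carrier)
    show "wajsberg_hoop ?Q"
    proof (intro wajsberg_hoop.intro comm_monoidI wajsberg_hoop_axioms.intro)
      show "\<one>\<^bsub>?Q\<^esub> \<in> carrier ?Q"
        using mem by simp
    next
      fix X assume "X \<in> carrier ?Q"
      then obtain x where x: "x \<in> carrier A" "X = \<theta> `` {x}"
        using ex by blast
      show "\<one>\<^bsub>?Q\<^esub> \<otimes>\<^bsub>?Q\<^esub> X = X" "X \<rightharpoonup>\<^bsub>?Q\<^esub> X = \<one>\<^bsub>?Q\<^esub>"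
        using x id[of x x x] by simp_all
    next
      fix X Y assume "X \<in> carrier ?Q" "Y \<in> carrier ?Q"
      then obtain x y where x: "x \<in> carrier A" "X = \<theta> `` {x}" and y: "y \<in> carrier A" "Y = \<theta> `` {y}"
        using ex by meson
      show "X \<otimes>\<^bsub>?Q\<^esub> Y \<in> carrier ?Q" "X \<rightharpoonup>\<^bsub>?Q\<^esub> Y \<in> carrier ?Q"
        using x y by (simp_all add: mem)
      show "X \<otimes>\<^bsub>?Q\<^esub> Y = Y \<otimes>\<^bsub>?Q\<^esub> X"
        "X \<otimes>\<^bsub>?Q\<^esub> (X \<rightharpoonup>\<^bsub>?Q\<^esub> Y) = Y \<otimes>\<^bsub>?Q\<^esub> (Y \<rightharpoonup>\<^bsub>?Q\<^esub> X)"
        "(X \<rightharpoonup>\<^bsub>?Q\<^esub> Y) \<rightharpoonup>\<^bsub>?Q\<^esub> Y = (Y \<rightharpoonup>\<^bsub>?Q\<^esub> X) \<rightharpoonup>\<^bsub>?Q\<^esub> X"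
        "X \<curlywedge>\<^bsub>?Q\<^esub> Y = X \<otimes>\<^bsub>?Q\<^esub> (X \<rightharpoonup>\<^bsub>?Q\<^esub> Y)"
        "X \<curlyvee>\<^bsub>?Q\<^esub> Y = (X \<rightharpoonup>\<^bsub>?Q\<^esub> Y) \<rightharpoonup>\<^bsub>?Q\<^esub> Y"
        using x y id[of x y x] by simp_all
    next
      fix X Y Z assume "X \<in> carrier ?Q" "Y \<in> carrier ?Q" "Z \<in> carrier ?Q"
      then obtain x y z where x: "x \<in> carrier A" "X = \<theta> `` {x}" and y: "y \<in> carrier A" "Y = \<theta> `` {y}"
        and z: "z \<in> carrier A" "Z = \<theta> `` {z}"
        using ex by meson
      show "X \<otimes>\<^bsub>?Q\<^esub> Y \<otimes>\<^bsub>?Q\<^esub> Z = X \<otimes>\<^bsub>?Q\<^esub> (Y \<otimes>\<^bsub>?Q\<^esub> Z)"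
        "(X \<otimes>\<^bsub>?Q\<^esub> Y) \<rightharpoonup>\<^bsub>?Q\<^esub> Z = X \<rightharpoonup>\<^bsub>?Q\<^esub> (Y \<rightharpoonup>\<^bsub>?Q\<^esub> Z)"
        using x y z id[of x y z] by simp_all
    qed
  }
qed

lemma (in wajsberg_hoop) identities:
  assumes "\<And>x. x \<in> carrier A \<Longrightarrow> (x, x) \<in> \<theta>"
  shows "wajsberg_identities A \<theta>"
proof -
  have eq: "(s, t) \<in> \<theta>" if "s = t" "s \<in> carrier A" for s t
    using that assms by simp
  show ?thesis
    unfolding wajsberg_identities_def
    by (intro ballI conjI; rule eq,
        (rule m_assoc m_comm l_one imp_self divisibility currying wajsberg hmeet_eq hjoin_eq; assumption), simp)
qed

lemma (in wajsberg_hoop) quotient_wajsberg: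
  assumes "congruence A \<theta>"
  shows "wajsberg_hoop (quotient_hoop A \<theta>)"
proof -
  have "(x, x) \<in> \<theta>" if "x \<in> carrier A" for x
    using congruenceD(1)[OF assms] that by (auto simp: equiv_def refl_on_def)
  then show ?thesis
    using quotient_wajsberg_iff[OF closed_ops assms] identities by blast
qed

lemma teval_quotient:
  assumes "closed_ops A" "congruence A \<theta>" "\<And>i. i \<in> tvars t \<Longrightarrow> v i \<in> carrier A"
  shows "teval (quotient_hoop A \<theta>) (\<lambda>i. \<theta> `` {v i}) t = \<theta> `` {teval A v t}"
  using assms(3)
  by (induction t) (simp_all add: quotient_ops[OF assms(2)] quotient_one teval_closed[OF assms(1)])

section \<open>Filter congruences and chain quotients\<close>

context wajsberg_hoop
begin

definition filter_congruence :: "'a set \<Rightarrow> ('a \<times> 'a) set" where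
  "filter_congruence F = {(x, y). x \<in> carrier A \<and> y \<in> carrier A \<and> x \<rightharpoonup> y \<in> F \<and> y \<rightharpoonup> x \<in> F}"

lemma filter_trans:
  assumes F: "hfilter F" and c: "x \<in> carrier A" "y \<in> carrier A" "z \<in> carrier A"
    and xy: "x \<rightharpoonup> y \<in> F" and yz: "y \<rightharpoonup> z \<in> F"
  shows "x \<rightharpoonup> z \<in> F"
proof -
  have "x \<otimes> (x \<rightharpoonup> y) \<otimes> (y \<rightharpoonup> z) \<preceq> y \<otimes> (y \<rightharpoonup> z)"
    using c by (simp add: mult_mono1)
  then have "x \<otimes> (x \<rightharpoonup> y) \<otimes> (y \<rightharpoonup> z) \<preceq> z"
    using c le_trans[of "x \<otimes> (x \<rightharpoonup> y) \<otimes> (y \<rightharpoonup> z)" "y \<otimes> (y \<rightharpoonup> z)" z] by simp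
  moreover have "x \<otimes> (x \<rightharpoonup> y) \<otimes> (y \<rightharpoonup> z) = (x \<rightharpoonup> y) \<otimes> (y \<rightharpoonup> z) \<otimes> x"
    using c by (simp add: m_ac)
  ultimately have "(x \<rightharpoonup> y) \<otimes> (y \<rightharpoonup> z) \<preceq> x \<rightharpoonup> z"
    using c by (simp add: currying)
  then show ?thesis
    using filter_up[OF F filter_mult[OF F xy yz]] c by simp
qed

lemma mult_imp_le:
  assumes "x \<in> carrier A" "y \<in> carrier A" "z \<in> carrier A"
  shows "x \<rightharpoonup> y \<preceq> x \<otimes> z \<rightharpoonup> y \<otimes> z"
proof -
  have "(x \<rightharpoonup> y) \<otimes> x \<otimes> z \<preceq> y \<otimes> z"
    using assms by (simp add: mult_mono1)
  then show ?thesis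
    using assms by (simp add: m_assoc currying)
qed

lemma imp_imp_le1:
  assumes "x \<in> carrier A" "y \<in> carrier A" "z \<in> carrier A"
  shows "x \<rightharpoonup> y \<preceq> (y \<rightharpoonup> z) \<rightharpoonup> (x \<rightharpoonup> z)"
proof -
  have "x \<otimes> (x \<rightharpoonup> y) \<otimes> (y \<rightharpoonup> z) \<preceq> y \<otimes> (y \<rightharpoonup> z)"
    using assms by (simp add: mult_mono1)
  then have "x \<otimes> (x \<rightharpoonup> y) \<otimes> (y \<rightharpoonup> z) \<preceq> z"
    using assms le_trans[of "x \<otimes> (x \<rightharpoonup> y) \<otimes> (y \<rightharpoonup> z)" "y \<otimes> (y \<rightharpoonup> z)" z] by simp
  moreover have "x \<otimes> (x \<rightharpoonup> y) \<otimes> (y \<rightharpoonup> z) = (x \<rightharpoonup> y) \<otimes> (y \<rightharpoonup> z) \<otimes> x"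
    using assms by (simp add: m_ac)
  ultimately show ?thesis
    using assms by (simp add: currying)
qed

lemma imp_imp_le2:
  assumes "x \<in> carrier A" "y \<in> carrier A" "z \<in> carrier A"
  shows "x \<rightharpoonup> y \<preceq> (z \<rightharpoonup> x) \<rightharpoonup> (z \<rightharpoonup> y)"
  using imp_imp_le1[of z x y] assms imp_swap[of "x \<rightharpoonup> y" "z \<rightharpoonup> x" "z \<rightharpoonup> y"] by simp

lemma filter_congruence:
  assumes F: "hfilter F"
  shows "congruence A (filter_congruence F)"
proof -
  let ?R = "filter_congruence F"
  have one: "\<one> \<in> F"
    using F by (rule filter_one)
  have D: "x \<in> carrier A" "y \<in> carrier A" "x \<rightharpoonup> y \<in> F" "y \<rightharpoonup> x \<in> F" if "(x, y) \<in> ?R" for x y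
    using that by (auto simp: filter_congruence_def)
  have I: "(x, y) \<in> ?R" if "x \<in> carrier A" "y \<in> carrier A" "x \<rightharpoonup> y \<in> F" "y \<rightharpoonup> x \<in> F" for x y
    using that by (simp add: filter_congruence_def)
  have sym: "(y, x) \<in> ?R" if "(x, y) \<in> ?R" for x y
    using D[OF that] I by blast
  have trans: "(x, z) \<in> ?R" if "(x, y) \<in> ?R" "(y, z) \<in> ?R" for x y z
    using D[OF that(1)] D[OF that(2)] filter_trans[OF F, of x y z] filter_trans[OF F, of z y x]
    by (intro I) simp_all
  have equiv: "equiv (carrier A) ?R"
  proof (intro equivI)
    show "?R \<subseteq> carrier A \<times> carrier A"
      using D by auto
    show "refl_on (carrier A) ?R"
      using one by (simp add: refl_on_def filter_congruence_def)
    show "sym ?R"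
      using sym by (rule symI)
    show "trans ?R"
      using trans by (rule transI)
  qed
  have mult1: "(x \<otimes> z, y \<otimes> z) \<in> ?R" if "(x, y) \<in> ?R" "z \<in> carrier A" for x y z
    using D[OF that(1)] that(2) filter_up[OF F _ _ mult_imp_le[of x y z]]
      filter_up[OF F _ _ mult_imp_le[of y x z]] by (intro I) simp_all
  have mult: "(x \<otimes> y, x' \<otimes> y') \<in> ?R" if "(x, x') \<in> ?R" "(y, y') \<in> ?R" for x x' y y'
  proof (rule trans)
    show "(x \<otimes> y, x' \<otimes> y) \<in> ?R"
      using mult1 that D by blast
    show "(x' \<otimes> y, x' \<otimes> y') \<in> ?R"
      using mult1[OF that(2), of x'] D[OF that(1)] D[OF that(2)] by (simp add: m_comm)
  qed
  have imp: "(x \<rightharpoonup> y, x' \<rightharpoonup> y') \<in> ?R" if xx: "(x, x') \<in> ?R" and yy: "(y, y') \<in> ?R" for x x' y y'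
  proof (rule trans)
    note dx = D[OF xx] and dy = D[OF yy]
    show "(x \<rightharpoonup> y, x' \<rightharpoonup> y) \<in> ?R"
      using dx dy filter_up[OF F _ _ imp_imp_le1[of x x' y]]
        filter_up[OF F _ _ imp_imp_le1[of x' x y]] by (intro I) simp_all
    show "(x' \<rightharpoonup> y, x' \<rightharpoonup> y') \<in> ?R"
      using dx dy filter_up[OF F _ _ imp_imp_le2[of y y' x']]
        filter_up[OF F _ _ imp_imp_le2[of y' y x']] by (intro I) simp_all
  qed
  show ?thesis
    unfolding congruence_def
  proof (intro conjI equiv ballI, clarify)
    fix x x' y y' assume *: "(x, x') \<in> ?R" "(y, y') \<in> ?R"
    show "(x \<otimes> y, x' \<otimes> y') \<in> ?R \<and> (x \<rightharpoonup> y, x' \<rightharpoonup> y') \<in> ?R \<and> (x \<curlywedge> y, x' \<curlywedge> y') \<in> ?R \<and> (x \<curlyvee> y, x' \<curlyvee> y') \<in> ?R"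
      using mult[OF *] imp[OF *] mult[OF *(1) imp[OF *]] imp[OF imp[OF *] *(2)] D[OF *(1)] D[OF *(2)]
      by (simp add: hmeet_eq hjoin_eq)
  qed
qed

text \<open>One of \<open>a \<rightharpoonup> b\<close> and \<open>b \<rightharpoonup> a\<close>
  differs from \<one>; call it \<open>c\<close>. A prime filter omitting \<open>c\<close> makes the
  quotient total by primeness and nontrivial by the class of \<open>c\<close>, and it keeps
  \<open>a\<close> and \<open>b\<close> apart.\<close>

lemma chain_quotient:
  assumes ab: "a \<in> carrier A" "b \<in> carrier A" "a \<noteq> b"
  obtains \<theta> where "congruence A \<theta>" "wajsberg_chain (quotient_hoop A \<theta>)" "(a, b) \<notin> \<theta>"
proof -
  obtain c where c: "c \<in> {a \<rightharpoonup> b, b \<rightharpoonup> a}" "c \<noteq> \<one>"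
    using le_antisym[OF ab(1,2)] ab by blast
  then have cc: "c \<in> carrier A"
    using ab by auto
  obtain F where F: "hfilter F" "c \<notin> F"
    and tot: "\<And>x y. \<lbrakk>x \<in> carrier A; y \<in> carrier A\<rbrakk> \<Longrightarrow> x \<rightharpoonup> y \<in> F \<or> y \<rightharpoonup> x \<in> F"
    using prime_filter_exists[OF cc c(2)] by blast
  let ?t = "filter_congruence F"
  let ?Q = "quotient_hoop A ?t"
  have con: "congruence A ?t"
    using F filter_congruence by blast
  have one_iff: "(x, \<one>) \<in> ?t \<longleftrightarrow> x \<in> F" if "x \<in> carrier A" for x
    using that filter_one[OF F(1)] by (simp add: filter_congruence_def)
  have "wajsberg_chain ?Q"
  proof (intro wajsberg_chain.intro wajsberg_chain_axioms.intro)
    show "wajsberg_hoop ?Q"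
      using con by (rule quotient_wajsberg)
    show "X \<rightharpoonup>\<^bsub>?Q\<^esub> Y = \<one>\<^bsub>?Q\<^esub> \<or> Y \<rightharpoonup>\<^bsub>?Q\<^esub> X = \<one>\<^bsub>?Q\<^esub>" if XY: "X \<in> carrier ?Q" "Y \<in> carrier ?Q" for X Y
    proof -
      obtain x y where "x \<in> carrier A" "X = ?t `` {x}" "y \<in> carrier A" "Y = ?t `` {y}"
        using XY by (auto simp: quotient_carrier)
      then show ?thesis
        using tot[of x y]
        by (simp add: quotient_ops[OF con] quotient_one congruence_class_eq_iff[OF con] one_iff)
    qed
    have "?t `` {c} \<noteq> \<one>\<^bsub>?Q\<^esub>"
      using cc F by (simp add: quotient_one congruence_class_eq_iff[OF con] one_iff)
    then show "\<exists>C \<in> carrier ?Q. C \<noteq> \<one>\<^bsub>?Q\<^esub>"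
      using cc by (auto simp: quotient_carrier)
  qed
  moreover have "(a, b) \<notin> ?t"
    using c F by (auto simp: filter_congruence_def)
  ultimately show ?thesis
    using that con by blast
qed

end

section \<open>Completeness for the unit interval\<close>

abbreviation ev :: "(nat \<Rightarrow> real) \<Rightarrow> hterm \<Rightarrow> real" where
  "ev \<equiv> teval standard_mv"

lemma standard_mv_simps [simp]:
  "carrier standard_mv = {0..1}" "\<one>\<^bsub>standard_mv\<^esub> = 1" "mvzero standard_mv = 0"
  "x \<otimes>\<^bsub>standard_mv\<^esub> y = max 0 (x + y - 1)" "x \<rightharpoonup>\<^bsub>standard_mv\<^esub> y = min 1 (1 - x + y)"
  "x \<curlywedge>\<^bsub>standard_mv\<^esub> y = min x y" "x \<curlyvee>\<^bsub>standard_mv\<^esub> y = max x y"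
  by (simp_all add: standard_mv_def)

lemma wajsberg_hoop_standard_mv: "wajsberg_hoop standard_mv"
  by (intro wajsberg_hoop.intro comm_monoidI wajsberg_hoop_axioms.intro)
    (auto simp: max_def min_def)

section \<open>Partial embeddings of chains and completeness\<close>

primrec subterms :: "hterm \<Rightarrow> hterm set" where
  "subterms (Var i) = {Var i}"
| "subterms One = {One}"
| "subterms (Mult s t) = insert (Mult s t) (subterms s \<union> subterms t)"
| "subterms (Imp s t) = insert (Imp s t) (subterms s \<union> subterms t)"
| "subterms (Meet s t) = insert (Meet s t) (subterms s \<union> subterms t)"
| "subterms (Join s t) = insert (Join s t) (subterms s \<union> subterms t)"

lemma finite_subterms [simp]: "finite (subterms t)"
  by (induction t) auto

lemma subterms_refl [simp]: "t \<in> subterms t"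
  by (induction t) auto

lemma tvars_subterms: "s \<in> subterms t \<Longrightarrow> tvars s \<subseteq> tvars t"
  by (induction t) auto

text \<open>Only finitely many elements of a chain can be sent to the reals at once, and a finite
  set is not closed under the operations; hence each law is asked for only when the result lies in
  \<open>E\<close>.\<close>

definition partial_hom :: "('a, 'c) hoop_scheme \<Rightarrow> 'a set \<Rightarrow> ('a \<Rightarrow> real) \<Rightarrow> bool" where
  "partial_hom A E x \<longleftrightarrow> (\<one>\<^bsub>A\<^esub> \<in> E \<longrightarrow> x \<one>\<^bsub>A\<^esub> = 1) \<and> (\<forall>a \<in> E. x a \<in> {0..1}) \<and> (\<forall>a \<in> E. \<forall>b \<in> E.
     (a \<otimes>\<^bsub>A\<^esub> b \<in> E \<longrightarrow> x (a \<otimes>\<^bsub>A\<^esub> b) = max 0 (x a + x b - 1)) \<and>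
     (a \<rightharpoonup>\<^bsub>A\<^esub> b \<in> E \<longrightarrow> x (a \<rightharpoonup>\<^bsub>A\<^esub> b) = min 1 (1 - x a + x b)) \<and>
     (a \<curlywedge>\<^bsub>A\<^esub> b \<in> E \<longrightarrow> x (a \<curlywedge>\<^bsub>A\<^esub> b) = min (x a) (x b)) \<and>
     (a \<curlyvee>\<^bsub>A\<^esub> b \<in> E \<longrightarrow> x (a \<curlyvee>\<^bsub>A\<^esub> b) = max (x a) (x b)))"

lemma partial_hom_teval:
  assumes "partial_hom A E x" "teval A v ` subterms t \<subseteq> E"
  shows "x (teval A v t) = ev (\<lambda>i. x (v i)) t"
  using assms(2)
proof (induction t)
  case (Mult s t)
  then have "teval A v s \<in> E" "teval A v t \<in> E" "teval A v s \<otimes>\<^bsub>A\<^esub> teval A v t \<in> E"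
    using subterms_refl[of s] subterms_refl[of t] by auto
  then show ?case
    using Mult assms(1) by (auto simp: partial_hom_def image_Un)
next
  case (Imp s t)
  then have "teval A v s \<in> E" "teval A v t \<in> E" "teval A v s \<rightharpoonup>\<^bsub>A\<^esub> teval A v t \<in> E"
    using subterms_refl[of s] subterms_refl[of t] by auto
  then show ?case
    using Imp assms(1) by (auto simp: partial_hom_def image_Un)
next
  case (Meet s t)
  then have "teval A v s \<in> E" "teval A v t \<in> E" "teval A v s \<curlywedge>\<^bsub>A\<^esub> teval A v t \<in> E"
    using subterms_refl[of s] subterms_refl[of t] by auto
  then show ?case
    using Meet assms(1) by (auto simp: partial_hom_def image_Un)
next
  case (Join s t)
  then have "teval A v s \<in> E" "teval A v t \<in> E" "teval A v s \<curlyvee>\<^bsub>A\<^esub> teval A v t \<in> E"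
    using subterms_refl[of s] subterms_refl[of t] by auto
  then show ?case
    using Join assms(1) by (auto simp: partial_hom_def image_Un)
qed (use assms in \<open>auto simp: partial_hom_def\<close>)

context wajsberg_chain
begin

text \<open>Transposition needs a finite part of the cone. Every relation used later has at most two
  elements on each side, so differences of counts between -2 and 2, supported in \<open>E\<close>,
  are enough.\<close>

lemma cone_functional:
  assumes E: "finite E"
  obtains \<phi> :: "'a \<Rightarrow> int" where
    "\<And>M N. \<lbrakk>set_mset M \<subseteq> E; set_mset N \<subseteq> E; size M \<le> 2; size N \<le> 2; sle (msum N) (msum M)\<rbrakk>
      \<Longrightarrow> (\<Sum>e \<in># N. \<phi> e) \<le> (\<Sum>e \<in># M. \<phi> e)"
    "\<And>M N. \<lbrakk>set_mset M \<subseteq> E; set_mset N \<subseteq> E; size M \<le> 2; size N \<le> 2; slt (msum N) (msum M)\<rbrakk>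
      \<Longrightarrow> (\<Sum>e \<in># N. \<phi> e) < (\<Sum>e \<in># M. \<phi> e)"
proof -
  define B where "B = cone \<inter> {g. \<forall>e. (e \<in> E \<longrightarrow> g e \<in> {-2..2}) \<and> (e \<notin> E \<longrightarrow> g e = 0)}"
  have "finite B"
    unfolding B_def using finite_set_of_finite_funs[of E "{-2..2::int}" 0] E by simp
  moreover have "B \<subseteq> cone" "\<And>b i. b \<in> B \<Longrightarrow> i \<notin> E \<Longrightarrow> b i = 0"
    by (simp_all add: B_def)
  ultimately have "\<exists>\<phi> :: 'a \<Rightarrow> int. \<forall>b \<in> B. 0 \<le> (\<Sum>i \<in> E. \<phi> i * b i) \<and>
      ((\<lambda>i. - b i) \<notin> cone \<longrightarrow> 0 < (\<Sum>i \<in> E. \<phi> i * b i))"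
    by (intro motzkin_transposition[OF E cone_zero]) (simp_all add: cone_add)
  then obtain \<phi> :: "'a \<Rightarrow> int" where \<phi>: "\<forall>b \<in> B. 0 \<le> (\<Sum>i \<in> E. \<phi> i * b i) \<and>
      ((\<lambda>i. - b i) \<notin> cone \<longrightarrow> 0 < (\<Sum>i \<in> E. \<phi> i * b i))"
    by blast
  have sum_count: "(\<Sum>e \<in># M. \<phi> e) = (\<Sum>e \<in> E. \<phi> e * int (count M e))" if "set_mset M \<subseteq> E" for M
    using that
  proof (induction M)
    case (add a M)
    have "(\<Sum>e \<in> E. \<phi> e * int (count (add_mset a M) e))
        = (\<Sum>e \<in> E. \<phi> e * int (count M e) + (if e = a then \<phi> e else 0))"
      by (intro sum.cong) (auto simp: algebra_simps)
    also have "\<dots> = (\<Sum>e \<in> E. \<phi> e * int (count M e)) + \<phi> a"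
      using add E by (simp add: sum.distrib)
    finally show ?case
      using add by simp
  qed simp
  have diff: "(\<Sum>i \<in> E. \<phi> i * (int (count M i) - int (count N i))) = (\<Sum>e \<in># M. \<phi> e) - (\<Sum>e \<in># N. \<phi> e)"
    if "set_mset M \<subseteq> E" "set_mset N \<subseteq> E" for M N
    using that by (simp add: sum_count right_diff_distrib sum_subtractf)
  have inB: "(\<lambda>e. int (count M e) - int (count N e)) \<in> B"
    if "set_mset M \<subseteq> E" "set_mset N \<subseteq> E" "size M \<le> 2" "size N \<le> 2" "sle (msum N) (msum M)" for M N
  proof -
    have "int (count M e) - int (count N e) \<in> {-2..2}" for e
    proof -
      have "count M e \<le> 2" "count N e \<le> 2"
        using that count_le_size[of M e] count_le_size[of N e] by linarith+
      then show ?thesis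
        by simp
    qed
    moreover have "count M e = 0" "count N e = 0" if "e \<notin> E" for e
      using that \<open>set_mset M \<subseteq> E\<close> \<open>set_mset N \<subseteq> E\<close> by (auto simp: count_eq_zero_iff)
    ultimately show ?thesis
      using coneI[OF that(5)] by (simp add: B_def)
  qed
  show ?thesis
  proof (rule that)
    fix M N assume *: "set_mset M \<subseteq> E" "set_mset N \<subseteq> E" "size M \<le> 2" "size N \<le> 2"
    show "(\<Sum>e \<in># N. \<phi> e) \<le> (\<Sum>e \<in># M. \<phi> e)" if "sle (msum N) (msum M)"
      using bspec[OF \<phi> inB[OF * that]] by (simp add: diff *)
    show "(\<Sum>e \<in># N. \<phi> e) < (\<Sum>e \<in># M. \<phi> e)" if "slt (msum N) (msum M)"
    proof -
      have "sle (msum N) (msum M)"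
        using that by (simp add: sle_def)
      then show ?thesis
        using bspec[OF \<phi> inB[OF *]] cone_strict[OF that] by (simp add: diff *)
    qed
  qed
qed

text \<open>A linear functional on the finitely many relevant elements of the ordered group, scaled so
  that the complement of the least element (if there is one) has length 1, gives the embedding.\<close>

lemma chain_partial_embedding:
  assumes fin: "finite E0" and E0: "E0 \<subseteq> carrier A"
  shows "\<exists>x. partial_hom A E0 x \<and> inj_on x E0"
proof -
  \<comment> \<open>The element \<one> is added so that its complement can be shown to have length
    0, and the least element so that it can serve as the unit of length.\<close>
  define E where "E = E0 \<union> {\<one>} \<union> {z \<in> carrier A. \<not> nonleast z}"
  have "finite {z \<in> carrier A. \<not> nonleast z}"
  proof (cases "{z \<in> carrier A. \<not> nonleast z} = {}")
    case False
    then obtain z where "z \<in> carrier A" "\<not> nonleast z"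
      by blast
    then have "{z \<in> carrier A. \<not> nonleast z} \<subseteq> {z}"
      using least_unique by blast
    then show ?thesis
      by (rule finite_subset) simp
  qed (simp only: finite.emptyI)
  then have E: "finite E"
    using fin by (simp add: E_def)
  have EC: "e \<in> carrier A" if "e \<in> E" for e
    using that E0 by (auto simp: E_def)
  have oneE: "\<one> \<in> E"
    by (simp add: E_def)
  obtain \<phi> :: "'a \<Rightarrow> int" where
    le: "\<And>M N. \<lbrakk>set_mset M \<subseteq> E; set_mset N \<subseteq> E; size M \<le> 2; size N \<le> 2; sle (msum N) (msum M)\<rbrakk>
      \<Longrightarrow> (\<Sum>e \<in># N. \<phi> e) \<le> (\<Sum>e \<in># M. \<phi> e)" and
    lt: "\<And>M N. \<lbrakk>set_mset M \<subseteq> E; set_mset N \<subseteq> E; size M \<le> 2; size N \<le> 2; slt (msum N) (msum M)\<rbrakk>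
      \<Longrightarrow> (\<Sum>e \<in># N. \<phi> e) < (\<Sum>e \<in># M. \<phi> e)"
    using cone_functional[OF E] by blast
  have nonneg: "0 \<le> \<phi> e" if "e \<in> E" for e
    using le[of "{#e#}" "{#}"] that msum_nonneg[OF EC] by (simp del: msum_add msum_empty)
  have mono: "\<phi> a \<le> \<phi> b" if "a \<in> E" "b \<in> E" "b \<preceq> a" for a b
    using le[of "{#b#}" "{#a#}"] that msum_antimono(1)[of a b] EC by (simp del: msum_add)
  have strict: "\<phi> a < \<phi> b" if "a \<in> E" "b \<in> E" "b \<preceq> a" "b \<noteq> a" for a b
    using lt[of "{#b#}" "{#a#}"] that msum_antimono(2)[of a b] EC by (simp del: msum_add)
  have one: "\<phi> \<one> = 0"
    using le[of "{#}" "{#\<one>#}"] nonneg[OF oneE] oneE msum_one[of "{#}"] by (simp add: sle_def)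
  have add: "\<phi> a + \<phi> b = \<phi> c" if "a \<in> E" "b \<in> E" "c \<in> E" "msum {#a, b#} = msum {#c#}" for a b c
    using le[of "{#a, b#}" "{#c#}"] le[of "{#c#}" "{#a, b#}"] that by (simp add: sle_def del: msum_add)
  obtain T :: int where T: "0 < T" "\<And>e. e \<in> E \<Longrightarrow> \<phi> e \<le> T"
    "\<And>e. \<lbrakk>e \<in> E; \<not> nonleast e\<rbrakk> \<Longrightarrow> \<phi> e = T"
  proof (cases "\<exists>z \<in> E. \<not> nonleast z")
    case True
    then obtain z where z: "z \<in> E" "\<not> nonleast z"
      by blast
    have "0 < \<phi> z"
      using lt[of "{#z#}" "{#}"] z msum_least_pos[OF EC] by (simp del: msum_add msum_empty)
    moreover have "\<phi> e \<le> \<phi> z" if "e \<in> E" for e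
      using mono[OF that z(1)] least_le EC that z by blast
    moreover have "\<phi> e = \<phi> z" if "e \<in> E" "\<not> nonleast e" for e
      using least_unique[of e z] EC that z by blast
    ultimately show ?thesis
      using that by blast
  next
    case False
    \<comment> \<open>Without a least element any positive upper bound can be the unit; the summand
      1 keeps it positive even if \<phi> vanishes on \<open>E\<close>.\<close>
    have "\<phi> e \<le> 1 + (\<Sum>e \<in> E. \<phi> e)" if "e \<in> E" for e
      using member_le_sum[of e E \<phi>] E that nonneg by simp
    moreover have "0 < 1 + (\<Sum>e \<in> E. \<phi> e)"
      using sum_nonneg[of E \<phi>] nonneg by simp
    ultimately show ?thesis
      using that[of "1 + (\<Sum>e \<in> E. \<phi> e)"] False by blast
  qed
  \<comment> \<open>This undoes the complement: \<open>\<phi> e / T\<close> is the length of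
    \<open>y\<^sub>e\<close>, so \<one> goes to 1 and a least element to 0.\<close>
  define x where "x e = 1 - real_of_int (\<phi> e) / real_of_int T" for e :: 'a
  have le_x: "x a \<le> x b \<longleftrightarrow> \<phi> b \<le> \<phi> a" for a b
    using T(1) by (simp add: x_def divide_le_cancel)
  have mono_x: "x a \<le> x b" if "a \<in> E" "b \<in> E" "a \<preceq> b" for a b
    using mono[of b a] that by (simp add: le_x)
  have range: "x e \<in> {0..1}" if "e \<in> E" for e
    using T that nonneg[OF that] by (simp add: x_def)
  have inj: "x a \<noteq> x b" if ab: "a \<in> E" "b \<in> E" "a \<noteq> b" for a b
  proof -
    have "\<phi> a \<noteq> \<phi> b"
      using total[of a b] EC strict[of a b] strict[of b a] ab by force
    then show ?thesis
      using T(1) by (simp add: x_def)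
  qed
  have tot: "a \<preceq> b \<or> b \<preceq> a" if "a \<in> E" "b \<in> E" for a b
    using total[of a b] that EC by blast
  have x_add: "x c = x a + x b - 1" if "\<phi> a + \<phi> b = \<phi> c" for a b c
    using T(1) by (simp add: x_def field_simps flip: that)
  have mult: "x (a \<otimes> b) = max 0 (x a + x b - 1)" if ab: "a \<in> E" "b \<in> E" "a \<otimes> b \<in> E" for a b
  proof (cases "nonleast (a \<otimes> b)")
    case True
    have "x (a \<otimes> b) = x a + x b - 1"
      using True ab EC by (intro x_add add msum_mult) auto
    then show ?thesis
      using range[OF ab(3)] by simp
  next
    \<comment> \<open>The product is least, so its image is 0; by \<open>msum_least_mult\<close> the
      lengths of \<open>a\<close> and \<open>b\<close> reach \<open>T\<close>, which truncates the
      right-hand side as well.\<close>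
    case False
    have "x (a \<otimes> b) = 0"
      using T(1) T(3)[OF ab(3) False] by (simp add: x_def)
    moreover have "\<phi> (a \<otimes> b) \<le> \<phi> a + \<phi> b"
      using le[of "{#a, b#}" "{#a \<otimes> b#}"] msum_least_mult[of a b] False ab EC by (simp del: msum_add)
    then have "T \<le> \<phi> a + \<phi> b"
      using T(3)[OF ab(3) False] by simp
    then have "real_of_int T \<le> real_of_int (\<phi> a) + real_of_int (\<phi> b)"
      by (simp flip: of_int_add)
    then have "1 \<le> (real_of_int (\<phi> a) + real_of_int (\<phi> b)) / real_of_int T"
      using T(1) by simp
    then have "x a + x b - 1 \<le> 0"
      by (simp add: x_def add_divide_distrib)
    ultimately show ?thesis
      by simp
  qed
  have x_one: "x \<one> = 1"
    by (simp add: x_def one)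
  have imp: "x (a \<rightharpoonup> b) = min 1 (1 - x a + x b)" if ab: "a \<in> E" "b \<in> E" "a \<rightharpoonup> b \<in> E" for a b
  proof (cases "a \<preceq> b")
    case True
    then show ?thesis
      using mono_x[OF ab(1,2)] x_one by simp
  next
    case False
    then have ba: "b \<preceq> a"
      using tot ab by blast
    have "x b = x a + x (a \<rightharpoonup> b) - 1"
      using ba ab EC by (intro x_add add msum_residual) auto
    then show ?thesis
      using range[OF ab(3)] by simp
  qed
  have meet: "x (a \<curlywedge> b) = min (x a) (x b)" if ab: "a \<in> E" "b \<in> E" for a b
    using tot[OF ab]
  proof
    assume "a \<preceq> b"
    then show ?thesis
      using mono_x[OF ab] ab EC by (simp add: hmeet_eq)
  next
    assume "b \<preceq> a"
    then show ?thesis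
      using mono_x[of b a] ab EC by (simp add: hmeet_eq mult_imp_eq)
  qed
  have join: "x (a \<curlyvee> b) = max (x a) (x b)" if ab: "a \<in> E" "b \<in> E" for a b
    using tot[OF ab]
  proof
    assume "a \<preceq> b"
    then show ?thesis
      using mono_x[OF ab] ab EC by (simp add: hjoin_eq)
  next
    assume "b \<preceq> a"
    then show ?thesis
      using mono_x[of b a] ab EC by (simp add: hjoin_eq imp_imp_eq)
  qed
  have E0E: "e \<in> E" if "e \<in> E0" for e
    using that by (simp add: E_def)
  have "partial_hom A E0 x"
    unfolding partial_hom_def using x_one range mult imp meet join E0E by simp
  moreover have "inj_on x E0"
    using inj E0E by (intro inj_onI) blast
  ultimately show ?thesis
    by blast
qed

text \<open>The finite set to be embedded contains the values of all subterms, so evaluation in the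
  chain and in the unit interval run in parallel; injectivity of the embedding reflects
  equality.\<close>

lemma chain_completeness:
  assumes v: "\<And>i. i < n \<Longrightarrow> v i \<in> carrier A" and Ts: "finite Ts" "\<And>t. t \<in> Ts \<Longrightarrow> tvars t \<subseteq> {..<n}"
  shows "\<exists>y \<in> cube n. \<forall>s \<in> Ts. \<forall>t \<in> Ts. teval A v s = teval A v t \<longleftrightarrow> ev y s = ev y t"
proof -
  define E where "E = v ` {..<n} \<union> (\<Union>t \<in> Ts. teval A v ` subterms t)"
  have "finite E"
    using Ts by (simp add: E_def)
  have cl: "teval A v s \<in> carrier A" if "s \<in> subterms t" "t \<in> Ts" for s t
    using tvars_subterms[OF that(1)] Ts(2)[OF that(2)] v
    by (intro teval_closed[OF closed_ops]) blast
  have "E \<subseteq> carrier A"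
    using v cl by (auto simp: E_def)
  then obtain x where x: "partial_hom A E x" "inj_on x E"
    using chain_partial_embedding[OF \<open>finite E\<close>] by blast
  define y where "y i = (if i < n then x (v i) else 0)" for i
  have "y \<in> cube n"
    using x(1) by (auto simp: cube_def space_def y_def partial_hom_def E_def)
  moreover have eq: "x (teval A v t) = ev y t" if "t \<in> Ts" for t
  proof -
    have "x (teval A v t) = ev (\<lambda>i. x (v i)) t"
      using that by (intro partial_hom_teval[OF x(1)]) (auto simp: E_def)
    also have "\<dots> = ev y t"
      using Ts(2)[OF that] by (intro teval_cong) (auto simp: y_def)
    finally show ?thesis .
  qed
  moreover have "teval A v t \<in> E" if "t \<in> Ts" for t
    using that subterms_refl unfolding E_def by blast
  ultimately show ?thesis
    using inj_on_eq_iff[OF x(2)] by (intro bexI[of _ y]) (metis, blast)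
qed

end

text \<open>A chain quotient keeps the equations of \<open>R\<close> and still separates
  \<open>s\<close> from \<open>t\<close>; the point given by \<open>chain_completeness\<close> then
  refutes \<open>valid\<close>.\<close>

theorem (in wajsberg_hoop) completeness:
  assumes v: "\<And>i. i < n \<Longrightarrow> v i \<in> carrier A"
    and R: "finite R" "\<And>p q. (p, q) \<in> R \<Longrightarrow> tvars p \<subseteq> {..<n} \<and> tvars q \<subseteq> {..<n} \<and> teval A v p = teval A v q"
    and st: "tvars s \<subseteq> {..<n}" "tvars t \<subseteq> {..<n}"
    and valid: "\<And>y. \<lbrakk>y \<in> cube n; \<And>p q. (p, q) \<in> R \<Longrightarrow> ev y p = ev y q\<rbrakk> \<Longrightarrow> ev y s = ev y t"
  shows "teval A v s = teval A v t"
proof (rule ccontr)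
  have cl: "teval A v u \<in> carrier A" if "tvars u \<subseteq> {..<n}" for u
    using that v by (intro teval_closed[OF closed_ops]) blast
  assume "teval A v s \<noteq> teval A v t"
  then obtain \<theta> where \<theta>: "congruence A \<theta>" "wajsberg_chain (quotient_hoop A \<theta>)"
    and ne: "(teval A v s, teval A v t) \<notin> \<theta>"
    using chain_quotient[OF cl[OF st(1)] cl[OF st(2)]] by blast
  interpret Q: wajsberg_chain "quotient_hoop A \<theta>"
    by (rule \<theta>)
  let ?v = "\<lambda>i. \<theta> `` {v i}"
  have tq: "teval (quotient_hoop A \<theta>) ?v u = \<theta> `` {teval A v u}" if "tvars u \<subseteq> {..<n}" for u
    using that v by (intro teval_quotient[OF closed_ops \<theta>(1)]) blast
  let ?Ts = "{s, t} \<union> fst ` R \<union> snd ` R"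
  have vq: "?v i \<in> carrier (quotient_hoop A \<theta>)" if "i < n" for i
    using v[OF that] by (auto simp: quotient_carrier)
  have tv: "tvars u \<subseteq> {..<n}" if "u \<in> ?Ts" for u
    using that R(2) st by fastforce
  have fin: "finite ?Ts"
    using R(1) by simp
  obtain y where y: "y \<in> cube n"
    and eq': "\<forall>p \<in> ?Ts. \<forall>q \<in> ?Ts.
      teval (quotient_hoop A \<theta>) ?v p = teval (quotient_hoop A \<theta>) ?v q \<longleftrightarrow> ev y p = ev y q"
    using Q.chain_completeness[of n ?v ?Ts, OF vq fin tv] by blast
  note eq = eq'[rule_format]
  have "ev y p = ev y q" if "(p, q) \<in> R" for p q
  proof -
    have "p \<in> ?Ts" "q \<in> ?Ts"
      using that by force+
    then show ?thesis
      using eq[of p q] R(2)[OF that] by (simp add: tq)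
  qed
  then have "ev y s = ev y t"
    using valid y by blast
  then have "\<theta> `` {teval A v s} = \<theta> `` {teval A v t}"
    using eq[of s t] st by (simp add: tq)
  then show False
    using ne congruence_class_eq_iff[OF \<theta>(1) cl[OF st(1)] cl[OF st(2)]] by simp
qed

section \<open>Finite presentations\<close>

lemma hoop_homD:
  assumes "f \<in> hoop_hom A B"
  shows "f \<in> extensional (carrier A)" "f \<one>\<^bsub>A\<^esub> = \<one>\<^bsub>B\<^esub>"
    and "x \<in> carrier A \<Longrightarrow> f x \<in> carrier B"
    and "\<lbrakk>x \<in> carrier A; y \<in> carrier A\<rbrakk> \<Longrightarrow> f (x \<otimes>\<^bsub>A\<^esub> y) = f x \<otimes>\<^bsub>B\<^esub> f y"
    and "\<lbrakk>x \<in> carrier A; y \<in> carrier A\<rbrakk> \<Longrightarrow> f (x \<rightharpoonup>\<^bsub>A\<^esub> y) = f x \<rightharpoonup>\<^bsub>B\<^esub> f y"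
    and "\<lbrakk>x \<in> carrier A; y \<in> carrier A\<rbrakk> \<Longrightarrow> f (x \<curlywedge>\<^bsub>A\<^esub> y) = f x \<curlywedge>\<^bsub>B\<^esub> f y"
    and "\<lbrakk>x \<in> carrier A; y \<in> carrier A\<rbrakk> \<Longrightarrow> f (x \<curlyvee>\<^bsub>A\<^esub> y) = f x \<curlyvee>\<^bsub>B\<^esub> f y"
  using assms by (auto simp: hoop_hom_def hom_def)

lemma hoop_homI:
  assumes "f \<in> extensional (carrier A)" "f \<one>\<^bsub>A\<^esub> = \<one>\<^bsub>B\<^esub>"
    and "\<And>x. x \<in> carrier A \<Longrightarrow> f x \<in> carrier B"
    and "\<And>x y. \<lbrakk>x \<in> carrier A; y \<in> carrier A\<rbrakk> \<Longrightarrow> f (x \<otimes>\<^bsub>A\<^esub> y) = f x \<otimes>\<^bsub>B\<^esub> f y"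
    and "\<And>x y. \<lbrakk>x \<in> carrier A; y \<in> carrier A\<rbrakk> \<Longrightarrow> f (x \<rightharpoonup>\<^bsub>A\<^esub> y) = f x \<rightharpoonup>\<^bsub>B\<^esub> f y"
    and "\<And>x y. \<lbrakk>x \<in> carrier A; y \<in> carrier A\<rbrakk> \<Longrightarrow> f (x \<curlywedge>\<^bsub>A\<^esub> y) = f x \<curlywedge>\<^bsub>B\<^esub> f y"
    and "\<And>x y. \<lbrakk>x \<in> carrier A; y \<in> carrier A\<rbrakk> \<Longrightarrow> f (x \<curlyvee>\<^bsub>A\<^esub> y) = f x \<curlyvee>\<^bsub>B\<^esub> f y"
  shows "f \<in> hoop_hom A B"
  using assms by (auto simp: hoop_hom_def hom_def)

lemma hoop_hom_teval:
  assumes f: "f \<in> hoop_hom A B" and cl: "closed_ops A" and v: "\<And>i. i \<in> tvars t \<Longrightarrow> v i \<in> carrier A"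
  shows "f (teval A v t) = teval B (\<lambda>i. f (v i)) t"
  using v by (induction t) (simp_all add: hoop_homD[OF f] teval_closed[OF cl])

lemma hoop_hom_comp:
  assumes f: "f \<in> hoop_hom A B" and g: "g \<in> hoop_hom B C" and cl: "closed_ops A"
  shows "compose (carrier A) g f \<in> hoop_hom A C"
  by (intro hoop_homI)
    (simp_all add: compose_def closed_opsD[OF cl] hoop_homD[OF f] hoop_homD[OF g])

lemma hoop_hom_id:
  assumes cl: "closed_ops A"
  shows "(\<lambda>x \<in> carrier A. x) \<in> hoop_hom A A"
  by (intro hoop_homI) (simp_all add: closed_opsD[OF cl])

lemma hoop_hom_inverse:
  assumes f: "f \<in> hoop_hom A B" and bij: "bij_betw f (carrier A) (carrier B)"
    and cA: "closed_ops A" and cB: "closed_ops B"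
  shows "(\<lambda>y \<in> carrier B. inv_into (carrier A) f y) \<in> hoop_hom B A"
proof -
  let ?g = "inv_into (carrier A) f"
  have gc: "?g y \<in> carrier A" "f (?g y) = y" if "y \<in> carrier B" for y
    using that bij bij_betw_imp_surj_on[OF bij] by (auto simp: inv_into_into f_inv_into_f)
  have eqI: "?g y = x" if "x \<in> carrier A" "f x = y" for x y
    using inv_into_f_eq[OF bij_betw_imp_inj_on[OF bij] that] .
  show ?thesis
    by (intro hoop_homI)
      (simp_all add: closed_opsD[OF cA] closed_opsD[OF cB] gc eqI hoop_homD[OF f])
qed

lemma kernel_congruence:
  assumes cl: "closed_ops A"
    and "\<And>x y. \<lbrakk>x \<in> carrier A; y \<in> carrier A\<rbrakk> \<Longrightarrow> f (x \<otimes>\<^bsub>A\<^esub> y) = f x \<otimes>\<^bsub>B\<^esub> f y"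
    and "\<And>x y. \<lbrakk>x \<in> carrier A; y \<in> carrier A\<rbrakk> \<Longrightarrow> f (x \<rightharpoonup>\<^bsub>A\<^esub> y) = f x \<rightharpoonup>\<^bsub>B\<^esub> f y"
    and "\<And>x y. \<lbrakk>x \<in> carrier A; y \<in> carrier A\<rbrakk> \<Longrightarrow> f (x \<curlywedge>\<^bsub>A\<^esub> y) = f x \<curlywedge>\<^bsub>B\<^esub> f y"
    and "\<And>x y. \<lbrakk>x \<in> carrier A; y \<in> carrier A\<rbrakk> \<Longrightarrow> f (x \<curlyvee>\<^bsub>A\<^esub> y) = f x \<curlyvee>\<^bsub>B\<^esub> f y"
  shows "congruence A {(x, y). x \<in> carrier A \<and> y \<in> carrier A \<and> f x = f y}"
proof -
  have "equiv (carrier A) {(x, y). x \<in> carrier A \<and> y \<in> carrier A \<and> f x = f y}"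
    by (intro equivI) (auto simp: refl_on_def sym_def trans_def)
  then show ?thesis
    unfolding congruence_def using assms(2-) by (auto intro: closed_opsD[OF cl])
qed

lemma congruence_Inter:
  assumes "S \<noteq> {}" and S: "\<And>\<theta>. \<theta> \<in> S \<Longrightarrow> congruence A \<theta>"
  shows "congruence A (\<Inter>S)"
proof -
  have eq: "equiv (carrier A) \<theta>" if "\<theta> \<in> S" for \<theta>
    using S[OF that] by (simp add: congruence_def)
  have "equiv (carrier A) (\<Inter>S)"
  proof (intro equivI)
    show "\<Inter>S \<subseteq> carrier A \<times> carrier A"
      using assms(1) eq unfolding equiv_def refl_on_def by blast
    show "refl_on (carrier A) (\<Inter>S)"
      using assms(1) eq unfolding equiv_def refl_on_def by blast
    show "sym (\<Inter>S)"
      using eq unfolding equiv_def sym_def by blast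
    show "trans (\<Inter>S)"
      using eq unfolding equiv_def trans_def by (meson InterD InterI)
  qed
  moreover have "(x \<otimes>\<^bsub>A\<^esub> y, x' \<otimes>\<^bsub>A\<^esub> y') \<in> \<theta> \<and> (x \<rightharpoonup>\<^bsub>A\<^esub> y, x' \<rightharpoonup>\<^bsub>A\<^esub> y') \<in> \<theta> \<and>
      (x \<curlywedge>\<^bsub>A\<^esub> y, x' \<curlywedge>\<^bsub>A\<^esub> y') \<in> \<theta> \<and> (x \<curlyvee>\<^bsub>A\<^esub> y, x' \<curlyvee>\<^bsub>A\<^esub> y') \<in> \<theta>"
    if "(x, x') \<in> \<Inter>S" "(y, y') \<in> \<Inter>S" "\<theta> \<in> S" for x x' y y' \<theta>
  proof -
    have "(x, x') \<in> \<theta>" "(y, y') \<in> \<theta>"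
      using that by blast+
    then show ?thesis
      using congruenceD(2-)[OF S[OF that(3)]] by simp
  qed
  then have "\<forall>(x, x') \<in> \<Inter>S. \<forall>(y, y') \<in> \<Inter>S.
      (x \<otimes>\<^bsub>A\<^esub> y, x' \<otimes>\<^bsub>A\<^esub> y') \<in> \<Inter>S \<and> (x \<rightharpoonup>\<^bsub>A\<^esub> y, x' \<rightharpoonup>\<^bsub>A\<^esub> y') \<in> \<Inter>S \<and>
      (x \<curlywedge>\<^bsub>A\<^esub> y, x' \<curlywedge>\<^bsub>A\<^esub> y') \<in> \<Inter>S \<and> (x \<curlyvee>\<^bsub>A\<^esub> y, x' \<curlyvee>\<^bsub>A\<^esub> y') \<in> \<Inter>S"
    by (intro ballI, clarify) (intro conjI InterI; blast)
  ultimately show ?thesis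
    unfolding congruence_def by blast
qed

text \<open>Guarantees that the families whose intersections define \<open>free_congruence\<close>
  and \<open>generated_congruence\<close> are nonempty.\<close>

lemma total_congruence:
  assumes cl: "closed_ops A"
  shows "congruence A (carrier A \<times> carrier A)"
    and "wajsberg_identities A (carrier A \<times> carrier A)"
proof -
  have "equiv (carrier A) (carrier A \<times> carrier A)"
    by (intro equivI) (auto simp: refl_on_def sym_def trans_def)
  then show "congruence A (carrier A \<times> carrier A)"
    unfolding congruence_def by (auto intro: closed_opsD[OF cl])
  show "wajsberg_identities A (carrier A \<times> carrier A)"
    unfolding wajsberg_identities_def by (simp add: closed_opsD[OF cl])
qed

lemma ev_range: "y \<in> cube n \<Longrightarrow> tvars t \<subseteq> {..<n} \<Longrightarrow> ev y t \<in> {0..1}"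
  using teval_closed[OF wajsberg_hoop.closed_ops[OF wajsberg_hoop_standard_mv], of t y]
  by (auto simp: cube_def)

section \<open>Presentations by solution sets\<close>

definition sol :: "nat \<Rightarrow> (hterm \<times> hterm) set \<Rightarrow> point set" where
  "sol n R = {y \<in> cube n. \<forall>(p, q) \<in> R. ev y p = ev y q}"

text \<open>Up to isomorphism, \<open>A\<close> is the algebra of term functions on
  \<open>P\<close>, with \<open>g\<close> as the coordinate functions. Phrased through equations, it
  applies alike to quotients of free hoops, to given hoops and to hoops of positive
  functions.\<close>

definition presented :: "nat \<Rightarrow> point set \<Rightarrow> ('a, 'c) hoop_scheme \<Rightarrow> (nat \<Rightarrow> 'a) \<Rightarrow> bool" where
  "presented n P A g \<longleftrightarrow> wajsberg_hoop A \<and> (\<forall>i < n. g i \<in> carrier A) \<and>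
     carrier A = teval A g ` {t. tvars t \<subseteq> {..<n}} \<and>
     (\<forall>s t. tvars s \<subseteq> {..<n} \<longrightarrow> tvars t \<subseteq> {..<n} \<longrightarrow>
        (teval A g s = teval A g t \<longleftrightarrow> (\<forall>y \<in> P. ev y s = ev y t)))"

lemma presentedD:
  assumes "presented n P A g"
  shows "wajsberg_hoop A" "i < n \<Longrightarrow> g i \<in> carrier A"
    and "carrier A = teval A g ` {t. tvars t \<subseteq> {..<n}}"
    and "\<lbrakk>tvars s \<subseteq> {..<n}; tvars t \<subseteq> {..<n}\<rbrakk> \<Longrightarrow>
      teval A g s = teval A g t \<longleftrightarrow> (\<forall>y \<in> P. ev y s = ev y t)"
  using assms unfolding presented_def by blast+

definition free_congruence :: "nat \<Rightarrow> (hterm \<times> hterm) set" where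
  "free_congruence n = \<Inter>{\<theta>. congruence (term_hoop n) \<theta> \<and> wajsberg_hoop (quotient_hoop (term_hoop n) \<theta>)}"

lemma free_hoop_eq: "free_hoop n = quotient_hoop (term_hoop n) (free_congruence n)"
  by (simp add: free_hoop_def free_congruence_def)

text \<open>The Wajsberg identities modulo a congruence survive intersection, so the intersection
  belongs to the family that defines it.\<close>

lemma
  shows free_congruence: "congruence (term_hoop n) (free_congruence n)"
    and wajsberg_hoop_free_hoop: "wajsberg_hoop (free_hoop n)"
proof -
  note cl = closed_ops_term_hoop[of n]
  let ?S = "{\<theta>. congruence (term_hoop n) \<theta> \<and> wajsberg_hoop (quotient_hoop (term_hoop n) \<theta>)}"
  have "carrier (term_hoop n) \<times> carrier (term_hoop n) \<in> ?S"
    using total_congruence[OF cl] quotient_wajsberg_iff[OF cl] by blast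
  then show con: "congruence (term_hoop n) (free_congruence n)"
    unfolding free_congruence_def by (intro congruence_Inter) auto
  have "wajsberg_identities (term_hoop n) \<theta>" if "\<theta> \<in> ?S" for \<theta>
    using that quotient_wajsberg_iff[OF cl] by blast
  then have "wajsberg_identities (term_hoop n) (free_congruence n)"
    unfolding free_congruence_def wajsberg_identities_def by simp
  then show "wajsberg_hoop (free_hoop n)"
    using quotient_wajsberg_iff[OF cl con] by (simp add: free_hoop_eq)
qed

lemma generated_congruence:
  assumes cl: "closed_ops A" and R: "R \<subseteq> carrier A \<times> carrier A"
  shows "congruence A (generated_congruence A R)"
  unfolding generated_congruence_def
  using total_congruence(1)[OF cl] R by (intro congruence_Inter) auto

lemma teval_term_hoop: "teval (term_hoop n) Var t = t"
  by (induction t) (simp_all add: term_hoop_def)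

text \<open>The kernel of evaluation at \<open>y\<close> is itself one of the congruences being
  intersected, because the identities hold in the unit interval.\<close>

lemma free_congruence_sound:
  assumes y: "y \<in> cube n" and st: "(s, t) \<in> free_congruence n"
  shows "ev y s = ev y t"
proof -
  let ?T = "term_hoop n"
  let ?K = "{(s, t). s \<in> carrier ?T \<and> t \<in> carrier ?T \<and> ev y s = ev y t}"
  note cl = closed_ops_term_hoop[of n]
  have con: "congruence ?T ?K"
    by (intro kernel_congruence[OF cl, where B = standard_mv]) (simp_all add: term_hoop_def)
  have range: "ev y t \<in> carrier standard_mv" if "t \<in> carrier ?T" for t
    using ev_range[OF y, of t] that by (simp add: term_hoop_def)
  have "wajsberg_identities ?T ?K"
    unfolding wajsberg_identities_def
  proof (intro ballI)
    fix r s t assume rst: "r \<in> carrier ?T" "s \<in> carrier ?T" "t \<in> carrier ?T"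
    show "(r \<otimes>\<^bsub>?T\<^esub> s \<otimes>\<^bsub>?T\<^esub> t, r \<otimes>\<^bsub>?T\<^esub> (s \<otimes>\<^bsub>?T\<^esub> t)) \<in> ?K \<and> (r \<otimes>\<^bsub>?T\<^esub> s, s \<otimes>\<^bsub>?T\<^esub> r) \<in> ?K \<and>
     (\<one>\<^bsub>?T\<^esub> \<otimes>\<^bsub>?T\<^esub> r, r) \<in> ?K \<and> (r \<rightharpoonup>\<^bsub>?T\<^esub> r, \<one>\<^bsub>?T\<^esub>) \<in> ?K \<and>
     (r \<otimes>\<^bsub>?T\<^esub> (r \<rightharpoonup>\<^bsub>?T\<^esub> s), s \<otimes>\<^bsub>?T\<^esub> (s \<rightharpoonup>\<^bsub>?T\<^esub> r)) \<in> ?K \<and>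
     ((r \<otimes>\<^bsub>?T\<^esub> s) \<rightharpoonup>\<^bsub>?T\<^esub> t, r \<rightharpoonup>\<^bsub>?T\<^esub> (s \<rightharpoonup>\<^bsub>?T\<^esub> t)) \<in> ?K \<and>
     ((r \<rightharpoonup>\<^bsub>?T\<^esub> s) \<rightharpoonup>\<^bsub>?T\<^esub> s, (s \<rightharpoonup>\<^bsub>?T\<^esub> r) \<rightharpoonup>\<^bsub>?T\<^esub> r) \<in> ?K \<and>
     (r \<curlywedge>\<^bsub>?T\<^esub> s, r \<otimes>\<^bsub>?T\<^esub> (r \<rightharpoonup>\<^bsub>?T\<^esub> s)) \<in> ?K \<and>
     (r \<curlyvee>\<^bsub>?T\<^esub> s, (r \<rightharpoonup>\<^bsub>?T\<^esub> s) \<rightharpoonup>\<^bsub>?T\<^esub> s) \<in> ?K"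
      using rst[THEN range] rst
      by (simp add: term_hoop_def) (intro conjI; linarith)
  qed
  then have "wajsberg_hoop (quotient_hoop ?T ?K)"
    using quotient_wajsberg_iff[OF cl con] by simp
  then have "(s, t) \<in> ?K"
    using st con unfolding free_congruence_def by blast
  then show ?thesis
    by simp
qed

definition free_class :: "nat \<Rightarrow> hterm \<Rightarrow> hterm set" where
  "free_class n t = free_congruence n `` {t}"

lemma free_hoop_carrier: "carrier (free_hoop n) = free_class n ` {t. tvars t \<subseteq> {..<n}}"
  by (simp add: free_hoop_eq quotient_carrier free_class_def term_hoop_def)

lemma teval_free_hoop:
  assumes "tvars t \<subseteq> {..<n}"
  shows "teval (free_hoop n) (\<lambda>i. free_class n (Var i)) t = free_class n t"
proof -
  have "Var i \<in> carrier (term_hoop n)" if "i \<in> tvars t" for i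
    using assms that by (auto simp: term_hoop_def)
  then show ?thesis
    using teval_quotient[OF closed_ops_term_hoop free_congruence, of t Var n]
    by (simp add: free_hoop_eq free_class_def teval_term_hoop)
qed

text \<open>Evaluation at a solution factors through the free hoop, and its kernel contains the
  given relations, hence the congruence they generate. The converse is \<open>completeness\<close>
  in the quotient, where the equations of \<open>R\<close> hold.\<close>

lemma quotient_free_hoop_presented:
  assumes R: "finite R" "\<And>p q. (p, q) \<in> R \<Longrightarrow> tvars p \<subseteq> {..<n} \<and> tvars q \<subseteq> {..<n}"
  defines "R' \<equiv> map_prod (free_class n) (free_class n) ` R"
  shows "\<exists>g. presented n (sol n R) (quotient_hoop (free_hoop n) (generated_congruence (free_hoop n) R')) g"
proof -
  let ?Fr = "free_hoop n"
  let ?G = "generated_congruence ?Fr R'"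
  let ?Q = "quotient_hoop ?Fr ?G"
  let ?g = "\<lambda>i. ?G `` {free_class n (Var i)}"
  interpret Fr: wajsberg_hoop ?Fr
    by (rule wajsberg_hoop_free_hoop)
  have R': "R' \<subseteq> carrier ?Fr \<times> carrier ?Fr"
    using R(2) by (force simp: R'_def free_hoop_carrier)
  then have con: "congruence ?Fr ?G"
    by (rule generated_congruence[OF Fr.closed_ops])
  interpret Q: wajsberg_hoop ?Q
    using con by (rule Fr.quotient_wajsberg)
  have fc: "free_class n t \<in> carrier ?Fr" if "tvars t \<subseteq> {..<n}" for t
    using that by (auto simp: free_hoop_carrier)
  have tq: "teval ?Q ?g t = ?G `` {free_class n t}" if "tvars t \<subseteq> {..<n}" for t
  proof -
    have "free_class n (Var i) \<in> carrier ?Fr" if "i \<in> tvars t" for i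
      using that \<open>tvars t \<subseteq> _\<close> by (intro fc) auto
    then show ?thesis
      using teval_quotient[OF Fr.closed_ops con, of t "\<lambda>i. free_class n (Var i)"]
      by (simp add: teval_free_hoop that)
  qed
  have g: "?g i \<in> carrier ?Q" if "i < n" for i
    using that by (auto simp: quotient_carrier intro!: imageI fc)
  have iff: "teval ?Q ?g s = teval ?Q ?g t \<longleftrightarrow> (free_class n s, free_class n t) \<in> ?G"
    if "tvars s \<subseteq> {..<n}" "tvars t \<subseteq> {..<n}" for s t
    using that congruence_class_eq_iff[OF con] fc by (simp add: tq)
  have "presented n (sol n R) ?Q ?g"
    unfolding presented_def
  proof (intro conjI allI impI)
    show "wajsberg_hoop ?Q" ..
    show "?g i \<in> carrier ?Q" if "i < n" for i
      using that by (rule g)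
    have "teval ?Q ?g ` {t. tvars t \<subseteq> {..<n}} = (\<lambda>t. ?G `` {free_class n t}) ` {t. tvars t \<subseteq> {..<n}}"
      by (intro image_cong) (auto simp: tq)
    then show "carrier ?Q = teval ?Q ?g ` {t. tvars t \<subseteq> {..<n}}"
      by (simp add: quotient_carrier free_hoop_carrier image_image)
    fix s t assume s: "tvars s \<subseteq> {..<n}" and t: "tvars t \<subseteq> {..<n}"
    show "teval ?Q ?g s = teval ?Q ?g t \<longleftrightarrow> (\<forall>y \<in> sol n R. ev y s = ev y t)"
    proof
      assume "teval ?Q ?g s = teval ?Q ?g t"
      then have st: "(free_class n s, free_class n t) \<in> ?G"
        using iff s t by simp
      show "\<forall>y \<in> sol n R. ev y s = ev y t"
      proof
        fix y assume "y \<in> sol n R"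
        then have y: "y \<in> cube n" and yR: "\<And>p q. (p, q) \<in> R \<Longrightarrow> ev y p = ev y q"
          by (auto simp: sol_def)
        \<comment> \<open>A class is evaluated through an arbitrary member;
          \<open>free_congruence_sound\<close> makes the choice immaterial.\<close>
        define e where "e X = ev y (SOME r. r \<in> X)" for X
        have e: "e (free_class n r) = ev y r" if "tvars r \<subseteq> {..<n}" for r
        proof -
          have "r \<in> free_class n r"
            using that equiv_class_self[OF congruenceD(1)[OF free_congruence[of n]], of r]
            by (simp add: free_class_def term_hoop_def)
          then have "(SOME q. q \<in> free_class n r) \<in> free_class n r"
            by (rule someI)
          then show ?thesis
            using free_congruence_sound[OF y, of r "SOME q. q \<in> free_class n r"]
            by (simp add: e_def free_class_def)
        qed
        let ?K = "{(X, Y). X \<in> carrier ?Fr \<and> Y \<in> carrier ?Fr \<and> e X = e Y}"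
        have ops: "free_class n p \<otimes>\<^bsub>?Fr\<^esub> free_class n q = free_class n (Mult p q)"
          "free_class n p \<rightharpoonup>\<^bsub>?Fr\<^esub> free_class n q = free_class n (Imp p q)"
          "free_class n p \<curlywedge>\<^bsub>?Fr\<^esub> free_class n q = free_class n (Meet p q)"
          "free_class n p \<curlyvee>\<^bsub>?Fr\<^esub> free_class n q = free_class n (Join p q)"
          if "tvars p \<subseteq> {..<n}" "tvars q \<subseteq> {..<n}" for p q
          using that quotient_ops[OF free_congruence[of n], of p q]
          by (simp_all add: free_hoop_eq free_class_def) (simp_all add: term_hoop_def)
        have "congruence ?Fr ?K"
          by (intro kernel_congruence[OF Fr.closed_ops, where B = standard_mv])
            (auto simp: free_hoop_carrier ops e)
        moreover have "R' \<subseteq> ?K"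
          using R' R(2) yR by (auto simp: R'_def e)
        ultimately have "?G \<subseteq> ?K"
          unfolding generated_congruence_def by blast
        then show "ev y s = ev y t"
          using st e s t by auto
      qed
    next
      assume valid: "\<forall>y \<in> sol n R. ev y s = ev y t"
      have "teval ?Q ?g p = teval ?Q ?g q" if "(p, q) \<in> R" for p q
      proof -
        have "(free_class n p, free_class n q) \<in> R'"
          using that by (force simp: R'_def)
        moreover have "R' \<subseteq> ?G"
          unfolding generated_congruence_def by blast
        ultimately show ?thesis
          using iff R(2)[OF that] by blast
      qed
      then show "teval ?Q ?g s = teval ?Q ?g t"
        using valid R s t g by (intro Q.completeness[of n ?g R]) (auto simp: sol_def)
    qed
  qed
  then show ?thesis
    by blast
qed

text \<open>The image of an element is read off from any term that represents it;
  \<open>resp\<close> says that all such terms give the same value in \<open>B\<close>.\<close>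

lemma presented_hom:
  assumes A: "presented n P A g" and B: "wajsberg_hoop B" "\<And>i. i < n \<Longrightarrow> h i \<in> carrier B"
    and resp: "\<And>s t. \<lbrakk>tvars s \<subseteq> {..<n}; tvars t \<subseteq> {..<n}; \<forall>y \<in> P. ev y s = ev y t\<rbrakk>
      \<Longrightarrow> teval B h s = teval B h t"
  obtains f where "f \<in> hoop_hom A B" "\<And>t. tvars t \<subseteq> {..<n} \<Longrightarrow> f (teval A g t) = teval B h t"
proof -
  interpret A: wajsberg_hoop A
    by (rule presentedD(1)[OF A])
  interpret B: wajsberg_hoop B
    by (rule B)
  note carr = presentedD(3)[OF A]
  have iff: "teval A g s = teval A g t \<longleftrightarrow> (\<forall>y \<in> P. ev y s = ev y t)"
    if "tvars s \<subseteq> {..<n}" "tvars t \<subseteq> {..<n}" for s t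
    using presentedD(4)[OF A that] .
  have hB: "teval B h t \<in> carrier B" if "tvars t \<subseteq> {..<n}" for t
    using that B(2) by (intro teval_closed[OF B.closed_ops]) blast
  define f where "f = (\<lambda>x \<in> carrier A. teval B h (SOME t. tvars t \<subseteq> {..<n} \<and> teval A g t = x))"
  have f: "f (teval A g t) = teval B h t" if t: "tvars t \<subseteq> {..<n}" for t
  proof -
    let ?s = "SOME s. tvars s \<subseteq> {..<n} \<and> teval A g s = teval A g t"
    have s: "tvars ?s \<subseteq> {..<n} \<and> teval A g ?s = teval A g t"
      by (rule someI[of _ t]) (use t in simp)
    then have "teval B h ?s = teval B h t"
      using resp[of ?s t] iff[of ?s t] t by blast
    then show ?thesis
      using t by (simp add: f_def carr)
  qed
  have "f \<in> hoop_hom A B"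
  proof (rule hoop_homI)
    show "f \<in> extensional (carrier A)"
      by (simp add: f_def)
    show "f \<one>\<^bsub>A\<^esub> = \<one>\<^bsub>B\<^esub>"
      using f[of One] by simp
    show "f x \<in> carrier B" if "x \<in> carrier A" for x
      using that f hB by (auto simp: carr)
    fix x y assume "x \<in> carrier A" "y \<in> carrier A"
    then obtain s t where s: "tvars s \<subseteq> {..<n}" "x = teval A g s" and t: "tvars t \<subseteq> {..<n}" "y = teval A g t"
      unfolding carr by blast
    show "f (x \<otimes>\<^bsub>A\<^esub> y) = f x \<otimes>\<^bsub>B\<^esub> f y" "f (x \<rightharpoonup>\<^bsub>A\<^esub> y) = f x \<rightharpoonup>\<^bsub>B\<^esub> f y"
      "f (x \<curlywedge>\<^bsub>A\<^esub> y) = f x \<curlywedge>\<^bsub>B\<^esub> f y" "f (x \<curlyvee>\<^bsub>A\<^esub> y) = f x \<curlyvee>\<^bsub>B\<^esub> f y"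
      using f[of s] f[of t] f[of "Mult s t"] f[of "Imp s t"] f[of "Meet s t"] f[of "Join s t"] s t
      by simp_all
  qed
  then show ?thesis
    using that f by blast
qed

text \<open>In both hoops the same equations hold between corresponding generators, namely those
  valid on \<open>P\<close>.\<close>

lemma presented_isomorphic:
  assumes A: "presented n P A g" and B: "presented n P B h"
  shows "hoop_isomorphic A B"
proof -
  have iff: "teval A g s = teval A g t \<longleftrightarrow> teval B h s = teval B h t"
    if "tvars s \<subseteq> {..<n}" "tvars t \<subseteq> {..<n}" for s t
    by (simp only: presentedD(4)[OF A that] presentedD(4)[OF B that])
  have resp: "teval B h s = teval B h t"
    if "tvars s \<subseteq> {..<n}" "tvars t \<subseteq> {..<n}" "\<forall>y \<in> P. ev y s = ev y t" for s t
    using presentedD(4)[OF B that(1,2)] that(3) by blast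
  obtain f where f: "f \<in> hoop_hom A B" "\<And>t. tvars t \<subseteq> {..<n} \<Longrightarrow> f (teval A g t) = teval B h t"
    using presented_hom[OF A presentedD(1,2)[OF B] resp] by blast
  note cA = presentedD(3)[OF A] and cB = presentedD(3)[OF B]
  have "bij_betw f (carrier A) (carrier B)"
    unfolding bij_betw_def
  proof
    show "inj_on f (carrier A)"
      using f(2) iff unfolding cA by (intro inj_onI) auto
    show "f ` carrier A = carrier B"
      unfolding cA cB image_image using f(2) by (intro image_cong) auto
  qed
  then show ?thesis
    using f(1) unfolding hoop_isomorphic_def by blast
qed

lemma presented_transfer:
  assumes A: "wajsberg_hoop A" and iso: "hoop_isomorphic A B" and B: "presented n P B h"
  shows "\<exists>g. presented n P A g"
proof -
  interpret A: wajsberg_hoop A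
    by (rule A)
  obtain f where f: "f \<in> hoop_hom A B" and bij: "bij_betw f (carrier A) (carrier B)"
    using iso unfolding hoop_isomorphic_def by blast
  note cB = presentedD(3)[OF B] and h = presentedD(2)[OF B]
  define g where "g i = inv_into (carrier A) f (h i)" for i
  have g: "g i \<in> carrier A" "f (g i) = h i" if "i < n" for i
    using bij_betw_imp_surj_on[OF bij] h[OF that]
    by (auto simp: g_def inv_into_into f_inv_into_f)
  have fg: "f (teval A g t) = teval B h t" if "tvars t \<subseteq> {..<n}" for t
  proof -
    have "f (teval A g t) = teval B (\<lambda>i. f (g i)) t"
      using that g by (intro hoop_hom_teval[OF f A.closed_ops]) blast
    also have "\<dots> = teval B h t"
      using that g by (intro teval_cong) blast
    finally show ?thesis .
  qed
  have cl: "teval A g t \<in> carrier A" if "tvars t \<subseteq> {..<n}" for t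
    using that g by (intro teval_closed[OF A.closed_ops]) blast
  have inj: "x = y" if "f x = f y" "x \<in> carrier A" "y \<in> carrier A" for x y
    using bij_betw_imp_inj_on[OF bij] that by (blast dest: inj_onD)
  have "carrier A \<subseteq> teval A g ` {t. tvars t \<subseteq> {..<n}}"
  proof
    fix x assume x: "x \<in> carrier A"
    then obtain t where t: "tvars t \<subseteq> {..<n}" "f x = teval B h t"
      using hoop_homD(3)[OF f x] unfolding cB by blast
    then have "x = teval A g t"
      using x fg cl inj by metis
    then show "x \<in> teval A g ` {t. tvars t \<subseteq> {..<n}}"
      using t by blast
  qed
  then have "carrier A = teval A g ` {t. tvars t \<subseteq> {..<n}}"
    using cl by blast
  moreover have iff: "teval A g s = teval A g t \<longleftrightarrow> (\<forall>y \<in> P. ev y s = ev y t)"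
    if st: "tvars s \<subseteq> {..<n}" "tvars t \<subseteq> {..<n}" for s t
  proof -
    have "teval A g s = teval A g t \<longleftrightarrow> f (teval A g s) = f (teval A g t)"
      using inj[OF _ cl[OF st(1)] cl[OF st(2)]] by auto
    also have "\<dots> \<longleftrightarrow> teval B h s = teval B h t"
      using fg st by simp
    also have "\<dots> \<longleftrightarrow> (\<forall>y \<in> P. ev y s = ev y t)"
      by (rule presentedD(4)[OF B st])
    finally show ?thesis .
  qed
  ultimately have "presented n P A g"
    using A g(1) unfolding presented_def by blast
  then show ?thesis
    by blast
qed

text \<open>Trades the quotient of a free hoop for a subset of the cube. The finitely many related
  classes are lifted to equations between terms.\<close>

lemma finitely_presented_iff:
  assumes A: "wajsberg_hoop A"
  shows "finitely_presented A \<longleftrightarrow> (\<exists>n R g. finite R \<and>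
    (\<forall>(p, q) \<in> R. tvars p \<subseteq> {..<n} \<and> tvars q \<subseteq> {..<n}) \<and> presented n (sol n R) A g)"
proof
  assume "finitely_presented A"
  then obtain n R' where R': "finite R'" "R' \<subseteq> carrier (free_hoop n) \<times> carrier (free_hoop n)"
    and iso: "hoop_isomorphic A (quotient_hoop (free_hoop n) (generated_congruence (free_hoop n) R'))"
    unfolding finitely_presented_def by blast
  have "R' \<subseteq> map_prod (free_class n) (free_class n) ` ({t. tvars t \<subseteq> {..<n}} \<times> {t. tvars t \<subseteq> {..<n}})"
    using R'(2) by (force simp: free_hoop_carrier)
  from finite_subset_image[OF R'(1) this] obtain R where R: "R \<subseteq> {t. tvars t \<subseteq> {..<n}} \<times> {t. tvars t \<subseteq> {..<n}}" "finite R"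
    "R' = map_prod (free_class n) (free_class n) ` R"
    by (elim bexE exE conjE) (rule that; assumption)
  have "\<exists>h. presented n (sol n R) (quotient_hoop (free_hoop n) (generated_congruence (free_hoop n) R')) h"
    unfolding R(3) using R(1,2) by (intro quotient_free_hoop_presented) auto
  then show "\<exists>n R g. finite R \<and>
    (\<forall>(p, q) \<in> R. tvars p \<subseteq> {..<n} \<and> tvars q \<subseteq> {..<n}) \<and> presented n (sol n R) A g"
  proof (elim exE)
    fix h assume "presented n (sol n R) (quotient_hoop (free_hoop n) (generated_congruence (free_hoop n) R')) h"
    from presented_transfer[OF A iso this] obtain g where "presented n (sol n R) A g"
      by (elim exE)
    moreover have "\<forall>(p, q) \<in> R. tvars p \<subseteq> {..<n} \<and> tvars q \<subseteq> {..<n}"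
      using R(1) by auto
    ultimately show "\<exists>n R g. finite R \<and>
      (\<forall>(p, q) \<in> R. tvars p \<subseteq> {..<n} \<and> tvars q \<subseteq> {..<n}) \<and> presented n (sol n R) A g"
      using R(2) by (intro exI conjI)
  qed
next
  assume "\<exists>n R g. finite R \<and>
    (\<forall>(p, q) \<in> R. tvars p \<subseteq> {..<n} \<and> tvars q \<subseteq> {..<n}) \<and> presented n (sol n R) A g"
  then obtain n R g where R: "finite R" "\<And>p q. (p, q) \<in> R \<Longrightarrow> tvars p \<subseteq> {..<n} \<and> tvars q \<subseteq> {..<n}"
    and g: "presented n (sol n R) A g"
    by (elim exE conjE) (rule that; fast)
  let ?R' = "map_prod (free_class n) (free_class n) ` R"
  have "\<exists>h. presented n (sol n R) (quotient_hoop (free_hoop n) (generated_congruence (free_hoop n) ?R')) h"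
    using R by (intro quotient_free_hoop_presented)
  then have "hoop_isomorphic A (quotient_hoop (free_hoop n) (generated_congruence (free_hoop n) ?R'))"
    by (elim exE) (rule presented_isomorphic[OF g])
  moreover have "?R' \<subseteq> carrier (free_hoop n) \<times> carrier (free_hoop n)"
    using R(2) by (force simp: free_hoop_carrier)
  ultimately show "finitely_presented A"
    using R(1) unfolding finitely_presented_def by (intro exI[of _ n] exI[of _ ?R'] conjI finite_imageI)
qed

section \<open>Rational polyhedra\<close>

definition aff :: "nat \<Rightarrow> (nat \<Rightarrow> int) \<times> int \<Rightarrow> point \<Rightarrow> real" where
  "aff n ab x = (\<Sum>i<n. of_int (fst ab i) * x i) + of_int (snd ab)"

definition halfspaces :: "nat \<Rightarrow> ((nat \<Rightarrow> int) \<times> int) set \<Rightarrow> point set" where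
  "halfspaces n H = {x \<in> cube n. \<forall>ab \<in> H. 0 \<le> aff n ab x}"

definition hpoly :: "nat \<Rightarrow> point set \<Rightarrow> bool" where
  "hpoly n P \<longleftrightarrow> (\<exists>\<H>. finite \<H> \<and> (\<forall>H \<in> \<H>. finite H) \<and> P = (\<Union>H \<in> \<H>. halfspaces n H))"

lemma aff_convex:
  assumes "(\<Sum>j \<in> J. w j) = 1"
  shows "aff n ab (\<lambda>i. \<Sum>j \<in> J. w j * p j i) = (\<Sum>j \<in> J. w j * aff n ab (p j))"
proof -
  have "(\<Sum>i<n. of_int (fst ab i) * (\<Sum>j \<in> J. w j * p j i))
      = (\<Sum>j \<in> J. w j * (\<Sum>i<n. of_int (fst ab i) * p j i))"
    by (simp add: sum_distrib_left sum.swap[of _ "{..<n}" J] mult_ac)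
  moreover have "(\<Sum>j \<in> J. w j * of_int (snd ab)) = of_int (snd ab)"
    using assms by (simp flip: sum_distrib_right)
  ultimately show ?thesis
    by (simp add: aff_def distrib_left sum.distrib)
qed

text \<open>\<open>conv_hull\<close> gives one weight to each point, while combinations that arise
  in proofs may list a point several times; the weights are collected over the fibres of
  \<open>p\<close>.\<close>

lemma conv_hullI:
  assumes V: "finite V" and J: "finite J" "\<And>j. j \<in> J \<Longrightarrow> p j \<in> V" "\<And>j. j \<in> J \<Longrightarrow> 0 \<le> w j" "(\<Sum>j \<in> J. w j) = 1"
  shows "(\<lambda>i. \<Sum>j \<in> J. w j * p j i) \<in> conv_hull V"
proof -
  let ?w = "\<lambda>v. \<Sum>j | j \<in> J \<and> p j = v. w j"
  have "p ` J \<subseteq> V"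
    using J by auto
  note group = sum.group[OF J(1) V this]
  have "(\<Sum>v \<in> V. ?w v) = 1"
    using group[of w] J by simp
  moreover have "(\<Sum>v \<in> V. ?w v * v i) = (\<Sum>j \<in> J. w j * p j i)" for i
  proof -
    have "(\<Sum>v \<in> V. ?w v * v i) = (\<Sum>v \<in> V. \<Sum>j | j \<in> J \<and> p j = v. w j * p j i)"
      by (intro sum.cong) (auto simp: sum_distrib_right)
    then show ?thesis
      using group[of "\<lambda>j. w j * p j i"] by simp
  qed
  moreover have "0 \<le> ?w v" for v
    using J by (intro sum_nonneg) auto
  ultimately show ?thesis
    unfolding conv_hull_def by (intro CollectI exI[of _ ?w]) simp
qed

lemma conv_hull_two:
  assumes "finite V" "u \<in> V" "v \<in> V" "0 \<le> s" "0 \<le> t" "s + t = 1"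
  shows "(\<lambda>i. s * u i + t * v i) \<in> conv_hull V"
  using conv_hullI[of V "{True, False}" "\<lambda>b. if b then u else v" "\<lambda>b. if b then s else t"] assms
  by simp

lemma conv_hull_superset:
  assumes "finite V" "v \<in> V"
  shows "v \<in> conv_hull V"
  using conv_hull_two[OF assms(1,2,2), of 1 0] by simp

lemma conv_hull_subset:
  assumes V: "finite V" and V': "finite V'" "V' \<subseteq> conv_hull V"
  shows "conv_hull V' \<subseteq> conv_hull V"
proof
  fix x assume "x \<in> conv_hull V'"
  then obtain w where w: "\<And>p. p \<in> V' \<Longrightarrow> 0 \<le> w p" "(\<Sum>p \<in> V'. w p) = 1" "x = (\<lambda>i. \<Sum>p \<in> V'. w p * p i)"
    unfolding conv_hull_def by blast
  have "\<forall>p \<in> V'. \<exists>c. (\<forall>v \<in> V. 0 \<le> c v) \<and> (\<Sum>v \<in> V. c v) = 1 \<and> p = (\<lambda>i. \<Sum>v \<in> V. c v * v i)"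
    using V'(2) unfolding conv_hull_def by blast
  from bchoice[OF this] obtain c where
    c': "\<forall>p \<in> V'. (\<forall>v \<in> V. 0 \<le> c p v) \<and> (\<Sum>v \<in> V. c p v) = 1 \<and> p = (\<lambda>i. \<Sum>v \<in> V. c p v * v i)"
    by (elim exE)
  have c: "0 \<le> c p v" if "p \<in> V'" "v \<in> V" for p v
    using bspec[OF c' that(1)] that(2) by blast
  have c2: "(\<Sum>v \<in> V. c p v) = 1" "(\<Sum>v \<in> V. c p v * v i) = p i" if "p \<in> V'" for p i
  proof -
    have *: "(\<Sum>v \<in> V. c p v) = 1" "p = (\<lambda>i. \<Sum>v \<in> V. c p v * v i)"
      using bspec[OF c' that] by blast+
    show "(\<Sum>v \<in> V. c p v) = 1"
      by (rule *)
    show "(\<Sum>v \<in> V. c p v * v i) = p i"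
      by (rule fun_cong[OF *(2)[symmetric]])
  qed
  have "x = (\<lambda>i. \<Sum>p \<in> V'. w p * (\<Sum>v \<in> V. c p v * v i))"
    unfolding w(3)
    by (intro ext sum.cong refl) (simp add: c2)
  also have "\<dots> = (\<lambda>i. \<Sum>(p, v) \<in> V' \<times> V. (w p * c p v) * v i)"
    by (simp add: sum_distrib_left mult.assoc flip: sum.cartesian_product)
  also have "\<dots> = (\<lambda>i. \<Sum>j \<in> V' \<times> V. (\<lambda>(p, v). w p * c p v) j * snd j i)"
    by (simp add: case_prod_unfold)
  also have "\<dots> \<in> conv_hull V"
  proof (rule conv_hullI[OF V])
    show "finite (V' \<times> V)"
      using V V' by simp
    show "(\<Sum>j \<in> V' \<times> V. (\<lambda>(p, v). w p * c p v) j) = 1"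
      using w(2) c2(1) by (simp flip: sum.cartesian_product sum_distrib_left)
  qed (use w c in auto)
  finally show "x \<in> conv_hull V" .
qed

text \<open>A convex combination \<open>x\<close> with \<open>l(x) \<ge> 0\<close> is rewritten by cancelling the weight \<open>w\<^sub>v l(v)\<close> of each
  negative vertex against the positive ones, in proportion to \<open>w\<^sub>u l(u)\<close>; this uses only the
  points where the edges \<open>uv\<close> cross the hyperplane.\<close>

lemma conv_hull_cut:
  fixes n :: nat and ab :: "(nat \<Rightarrow> int) \<times> int"
  assumes V: "finite V"
  defines "l \<equiv> aff n ab"
  defines "c u v \<equiv> (\<lambda>i. (- l v / (l u - l v)) * u i + (l u / (l u - l v)) * v i)"
  defines "V' \<equiv> {v \<in> V. 0 \<le> l v} \<union> case_prod c ` ({v \<in> V. 0 \<le> l v} \<times> {v \<in> V. l v < 0})"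
  shows "conv_hull V \<inter> {x. 0 \<le> l x} = conv_hull V'"
proof -
  let ?P = "{v \<in> V. 0 \<le> l v}" and ?N = "{v \<in> V. l v < 0}"
  have fin: "finite ?P" "finite ?N" "finite V'"
    using V by (auto simp: V'_def)
  have c_conv: "c u v \<in> conv_hull V" "l (c u v) = 0" if "u \<in> ?P" "v \<in> ?N" for u v
  proof -
    have pos: "0 < l u - l v"
      using that by auto
    have s: "0 \<le> - l v / (l u - l v)" "0 \<le> l u / (l u - l v)"
      using that pos by (simp_all add: divide_nonneg_pos divide_nonpos_pos)
    have one: "- l v / (l u - l v) + l u / (l u - l v) = 1"
      using pos by (simp flip: diff_divide_distrib)
    show "c u v \<in> conv_hull V"
      unfolding c_def using that by (intro conv_hull_two[OF V _ _ s one]) auto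
    have "l (c u v) = - l v / (l u - l v) * l u + l u / (l u - l v) * l v"
      unfolding c_def l_def
      using aff_convex[of "\<lambda>b. if b then - l v / (l u - l v) else l u / (l u - l v)" "{True, False}" n ab
        "\<lambda>b. if b then u else v"] one by (simp add: l_def)
    then show "l (c u v) = 0"
      by simp
  qed
  have V'_nonneg: "0 \<le> l v" if "v \<in> V'" for v
    using that c_conv(2) by (auto simp: V'_def)
  have V'_sub: "V' \<subseteq> conv_hull V"
    using conv_hull_superset[OF V] c_conv(1) by (auto simp: V'_def)
  show ?thesis
  proof (intro equalityI subsetI)
    fix x assume x: "x \<in> conv_hull V'"
    then obtain w where "\<And>v. v \<in> V' \<Longrightarrow> 0 \<le> w v" "(\<Sum>v \<in> V'. w v) = 1" "x = (\<lambda>i. \<Sum>v \<in> V'. w v * v i)"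
      unfolding conv_hull_def by blast
    then have "0 \<le> l x"
      using V'_nonneg unfolding l_def by (simp add: aff_convex sum_nonneg)
    then show "x \<in> conv_hull V \<inter> {x. 0 \<le> l x}"
      using x conv_hull_subset[OF V fin(3) V'_sub] by blast
  next
    fix x assume "x \<in> conv_hull V \<inter> {x. 0 \<le> l x}"
    then obtain w where w: "\<And>v. v \<in> V \<Longrightarrow> 0 \<le> w v" "(\<Sum>v \<in> V. w v) = 1" "x = (\<lambda>i. \<Sum>v \<in> V. w v * v i)"
      and lx: "0 \<le> l x"
      unfolding conv_hull_def by blast
    define p where "p = (\<Sum>v \<in> ?P. w v * l v)"
    define q where "q = (\<Sum>v \<in> ?N. w v * - l v)"
    have split: "(\<Sum>v \<in> V. f v) = (\<Sum>v \<in> ?P. f v) + (\<Sum>v \<in> ?N. f v)" for f :: "point \<Rightarrow> real"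
    proof -
      have "V = ?P \<union> ?N" "?P \<inter> ?N = {}"
        by auto
      then show ?thesis
        using sum.union_disjoint[OF fin(1,2), of f] by simp
    qed
    have "l x = p - q"
    proof -
      have "l x = (\<Sum>v \<in> V. w v * l v)"
        unfolding w(3) l_def by (rule aff_convex[OF w(2)])
      then show ?thesis
        by (simp only: split p_def q_def) (simp add: sum_negf)
    qed
    then have qp: "q \<le> p"
      using lx by simp
    have q0: "0 \<le> q"
      unfolding q_def using w(1) by (intro sum_nonneg mult_nonneg_nonneg) auto
    \<comment> \<open>The proportion in which positive vertices are used up. If
      \<open>p = 0\<close>, then \<open>q \<le> p\<close> forces \<open>q = 0\<close>, and division
      by zero returns the right value 0.\<close>
    define r where "r = q / p"
    have r: "0 \<le> r" "r \<le> 1" "r * p = q"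
      using q0 qp by (auto simp: r_def divide_le_eq_1)
    have zero: "w v = 0" if "p = 0" "v \<in> ?N" for v
    proof -
      have "q = 0"
        using that q0 qp by simp
      moreover have "w v * - l v \<le> q"
        unfolding q_def using that fin w(1) by (intro member_le_sum) (auto simp: mult_nonneg_nonpos)
      moreover have "0 \<le> w v * - l v"
        using that w(1) by (intro mult_nonneg_nonneg) auto
      ultimately show ?thesis
        using that by auto
    qed
    \<comment> \<open>A pair splits as \<open>w u * w v * (- l v) / p\<close> at \<open>u\<close>
      and \<open>w u * w v * l u / p\<close> at \<open>v\<close>. Summed over \<open>v\<close> the
      first part is \<open>r * w u\<close>, which restores the weight of \<open>u\<close>; summed
      over \<open>u\<close> the second is \<open>w v\<close>.\<close>
    define W where "W j = (case j of Inl u \<Rightarrow> (1 - r) * w u | Inr (u, v) \<Rightarrow> w u * w v * (l u - l v) / p)" for j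
    define K where "K j = (case j of Inl u \<Rightarrow> u | Inr (u, v) \<Rightarrow> c u v)" for j
    let ?J = "?P <+> (?P \<times> ?N)"
    have W0: "0 \<le> W j" if "j \<in> ?J" for j
      using that w(1) r q0 qp by (auto simp: W_def intro!: divide_nonneg_nonneg mult_nonneg_nonneg)
    \<comment> \<open>Taken for arbitrary \<open>f\<close> and \<open>g\<close> because it serves
      twice: with coordinates it recovers the point, with the constant 1 the total weight.\<close>
    have pair: "(\<Sum>(u, v) \<in> ?P \<times> ?N. w u * w v * (- l v * f u + l u * g v) / p)
        = r * (\<Sum>u \<in> ?P. w u * f u) + (\<Sum>v \<in> ?N. w v * g v)" for f g :: "point \<Rightarrow> real"
    proof -
      have "(\<Sum>(u, v) \<in> ?P \<times> ?N. w u * w v * (- l v * f u + l u * g v) / p)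
        = (\<Sum>u \<in> ?P. \<Sum>v \<in> ?N. (w u * f u) * (w v * - l v) + (w u * l u) * (w v * g v)) / p"
        by (simp add: sum.cartesian_product[symmetric] sum_divide_distrib[symmetric] algebra_simps)
      also have "\<dots> = ((\<Sum>u \<in> ?P. w u * f u) * q + p * (\<Sum>v \<in> ?N. w v * g v)) / p"
        unfolding p_def q_def sum_product by (simp only: sum.distrib)
      also have "\<dots> = r * (\<Sum>u \<in> ?P. w u * f u) + (\<Sum>v \<in> ?N. w v * g v)"
        using zero by (cases "p = 0") (auto simp: r_def add_divide_distrib)
      finally show ?thesis .
    qed
    have Kw: "(\<Sum>j \<in> ?J. W j * K j i) = x i" for i
    proof -
      have "(\<Sum>j \<in> ?J. W j * K j i) = (1 - r) * (\<Sum>u \<in> ?P. w u * u i) + (\<Sum>(u, v) \<in> ?P \<times> ?N. w u * w v * (l u - l v) / p * c u v i)"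
        using fin by (simp add: sum.Plus W_def K_def sum_distrib_left mult.assoc case_prod_unfold)
      also have "(\<Sum>(u, v) \<in> ?P \<times> ?N. w u * w v * (l u - l v) / p * c u v i)
          = (\<Sum>(u, v) \<in> ?P \<times> ?N. w u * w v * (- l v * u i + l u * v i) / p)"
      proof (rule sum.cong[OF refl])
        fix j assume "j \<in> ?P \<times> ?N"
        then obtain u v where j: "j = (u, v)" and ne: "l u - l v \<noteq> 0"
          by auto
        have "c u v i = (- l v * u i + l u * v i) / (l u - l v)"
          by (simp add: c_def diff_divide_distrib)
        then have "(l u - l v) * c u v i = - l v * u i + l u * v i"
          using ne by simp
        then have "w u * w v * ((l u - l v) * c u v i) / p = w u * w v * (- l v * u i + l u * v i) / p"
          by (rule arg_cong)
        then show "(case j of (u, v) \<Rightarrow> w u * w v * (l u - l v) / p * c u v i)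
            = (case j of (u, v) \<Rightarrow> w u * w v * (- l v * u i + l u * v i) / p)"
          by (simp add: j)
      qed
      also have "(1 - r) * (\<Sum>u \<in> ?P. w u * u i) + \<dots> = (\<Sum>v \<in> V. w v * v i)"
        by (simp only: pair split) (simp add: algebra_simps)
      finally show ?thesis
        by (simp add: w(3))
    qed
    have "(\<Sum>j \<in> ?J. W j) = (1 - r) * (\<Sum>u \<in> ?P. w u) + (\<Sum>(u, v) \<in> ?P \<times> ?N. w u * w v * (- l v * 1 + l u * 1) / p)"
      using fin by (simp add: sum.Plus W_def sum_distrib_left case_prod_unfold algebra_simps)
    also have "\<dots> = (\<Sum>v \<in> V. w v)"
      by (simp only: pair split) (simp add: algebra_simps)
    finally have W1: "(\<Sum>j \<in> ?J. W j) = 1"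
      using w by simp
    have "K j \<in> V'" if "j \<in> ?J" for j
      using that by (auto simp: K_def V'_def)
    then have "(\<lambda>i. \<Sum>j \<in> ?J. W j * K j i) \<in> conv_hull V'"
      using fin by (intro conv_hullI[OF fin(3) _ _ W0 W1]) auto
    then show "x \<in> conv_hull V'"
      by (simp only: Kw)
  qed
qed

definition rational_points :: "nat \<Rightarrow> point set \<Rightarrow> bool" where
  "rational_points n V \<longleftrightarrow> finite V \<and> (\<forall>v \<in> V. v \<in> space n \<and> (\<forall>i. v i \<in> \<rat>))"

lemma conv_hull_space:
  assumes "V \<subseteq> space n" "x \<in> conv_hull V"
  shows "x \<in> space n"
proof -
  obtain w where "x = (\<lambda>i. \<Sum>v \<in> V. w v * v i)"
    using assms(2) unfolding conv_hull_def by blast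
  then show ?thesis
    using assms(1) by (auto simp: space_def subset_eq intro!: sum.neutral)
qed

lemma Rats_aff:
  assumes "\<And>i. v i \<in> \<rat>"
  shows "aff n ab v \<in> \<rat>"
  unfolding aff_def using assms by (intro Rats_add Rats_sum Rats_mult) auto

text \<open>Iterates \<open>conv_hull_cut\<close>; the crossing points stay rational because integer
  affine forms take rational values at rational points.\<close>

lemma conv_hull_inter_halfspaces:
  assumes "finite H" "rational_points n V"
  shows "\<exists>V'. rational_points n V' \<and> conv_hull V \<inter> {x. \<forall>ab \<in> H. 0 \<le> aff n ab x} = conv_hull V'"
  using assms(1)
proof (induction H rule: finite_induct)
  case empty
  then show ?case
    using assms(2) by auto
next
  case (insert ab H)
  then obtain V1 where V1: "rational_points n V1"
    "conv_hull V \<inter> {x. \<forall>ab \<in> H. 0 \<le> aff n ab x} = conv_hull V1"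
    by blast
  let ?l = "aff n ab"
  let ?c = "\<lambda>u v i. (- ?l v / (?l u - ?l v)) * u i + (?l u / (?l u - ?l v)) * v i"
  let ?V2 = "{v \<in> V1. 0 \<le> ?l v} \<union> case_prod ?c ` ({v \<in> V1. 0 \<le> ?l v} \<times> {v \<in> V1. ?l v < 0})"
  have fin: "finite V1"
    using V1 by (simp add: rational_points_def)
  have pt: "?c u v \<in> space n \<and> (\<forall>i. ?c u v i \<in> \<rat>)" if "u \<in> V1" "v \<in> V1" for u v
  proof -
    have u: "u \<in> space n" "\<And>i. u i \<in> \<rat>" and v: "v \<in> space n" "\<And>i. v i \<in> \<rat>"
      using V1(1) that by (auto simp: rational_points_def)
    have "?l u \<in> \<rat>" "?l v \<in> \<rat>"
      using u v by (auto intro: Rats_aff)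
    then have "- ?l v / (?l u - ?l v) \<in> \<rat>" "?l u / (?l u - ?l v) \<in> \<rat>"
      by auto
    then have "?c u v i \<in> \<rat>" for i
      using u(2) v(2) by (intro Rats_add Rats_mult) auto
    then show ?thesis
      using u(1) v(1) by (simp add: space_def)
  qed
  have "rational_points n ?V2"
    unfolding rational_points_def
  proof (intro conjI ballI)
    show "finite ?V2"
      using fin by simp
    fix v assume "v \<in> ?V2"
    then have "v \<in> V1 \<or> (\<exists>a b. a \<in> V1 \<and> b \<in> V1 \<and> v = ?c a b)"
      by auto
    then have "v \<in> space n \<and> (\<forall>i. v i \<in> \<rat>)"
      using V1(1) pt unfolding rational_points_def by blast
    then show "v \<in> space n" "\<forall>i. v i \<in> \<rat>"
      by auto
  qed
  moreover have "conv_hull V \<inter> {x. \<forall>ab \<in> insert ab H. 0 \<le> aff n ab x} = conv_hull V1 \<inter> {x. 0 \<le> ?l x}"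
    using V1(2) by auto
  then have "conv_hull V \<inter> {x. \<forall>ab \<in> insert ab H. 0 \<le> aff n ab x} = conv_hull ?V2"
    unfolding conv_hull_cut[OF fin, of n ab] .
  ultimately show ?case
    by (intro exI[of _ ?V2] conjI)
qed

definition unit_vec :: "int \<Rightarrow> nat \<Rightarrow> nat \<Rightarrow> int" where
  "unit_vec c k = (\<lambda>i. if i = k then c else 0)"

lemma aff_unit_vec:
  assumes "k < n"
  shows "aff n (unit_vec c k, b) x = of_int c * x k + of_int b"
proof -
  have "(\<Sum>i<n. of_int (unit_vec c k i) * x i) = (\<Sum>i<n. if i = k then of_int c * x i else 0)"
    by (intro sum.cong) (auto simp: unit_vec_def)
  then show ?thesis
    using assms by (simp add: aff_def)
qed

text \<open>Provides a start for successive cutting without listing the vertices of the cube. The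
  coordinates of a point of the cube add up to at most \<open>n\<close>, so after division by
  \<open>n + 1\<close> a nonnegative weight is left for the origin.\<close>

lemma cube_subset_simplex:
  assumes "x \<in> cube n"
  shows "x \<in> conv_hull (insert (\<lambda>i. 0) ((\<lambda>k i. if i = k then real (n + 1) else 0) ` {..<n}))"
proof -
  let ?e = "\<lambda>k i. if i = k then real (n + 1) else (0::real)"
  let ?J = "insert None (Some ` {..<n})"
  define p where "p j = (case j of None \<Rightarrow> \<lambda>i. 0 | Some k \<Rightarrow> ?e k)" for j :: "nat option"
  define w where "w j = (case j of None \<Rightarrow> 1 - (\<Sum>k<n. x k / real (n + 1)) | Some k \<Rightarrow> x k / real (n + 1))" for j
  have xk: "0 \<le> x k" "x k \<le> 1" if "k < n" for k
    using assms that by (auto simp: cube_def)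
  have "(\<Sum>k<n. x k / real (n + 1)) \<le> (\<Sum>k<n. 1 / real (n + 1))"
    using xk by (intro sum_mono divide_right_mono) auto
  also have "\<dots> \<le> 1"
    by simp
  finally have "0 \<le> w None"
    by (simp add: w_def)
  then have w: "0 \<le> w j" if "j \<in> ?J" for j
    using that xk by (auto simp: w_def)
  have sum_J: "(\<Sum>j \<in> ?J. f j) = f None + (\<Sum>k<n. f (Some k))" for f :: "nat option \<Rightarrow> real"
    by (subst sum.insert) (auto simp: sum.reindex)
  have w1: "(\<Sum>j \<in> ?J. w j) = 1"
    by (simp only: sum_J) (simp add: w_def)
  have wp: "(\<Sum>j \<in> ?J. w j * p j i) = x i" for i
  proof -
    have "(\<Sum>j \<in> ?J. w j * p j i) = (\<Sum>k<n. w (Some k) * p (Some k) i)"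
      unfolding sum_J by (simp add: p_def)
    also have "\<dots> = (\<Sum>k<n. if k = i then x k else 0)"
      by (intro sum.cong refl) (auto simp: w_def p_def)
    also have "\<dots> = x i"
      using assms by (auto simp: cube_def space_def)
    finally show ?thesis .
  qed
  have "p j \<in> insert (\<lambda>i. 0) (?e ` {..<n})" if "j \<in> ?J" for j
    using that by (auto simp: p_def)
  then have "(\<lambda>i. \<Sum>j \<in> ?J. w j * p j i) \<in> conv_hull (insert (\<lambda>i. 0) (?e ` {..<n}))"
    using w w1 by (intro conv_hullI) simp_all
  then show ?thesis
    by (simp only: wp)
qed

text \<open>The faces of the cube count as further inequalities, and all of them cut down the
  enclosing simplex.\<close>

lemma halfspaces_conv_hull:
  assumes "finite H"
  shows "\<exists>V. rational_points n V \<and> halfspaces n H = conv_hull V"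
proof -
  let ?V = "insert (\<lambda>i. 0) ((\<lambda>k i. if i = k then real (n + 1) else 0) ` {..<n})"
  let ?C = "(\<lambda>k. (unit_vec 1 k, 0)) ` {..<n} \<union> (\<lambda>k. (unit_vec (-1) k, 1)) ` {..<n}"
  have V: "rational_points n ?V"
    by (auto simp: rational_points_def space_def)
  then have sp: "?V \<subseteq> space n"
    unfolding rational_points_def by blast
  have cube: "x \<in> cube n \<longleftrightarrow> x \<in> space n \<and> (\<forall>ab \<in> ?C. 0 \<le> aff n ab x)" for x
    by (auto simp: cube_def aff_unit_vec ball_Un)
  have "halfspaces n H = conv_hull ?V \<inter> {x. \<forall>ab \<in> H \<union> ?C. 0 \<le> aff n ab x}" (is "?l = ?r")
  proof (intro equalityI subsetI)
    fix x assume "x \<in> ?l"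
    then show "x \<in> ?r"
      using cube_subset_simplex[of x n] cube[of x] by (simp add: halfspaces_def ball_Un)
  next
    fix x assume x: "x \<in> ?r"
    then have "x \<in> space n"
      using conv_hull_space[OF sp] by blast
    then show "x \<in> ?l"
      using x cube[of x] by (simp add: halfspaces_def ball_Un)
  qed
  moreover have "finite (H \<union> ?C)"
    using assms by simp
  ultimately show ?thesis
    using conv_hull_inter_halfspaces[OF _ V, of "H \<union> ?C"] by simp
qed

lemma hpoly_rational_polyhedron:
  assumes "hpoly n P"
  shows "rational_polyhedron n P"
proof -
  obtain \<H> where H: "finite \<H>" "\<And>H. H \<in> \<H> \<Longrightarrow> finite H" "P = (\<Union>H \<in> \<H>. halfspaces n H)"
    using assms unfolding hpoly_def by blast
  have "\<forall>H \<in> \<H>. \<exists>V. rational_points n V \<and> halfspaces n H = conv_hull V"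
    using H(2) halfspaces_conv_hull by blast
  from bchoice[OF this] obtain V where V: "\<forall>H \<in> \<H>. rational_points n (V H) \<and> halfspaces n H = conv_hull (V H)"
    by (elim exE)
  show ?thesis
    unfolding rational_polyhedron_def
  proof (intro exI[of _ "V ` \<H>"] conjI)
    show "P = (\<Union>V \<in> V ` \<H>. conv_hull V)"
      using V H(3) by simp
  qed (use H V in \<open>auto simp: rational_points_def\<close>)
qed

lemma hpoly_subset_cube: "hpoly n P \<Longrightarrow> P \<subseteq> cube n"
  by (auto simp: hpoly_def halfspaces_def)

text \<open>Homogenising with an extra coordinate \<open>n\<close> turns the convex hull into a finitely generated cone.\<close>

lemma conv_hull_halfspaces:
  assumes V: "rational_points n V"
  shows "\<exists>H. finite H \<and> conv_hull V \<inter> cube n = halfspaces n H"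
proof -
  have fin: "finite V" and sp: "\<And>v i. v \<in> V \<Longrightarrow> i \<ge> n \<Longrightarrow> v i = 0" and rat: "\<And>v i. v \<in> V \<Longrightarrow> v i \<in> \<rat>"
    using V by (auto simp: rational_points_def space_def)
  have "case_prod (\<lambda>v i. v i) u \<in> \<rat>" if "u \<in> V \<times> {..<n}" for u
    using rat that by auto
  then obtain d :: nat where d: "d > 0" and dint: "\<And>u. u \<in> V \<times> {..<n} \<Longrightarrow> of_nat d * case_prod (\<lambda>v i. v i) u \<in> \<int>"
    using common_denominator[of "V \<times> {..<n}" "case_prod (\<lambda>v i. v i)"] fin by auto
  \<comment> \<open>All vertices are scaled by the common denominator, so the homogenising
    coordinate is \<open>d\<close> instead of 1 and the weights change by the factor
    \<open>d\<close>.\<close>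
  define u where "u v i = (if i = n then int d else \<lfloor>real d * v i\<rfloor>)" for v :: point and i
  have u_real: "real_of_int (u v i) = real d * v i" if "v \<in> V" "i < n" for v i
    using dint[of "(v, i)"] that by (simp add: u_def of_int_floor)
  have u_n: "real_of_int (u v n) = real d" for v
    by (simp add: u_def)
  have inj: "inj_on u V"
  proof (rule inj_onI)
    fix v v' assume vv: "v \<in> V" "v' \<in> V" "u v = u v'"
    show "v = v'"
    proof
      fix i
      show "v i = v' i"
      proof (cases "i < n")
        case True
        have "real d * v i = real d * v' i"
          using u_real[OF vv(1) True] u_real[OF vv(2) True] unfolding vv(3) by linarith
        then show ?thesis
          using d by simp
      next
        case False
        then show ?thesis
          using sp[OF vv(1), of i] sp[OF vv(2), of i] by simp
      qed
    qed
  qed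
  obtain H :: "(nat \<Rightarrow> int) set" where H: "finite H"
    and eq: "\<And>x :: nat \<Rightarrow> real.
      (\<exists>w. (\<forall>a \<in> u ` V. 0 \<le> w a) \<and> (\<forall>i \<in> {..n}. x i = (\<Sum>a \<in> u ` V. w a * of_int (a i)))) \<longleftrightarrow>
      (\<forall>a \<in> H. 0 \<le> (\<Sum>i \<in> {..n}. of_int (a i) * x i))"
    using generated_cone_halfspaces[of "{..n}" "u ` V", where ?'f = real] fin by auto
  have "x \<in> conv_hull V \<longleftrightarrow> (\<forall>a \<in> H. 0 \<le> aff n (a, a n) x)" if x: "x \<in> cube n" for x
  proof -
    let ?x = "x(n := 1)"
    have x0: "x i = 0" if "i \<ge> n" for i
      using x that by (simp add: cube_def space_def)
    have "(\<Sum>i \<in> {..n}. of_int (a i) * ?x i) = aff n (a, a n) x" for a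
    proof -
      have "(\<Sum>i<n. of_int (a i) * ?x i) = (\<Sum>i<n. of_int (a i) * x i)"
        by (intro sum.cong) auto
      then show ?thesis
        by (simp add: aff_def flip: lessThan_Suc_atMost)
    qed
    then have 1: "(\<forall>a \<in> H. 0 \<le> aff n (a, a n) x) \<longleftrightarrow>
      (\<exists>w. (\<forall>a \<in> u ` V. 0 \<le> w a) \<and> (\<forall>i \<in> {..n}. ?x i = (\<Sum>a \<in> u ` V. w a * of_int (a i))))"
      using eq[of ?x] by simp
    also have "\<dots> \<longleftrightarrow> x \<in> conv_hull V"
    proof
      assume "\<exists>w. (\<forall>a \<in> u ` V. 0 \<le> w a) \<and> (\<forall>i \<in> {..n}. ?x i = (\<Sum>a \<in> u ` V. w a * of_int (a i)))"
      then obtain w where w: "\<And>v. v \<in> V \<Longrightarrow> 0 \<le> w (u v)"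
        "\<And>i. i \<le> n \<Longrightarrow> ?x i = (\<Sum>a \<in> u ` V. w a * of_int (a i))"
        by auto
      have w': "?x i = (\<Sum>v \<in> V. w (u v) * of_int (u v i))" if "i \<le> n" for i
        using w(2)[OF that] by (simp add: sum.reindex[OF inj])
      let ?w = "\<lambda>v. w (u v) * real d"
      have "(\<Sum>v \<in> V. ?w v) = 1"
        using w'[of n] by (simp add: u_n)
      moreover have "x i = (\<Sum>v \<in> V. ?w v * v i)" for i
      proof (cases "i < n")
        case True
        then have "x i = (\<Sum>v \<in> V. w (u v) * of_int (u v i))"
          using w'[of i] by simp
        also have "\<dots> = (\<Sum>v \<in> V. ?w v * v i)"
          using True by (intro sum.cong) (auto simp: u_real)
        finally show ?thesis .
      next
        case False
        then show ?thesis
          using x0[of i] sp[of _ i] by (simp add: sum.neutral)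
      qed
      ultimately show "x \<in> conv_hull V"
        using w(1) unfolding conv_hull_def by (intro CollectI exI[of _ ?w]) (auto simp: fun_eq_iff)
    next
      assume "x \<in> conv_hull V"
      then obtain w where w: "\<And>v. v \<in> V \<Longrightarrow> 0 \<le> w v" "(\<Sum>v \<in> V. w v) = 1" "x = (\<lambda>i. \<Sum>v \<in> V. w v * v i)"
        unfolding conv_hull_def by blast
      let ?w = "\<lambda>a. w (inv_into V u a) / real d"
      have inv: "inv_into V u (u v) = v" if "v \<in> V" for v
        using inj that by simp
      show "\<exists>w. (\<forall>a \<in> u ` V. 0 \<le> w a) \<and> (\<forall>i \<in> {..n}. ?x i = (\<Sum>a \<in> u ` V. w a * of_int (a i)))"
      proof (intro exI[of _ ?w] conjI ballI)
        show "0 \<le> ?w a" if "a \<in> u ` V" for a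
          using that w(1) inv by auto
        fix i assume i: "i \<in> {..n}"
        have "(\<Sum>a \<in> u ` V. ?w a * of_int (a i)) = (\<Sum>v \<in> V. w v / real d * of_int (u v i))"
          by (simp add: sum.reindex[OF inj] inv)
        also have "\<dots> = ?x i"
        proof (cases "i = n")
          case True
          then show ?thesis
            using d w(2) by (simp add: u_n)
        next
          case False
          then have "(\<Sum>v \<in> V. w v / real d * of_int (u v i)) = (\<Sum>v \<in> V. w v * v i)"
            using i d by (intro sum.cong) (auto simp: u_real)
          then show ?thesis
            using False w(3) by simp
        qed
        finally show "?x i = (\<Sum>a \<in> u ` V. ?w a * of_int (a i))"
          by simp
      qed
    qed
    finally show ?thesis
      by simp
  qed
  \<comment> \<open>The homogenising coordinate of a point is 1, which turns the coefficient
    \<open>a n\<close> into the constant term.\<close>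
  then have "conv_hull V \<inter> cube n = halfspaces n ((\<lambda>a. (a, a n)) ` H)"
    by (auto simp: halfspaces_def)
  then show ?thesis
    using H by blast
qed

lemma rational_polyhedron_hpoly:
  assumes "rational_polyhedron n P" "P \<subseteq> cube n"
  shows "hpoly n P"
proof -
  obtain \<V> where V: "finite \<V>" "\<forall>V \<in> \<V>. rational_points n V" "P = (\<Union>V \<in> \<V>. conv_hull V)"
    using assms(1) unfolding rational_polyhedron_def rational_points_def by (elim exE conjE)
  have "\<forall>V \<in> \<V>. \<exists>H. finite H \<and> conv_hull V \<inter> cube n = halfspaces n H"
    using V(2) by (intro ballI conv_hull_halfspaces) blast
  from bchoice[OF this] obtain H where H: "\<forall>V \<in> \<V>. finite (H V) \<and> conv_hull V \<inter> cube n = halfspaces n (H V)"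
    by (elim exE)
  have "conv_hull V = halfspaces n (H V)" if "V \<in> \<V>" for V
    using bspec[OF H that] that V(3) assms(2) by blast
  then have "P = (\<Union>H \<in> H ` \<V>. halfspaces n H)"
    using V(3) by simp
  then show ?thesis
    using V(1) H unfolding hpoly_def by blast
qed

text \<open>Each cell \<open>(H, ab)\<close> consists of a polytope and the affine function that agrees with \<open>f\<close> on it.\<close>

definition PL :: "nat \<Rightarrow> (point \<Rightarrow> real) \<Rightarrow> bool" where
  "PL n f \<longleftrightarrow> (\<exists>\<C> :: (((nat \<Rightarrow> int) \<times> int) set \<times> (nat \<Rightarrow> int) \<times> int) set. finite \<C> \<and>
     (\<forall>c \<in> \<C>. finite (fst c)) \<and> (\<forall>x \<in> cube n. \<exists>c \<in> \<C>. x \<in> halfspaces n (fst c)) \<and>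
     (\<forall>c \<in> \<C>. \<forall>x \<in> halfspaces n (fst c). f x = aff n (snd c) x))"

section \<open>Calculus of piecewise affine functions\<close>

definition aff_add :: "(nat \<Rightarrow> int) \<times> int \<Rightarrow> (nat \<Rightarrow> int) \<times> int \<Rightarrow> (nat \<Rightarrow> int) \<times> int" where
  "aff_add p q = (\<lambda>i. fst p i + fst q i, snd p + snd q)"

definition aff_neg :: "(nat \<Rightarrow> int) \<times> int \<Rightarrow> (nat \<Rightarrow> int) \<times> int" where
  "aff_neg p = (\<lambda>i. - fst p i, - snd p)"

lemma aff_add [simp]: "aff n (aff_add p q) x = aff n p x + aff n q x"
  by (simp add: aff_def aff_add_def distrib_right sum.distrib)

lemma aff_neg [simp]: "aff n (aff_neg p) x = - aff n p x"
  by (simp add: aff_def aff_neg_def sum_negf)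

lemma halfspaces_Un [simp]: "halfspaces n (H \<union> K) = halfspaces n H \<inter> halfspaces n K"
  by (auto simp: halfspaces_def)

lemma halfspaces_insert [simp]: "x \<in> halfspaces n (insert p H) \<longleftrightarrow> x \<in> halfspaces n H \<and> 0 \<le> aff n p x"
  by (auto simp: halfspaces_def)

lemma halfspaces_empty [simp]: "halfspaces n {} = cube n"
  by (simp add: halfspaces_def)

lemma PL_aff: "PL n (aff n ab)"
  unfolding PL_def by (intro exI[of _ "{({}, ab)}"]) (auto simp: halfspaces_def)

lemma PL_const: "PL n (\<lambda>x. of_int c)"
proof -
  have "aff n (\<lambda>i. 0, c) = (\<lambda>x. of_int c)"
    by (simp add: aff_def fun_eq_iff)
  then show ?thesis
    using PL_aff[of n "(\<lambda>i. 0, c)"] by simp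
qed

lemma PL_proj: "i < n \<Longrightarrow> PL n (\<lambda>x. x i)"
proof -
  assume "i < n"
  then have "aff n (unit_vec 1 i, 0) = (\<lambda>x. x i)"
    by (simp add: aff_unit_vec fun_eq_iff)
  then show ?thesis
    using PL_aff[of n "(unit_vec 1 i, 0)"] by simp
qed

lemma PL_neg:
  assumes "PL n f"
  shows "PL n (\<lambda>x. - f x)"
proof -
  obtain \<C> where C: "finite \<C>" "\<And>c. c \<in> \<C> \<Longrightarrow> finite (fst c)"
    "\<And>x. x \<in> cube n \<Longrightarrow> \<exists>c \<in> \<C>. x \<in> halfspaces n (fst c)"
    "\<And>c x. c \<in> \<C> \<Longrightarrow> x \<in> halfspaces n (fst c) \<Longrightarrow> f x = aff n (snd c) x"
    using assms unfolding PL_def by blast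
  then show ?thesis
    unfolding PL_def by (intro exI[of _ "map_prod id aff_neg ` \<C>"]) simp
qed

lemma PL_add:
  assumes "PL n f" "PL n g"
  shows "PL n (\<lambda>x. f x + g x)"
proof -
  obtain \<C> where C: "finite \<C>" "\<And>c. c \<in> \<C> \<Longrightarrow> finite (fst c)"
    "\<And>x. x \<in> cube n \<Longrightarrow> \<exists>c \<in> \<C>. x \<in> halfspaces n (fst c)"
    "\<And>c x. c \<in> \<C> \<Longrightarrow> x \<in> halfspaces n (fst c) \<Longrightarrow> f x = aff n (snd c) x"
    using assms(1) unfolding PL_def by blast
  obtain \<D> where D: "finite \<D>" "\<And>c. c \<in> \<D> \<Longrightarrow> finite (fst c)"
    "\<And>x. x \<in> cube n \<Longrightarrow> \<exists>c \<in> \<D>. x \<in> halfspaces n (fst c)"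
    "\<And>c x. c \<in> \<D> \<Longrightarrow> x \<in> halfspaces n (fst c) \<Longrightarrow> g x = aff n (snd c) x"
    using assms(2) unfolding PL_def by blast
  let ?E = "(\<lambda>(c, d). (fst c \<union> fst d, aff_add (snd c) (snd d))) ` (\<C> \<times> \<D>)"
  show ?thesis
    unfolding PL_def
  proof (intro exI[of _ ?E] conjI ballI)
    fix x assume "x \<in> cube n"
    then obtain c d where "c \<in> \<C>" "x \<in> halfspaces n (fst c)" "d \<in> \<D>" "x \<in> halfspaces n (fst d)"
      using C(3) D(3) by meson
    then show "\<exists>e \<in> ?E. x \<in> halfspaces n (fst e)"
      by (intro bexI[of _ "(fst c \<union> fst d, aff_add (snd c) (snd d))"]) force+
  qed (use C D in auto)
qed

lemma PL_max:
  assumes "PL n f" "PL n g"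
  shows "PL n (\<lambda>x. max (f x) (g x))"
proof -
  obtain \<C> where C: "finite \<C>" "\<And>c. c \<in> \<C> \<Longrightarrow> finite (fst c)"
    "\<And>x. x \<in> cube n \<Longrightarrow> \<exists>c \<in> \<C>. x \<in> halfspaces n (fst c)"
    "\<And>c x. c \<in> \<C> \<Longrightarrow> x \<in> halfspaces n (fst c) \<Longrightarrow> f x = aff n (snd c) x"
    using assms(1) unfolding PL_def by blast
  obtain \<D> where D: "finite \<D>" "\<And>c. c \<in> \<D> \<Longrightarrow> finite (fst c)"
    "\<And>x. x \<in> cube n \<Longrightarrow> \<exists>c \<in> \<D>. x \<in> halfspaces n (fst c)"
    "\<And>c x. c \<in> \<D> \<Longrightarrow> x \<in> halfspaces n (fst c) \<Longrightarrow> g x = aff n (snd c) x"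
    using assms(2) unfolding PL_def by blast
  \<comment> \<open>Each cell of the common refinement is divided by the sign of the difference of
    the two affine forms.\<close>
  let ?l = "\<lambda>(c, d). (fst c \<union> fst d \<union> {aff_add (snd c) (aff_neg (snd d))}, snd c)"
  let ?r = "\<lambda>(c, d). (fst c \<union> fst d \<union> {aff_add (snd d) (aff_neg (snd c))}, snd d)"
  let ?E = "?l ` (\<C> \<times> \<D>) \<union> ?r ` (\<C> \<times> \<D>)"
  show ?thesis
    unfolding PL_def
  proof (intro exI[of _ ?E] conjI ballI)
    fix x assume x: "x \<in> cube n"
    then obtain c d where cd: "c \<in> \<C>" "x \<in> halfspaces n (fst c)" "d \<in> \<D>" "x \<in> halfspaces n (fst d)"
      using C(3) D(3) by meson
    then have E: "?l (c, d) \<in> ?E" "?r (c, d) \<in> ?E"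
      by blast+
    show "\<exists>e \<in> ?E. x \<in> halfspaces n (fst e)"
    proof (cases "aff n (snd c) x \<ge> aff n (snd d) x")
      case True
      then show ?thesis
        using cd x by (intro bexI[OF _ E(1)]) simp
    next
      case False
      then show ?thesis
        using cd x by (intro bexI[OF _ E(2)]) simp
    qed
  next
    fix e x assume "e \<in> ?E" "x \<in> halfspaces n (fst e)"
    then show "max (f x) (g x) = aff n (snd e) x"
      using C(4) D(4) by auto
  qed (use C D in auto)
qed

lemma PL_diff: "PL n f \<Longrightarrow> PL n g \<Longrightarrow> PL n (\<lambda>x. f x - g x)"
  using PL_add[OF _ PL_neg, of n f g] by simp

lemma PL_min: "PL n f \<Longrightarrow> PL n g \<Longrightarrow> PL n (\<lambda>x. min (f x) (g x))"
proof -
  assume "PL n f" "PL n g"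
  then have "PL n (\<lambda>x. - max (- f x) (- g x))"
    by (intro PL_neg PL_max)
  then show ?thesis
    by (simp flip: minus_min_eq_max)
qed

lemma PL_ev: "tvars t \<subseteq> {..<n} \<Longrightarrow> PL n (\<lambda>x. ev x t)"
proof (induction t)
  case (Var i)
  then show ?case
    by (simp add: PL_proj)
next
  case One
  show ?case
    using PL_const[of n 1] by simp
next
  case (Mult s t)
  then show ?case
    using PL_max[OF PL_const[of n 0] PL_diff[OF PL_add[of n "\<lambda>x. ev x s" "\<lambda>x. ev x t"] PL_const[of n 1]]]
    by simp
next
  case (Imp s t)
  then show ?case
    using PL_min[OF PL_const[of n 1] PL_add[OF PL_diff[OF PL_const[of n 1], of "\<lambda>x. ev x s"], of "\<lambda>x. ev x t"]]
    by simp
qed (simp_all add: PL_min PL_max)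

text \<open>On a cell the equation becomes two opposite affine inequalities, added to those that
  define the cell.\<close>

lemma hpoly_PL_zero:
  assumes "PL n f"
  shows "hpoly n {x \<in> cube n. f x = 0}"
proof -
  obtain \<C> where C: "finite \<C>" "\<And>c. c \<in> \<C> \<Longrightarrow> finite (fst c)"
    "\<And>x. x \<in> cube n \<Longrightarrow> \<exists>c \<in> \<C>. x \<in> halfspaces n (fst c)"
    "\<And>c x. c \<in> \<C> \<Longrightarrow> x \<in> halfspaces n (fst c) \<Longrightarrow> f x = aff n (snd c) x"
    using assms unfolding PL_def by blast
  let ?h = "\<lambda>c. fst c \<union> {snd c, aff_neg (snd c)}"
  have h: "x \<in> halfspaces n (?h c) \<longleftrightarrow> x \<in> halfspaces n (fst c) \<and> f x = 0" if "c \<in> \<C>" for c x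
    using C(4)[OF that, of x] by auto
  have "{x \<in> cube n. f x = 0} = (\<Union>H \<in> ?h ` \<C>. halfspaces n H)"
  proof (intro equalityI subsetI)
    fix x assume "x \<in> {x \<in> cube n. f x = 0}"
    then obtain c where "c \<in> \<C>" "x \<in> halfspaces n (fst c)" "f x = 0"
      using C(3) by blast
    then show "x \<in> (\<Union>H \<in> ?h ` \<C>. halfspaces n H)"
      using h by blast
  next
    fix x assume "x \<in> (\<Union>H \<in> ?h ` \<C>. halfspaces n H)"
    then obtain c where "c \<in> \<C>" "x \<in> halfspaces n (?h c)"
      by blast
    then show "x \<in> {x \<in> cube n. f x = 0}"
      using h[of c x] by (auto simp: halfspaces_def)
  qed
  moreover have "finite (?h ` \<C>)" "\<forall>H \<in> ?h ` \<C>. finite H"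
    using C by auto
  ultimately show ?thesis
    unfolding hpoly_def by blast
qed

lemma PL_sum:
  assumes "finite S" "\<And>s. s \<in> S \<Longrightarrow> PL n (f s)"
  shows "PL n (\<lambda>x. \<Sum>s \<in> S. f s x)"
  using assms
proof (induction S rule: finite_induct)
  case empty
  then show ?case
    using PL_const[of n 0] by simp
next
  case (insert s S)
  then show ?case
    using PL_add[of n "f s" "\<lambda>x. \<Sum>s \<in> S. f s x"] by simp
qed

text \<open>Summing absolute differences turns a finite system of equations into the zero set of one
  piecewise affine function.\<close>

lemma hpoly_sol:
  assumes R: "finite R" "\<And>p q. (p, q) \<in> R \<Longrightarrow> tvars p \<subseteq> {..<n} \<and> tvars q \<subseteq> {..<n}"
  shows "hpoly n (sol n R)"
proof -
  let ?f = "\<lambda>pq x. max (ev x (fst pq) - ev x (snd pq)) (- (ev x (fst pq) - ev x (snd pq)))"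
  have "PL n (\<lambda>x. \<Sum>pq \<in> R. ?f pq x)"
    using R(2) by (intro PL_sum[OF R(1)] PL_max PL_neg PL_diff PL_ev) (metis prod.collapse)+
  moreover have "(\<Sum>pq \<in> R. ?f pq x) = 0 \<longleftrightarrow> (\<forall>(p, q) \<in> R. ev x p = ev x q)" for x
    using R(1) by (subst sum_nonneg_eq_0_iff) (auto simp: max_def)
  then have "sol n R = {x \<in> cube n. (\<Sum>pq \<in> R. ?f pq x) = 0}"
    by (simp add: sol_def)
  ultimately show ?thesis
    using hpoly_PL_zero[of n "\<lambda>x. \<Sum>pq \<in> R. ?f pq x"] by simp
qed

text \<open>The source of pointedness: every equation between 0-free terms holds at this
  point.\<close>

lemma ev_ones: "tvars t \<subseteq> {..<n} \<Longrightarrow> ev (ones n) t = 1"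
  by (induction t) (auto simp: ones_def)

lemma ones_cube: "ones n \<in> cube n"
  by (simp add: ones_def cube_def space_def)

lemma sol_pointed:
  assumes "finite R" "\<And>p q. (p, q) \<in> R \<Longrightarrow> tvars p \<subseteq> {..<n} \<and> tvars q \<subseteq> {..<n}"
  shows "pointed_rational_polyhedron n (sol n R)"
proof -
  have "ones n \<in> sol n R"
    using assms(2) ones_cube by (fastforce simp: sol_def ev_ones)
  then show ?thesis
    using hpoly_sol[OF assms] hpoly_rational_polyhedron hpoly_subset_cube
    unfolding pointed_rational_polyhedron_def by blast
qed

section \<open>Positive functions and McNaughton functions\<close>

text \<open>Stands in for MV-terms: adjoining negations to the 0-free terms already gives closure
  under all MV-operations, with 0 as the negation of \<open>One\<close>.\<close>

definition PN :: "nat \<Rightarrow> (point \<Rightarrow> real) \<Rightarrow> bool" where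
  "PN n f \<longleftrightarrow> (\<exists>t. tvars t \<subseteq> {..<n} \<and>
     ((\<forall>x \<in> cube n. f x = ev x t) \<or> (\<forall>x \<in> cube n. f x = 1 - ev x t)))"

lemma PN_cong: "\<lbrakk>PN n f; \<And>x. x \<in> cube n \<Longrightarrow> f x = g x\<rbrakk> \<Longrightarrow> PN n g"
  unfolding PN_def by (elim exE) auto

lemma PN_ev: "tvars t \<subseteq> {..<n} \<Longrightarrow> PN n (\<lambda>x. ev x t)"
  unfolding PN_def by blast

lemma PN_neg:
  assumes "PN n f"
  shows "PN n (\<lambda>x. 1 - f x)"
proof -
  obtain t where "tvars t \<subseteq> {..<n}" "(\<forall>x \<in> cube n. f x = ev x t) \<or> (\<forall>x \<in> cube n. f x = 1 - ev x t)"
    using assms unfolding PN_def by blast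
  then show ?thesis
    unfolding PN_def by (intro exI[of _ t]) auto
qed

lemma PN_range:
  assumes "PN n f" "x \<in> cube n"
  shows "0 \<le> f x" "f x \<le> 1"
proof -
  obtain t where "tvars t \<subseteq> {..<n}" "f x = ev x t \<or> f x = 1 - ev x t"
    using assms unfolding PN_def by blast
  then show "0 \<le> f x" "f x \<le> 1"
    using ev_range[OF assms(2), of t] by auto
qed

text \<open>Closure under the MV-operations reduces to the identity \<open>p \<oplus> q = (p \<rightharpoonup> p \<otimes> q) \<rightharpoonup> q\<close>, in which
  no constant \<open>0\<close> occurs on the right.\<close>

lemma PN_imp:
  assumes "PN n f" "PN n g"
  shows "PN n (\<lambda>x. min 1 (1 - f x + g x))"
proof -
  obtain s where s: "tvars s \<subseteq> {..<n}" "(\<forall>x \<in> cube n. f x = ev x s) \<or> (\<forall>x \<in> cube n. f x = 1 - ev x s)"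
    using assms(1) unfolding PN_def by blast
  obtain t where t: "tvars t \<subseteq> {..<n}" "(\<forall>x \<in> cube n. g x = ev x t) \<or> (\<forall>x \<in> cube n. g x = 1 - ev x t)"
    using assms(2) unfolding PN_def by blast
  have range: "0 \<le> ev x s" "ev x s \<le> 1" "0 \<le> ev x t" "ev x t \<le> 1" if "x \<in> cube n" for x
    using ev_range[OF that s(1)] ev_range[OF that t(1)] by auto
  have pn: "PN n (\<lambda>x. ev x (Imp s t))" "PN n (\<lambda>x. 1 - ev x (Mult s t))"
    "PN n (\<lambda>x. ev x (Imp (Imp s (Mult s t)) t))" "PN n (\<lambda>x. ev x (Imp t s))"
    using s(1) t(1) by (auto intro!: PN_ev PN_neg simp del: teval.simps)
  have cases: "(\<forall>x \<in> cube n. min 1 (1 - f x + g x) = ev x (Imp s t)) \<or>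
    (\<forall>x \<in> cube n. min 1 (1 - f x + g x) = 1 - ev x (Mult s t)) \<or>
    (\<forall>x \<in> cube n. min 1 (1 - f x + g x) = ev x (Imp (Imp s (Mult s t)) t)) \<or>
    (\<forall>x \<in> cube n. min 1 (1 - f x + g x) = ev x (Imp t s))"
    using s(2)
  proof
    assume f: "\<forall>x \<in> cube n. f x = ev x s"
    from t(2) show ?thesis
    proof
      assume "\<forall>x \<in> cube n. g x = ev x t"
      then have "\<forall>x \<in> cube n. min 1 (1 - f x + g x) = ev x (Imp s t)"
        using f by simp
      then show ?thesis
        by blast
    next
      assume "\<forall>x \<in> cube n. g x = 1 - ev x t"
      then have "\<forall>x \<in> cube n. min 1 (1 - f x + g x) = 1 - ev x (Mult s t)"
        using f by (auto simp: min_def max_def)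
      then show ?thesis
        by blast
    qed
  next
    assume f: "\<forall>x \<in> cube n. f x = 1 - ev x s"
    from t(2) show ?thesis
    proof
      assume g: "\<forall>x \<in> cube n. g x = ev x t"
      have "min 1 (1 - f x + g x) = ev x (Imp (Imp s (Mult s t)) t)" if "x \<in> cube n" for x
        using f g that range[OF that] by (auto simp: min_def max_def)
      then show ?thesis
        by blast
    next
      assume "\<forall>x \<in> cube n. g x = 1 - ev x t"
      then have "\<forall>x \<in> cube n. min 1 (1 - f x + g x) = ev x (Imp t s)"
        using f by (simp add: add.commute)
      then show ?thesis
        by blast
    qed
  qed
  have cong: "PN n h" if "\<forall>x \<in> cube n. h x = h' x" "PN n h'" for h h'
    using that(2) by (rule PN_cong) (use that(1) in simp)
  show ?thesis
    using cases by (elim disjE) (drule cong, rule pn, assumption)+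
qed

lemma PN_oplus:
  assumes "PN n f" "PN n g"
  shows "PN n (\<lambda>x. min 1 (f x + g x))"
  using PN_imp[OF PN_neg[OF assms(1)] assms(2)] by simp

lemma PN_mult:
  assumes "PN n f" "PN n g"
  shows "PN n (\<lambda>x. max 0 (f x + g x - 1))"
  by (rule PN_cong[OF PN_neg[OF PN_imp[OF assms(1) PN_neg[OF assms(2)]]]]) (auto simp: min_def max_def)

lemma PN_max:
  assumes "PN n f" "PN n g"
  shows "PN n (\<lambda>x. max (f x) (g x))"
proof (rule PN_cong[OF PN_imp[OF PN_imp[OF assms] assms(2)]])
  fix x assume "x \<in> cube n"
  then show "min 1 (1 - min 1 (1 - f x + g x) + g x) = max (f x) (g x)"
    using PN_range[OF assms(1), of x] PN_range[OF assms(2), of x] by (auto simp: min_def max_def)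
qed

lemma PN_min:
  assumes "PN n f" "PN n g"
  shows "PN n (\<lambda>x. min (f x) (g x))"
  by (rule PN_cong[OF PN_neg[OF PN_max[OF PN_neg[OF assms(1)] PN_neg[OF assms(2)]]]]) (auto simp: min_def max_def)

section \<open>Clipped affine functions and polyhedra as level sets\<close>

definition clip :: "real \<Rightarrow> real" where
  "clip r = max 0 (min 1 r)"

text \<open>The Rose--Rosser identity; it builds up clipped affine functions one unit of slope at a time.\<close>

lemma clip_add:
  assumes "0 \<le> x" "x \<le> 1"
  shows "clip (g + x) = max 0 (min 1 (clip g + x) + clip (g + 1) - 1)"
  using assms by (auto simp: clip_def min_def max_def)

lemma clip_neg: "clip (1 - r) = 1 - clip r"
  by (auto simp: clip_def min_def max_def)

text \<open>All translates are carried along because \<open>clip_add\<close> expresses a sum at one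
  shift by the clips at that shift and at the next.\<close>

definition PN_shifts :: "nat \<Rightarrow> (point \<Rightarrow> real) \<Rightarrow> bool" where
  "PN_shifts n g \<longleftrightarrow> (\<forall>b :: int. PN n (\<lambda>x. clip (g x + of_int b)))"

lemma PN_shifts_zero: "PN_shifts n (\<lambda>x. 0)"
  unfolding PN_shifts_def
proof
  fix b :: int
  have "PN n (\<lambda>x. 1)" "PN n (\<lambda>x. 0)"
    using PN_ev[of One n] PN_neg[OF PN_ev[of One n]] by simp_all
  moreover have "clip (0 + of_int b) = (if b \<le> 0 then 0 else 1)"
    by (auto simp: clip_def min_def max_def)
  ultimately show "PN n (\<lambda>x. clip (0 + of_int b))"
    by simp
qed

lemma PN_shifts_add:
  assumes g: "PN_shifts n g" and i: "i < n"
  shows "PN_shifts n (\<lambda>x. g x + x i)"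
  unfolding PN_shifts_def
proof
  fix b :: int
  have x: "PN n (\<lambda>x. x i)"
    using PN_ev[of "Var i" n] i by simp
  have "PN n (\<lambda>x. clip (g x + of_int b))" "PN n (\<lambda>x. clip (g x + of_int (b + 1)))"
    using g unfolding PN_shifts_def by blast+
  then have "PN n (\<lambda>x. max 0 (min 1 (clip (g x + of_int b) + x i) + clip (g x + of_int (b + 1)) - 1))"
    by (intro PN_mult PN_oplus x)
  then show "PN n (\<lambda>x. clip (g x + x i + of_int b))"
  proof (rule PN_cong)
    fix x assume "x \<in> cube n"
    then have "0 \<le> x i" "x i \<le> 1"
      using i by (auto simp: cube_def)
    then show "max 0 (min 1 (clip (g x + of_int b) + x i) + clip (g x + of_int (b + 1)) - 1) = clip (g x + x i + of_int b)"
      using clip_add[of "x i" "g x + of_int b"] by (simp add: algebra_simps)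
  qed
qed

text \<open>Negation reflects the unit interval about its midpoint, which pairs the shift
  \<open>b\<close> with \<open>1 - b\<close>.\<close>

lemma PN_shifts_neg:
  assumes "PN_shifts n g"
  shows "PN_shifts n (\<lambda>x. - g x)"
  unfolding PN_shifts_def
proof
  fix b :: int
  have "PN n (\<lambda>x. clip (g x + of_int (1 - b)))"
    using assms unfolding PN_shifts_def by blast
  then show "PN n (\<lambda>x. clip (- g x + of_int b))"
  proof (rule PN_cong[OF PN_neg])
    fix x
    show "1 - clip (g x + of_int (1 - b)) = clip (- g x + of_int b)"
      unfolding clip_neg[symmetric] by (simp add: algebra_simps)
  qed
qed

lemma PN_shifts_sub:
  assumes "PN_shifts n g" "i < n"
  shows "PN_shifts n (\<lambda>x. g x - x i)"
  using PN_shifts_neg[OF PN_shifts_add[OF PN_shifts_neg[OF assms(1)] assms(2)]] by simp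

lemma PN_shifts_mult:
  assumes g: "PN_shifts n g" and i: "i < n"
  shows "PN_shifts n (\<lambda>x. g x + of_int k * x i)"
proof (induction k rule: int_induct[where k = 0])
  case base
  then show ?case
    using g by simp
next
  case (step1 k)
  then show ?case
    using PN_shifts_add[OF step1(2) i] by (simp add: algebra_simps)
next
  case (step2 k)
  then show ?case
    using PN_shifts_sub[OF step2(2) i] by (simp add: algebra_simps)
qed

lemma PN_clip_aff: "PN n (\<lambda>x. clip (aff n ab x))"
proof -
  have "PN_shifts n (\<lambda>x. \<Sum>i<m. of_int (fst ab i) * x i)" if "m \<le> n" for m
    using that
  proof (induction m)
    case 0
    then show ?case
      using PN_shifts_zero by simp
  next
    case (Suc m)
    then show ?case
      using PN_shifts_mult[of n "\<lambda>x. \<Sum>i<m. of_int (fst ab i) * x i" m "fst ab m"] by simp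
  qed
  then show ?thesis
    unfolding PN_shifts_def aff_def by blast
qed

lemma PN_halfspaces:
  assumes "finite H"
  shows "\<exists>f. PN n f \<and> (\<forall>x \<in> cube n. f x = 1 \<longleftrightarrow> x \<in> halfspaces n H)"
  using assms
proof (induction H rule: finite_induct)
  case empty
  have "PN n (\<lambda>x. 1)"
    using PN_ev[of One n] by simp
  then show ?case
    by (intro exI[of _ "\<lambda>x. 1"]) simp
next
  case (insert ab H)
  then obtain f where f: "PN n f" "\<And>x. x \<in> cube n \<Longrightarrow> f x = 1 \<longleftrightarrow> x \<in> halfspaces n H"
    by blast
  \<comment> \<open>With 1 added, the clip reaches the value 1 exactly where \<open>ab\<close> is
    nonnegative.\<close>
  let ?l = "aff_add ab (\<lambda>i. 0, 1)"
  let ?g = "\<lambda>x. min (f x) (clip (aff n ?l x))"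
  have "?g x = 1 \<longleftrightarrow> x \<in> halfspaces n (insert ab H)" if x: "x \<in> cube n" for x
  proof -
    have "?g x = 1 \<longleftrightarrow> f x = 1 \<and> clip (aff n ?l x) = 1"
      using PN_range[OF f(1) x] by (auto simp: clip_def min_def max_def)
    also have "clip (aff n ?l x) = 1 \<longleftrightarrow> 0 \<le> aff n ab x"
      by (simp add: clip_def) (auto simp: aff_def min_def max_def)
    finally show ?thesis
      using f(2)[OF x] by simp
  qed
  moreover have "PN n ?g"
    using f(1) by (intro PN_min PN_clip_aff)
  ultimately show ?case
    by blast
qed

text \<open>The set where a function equals 1 turns minima into intersections and maxima into
  unions, so a function in \<open>PN\<close> with 1-set \<open>P\<close> exists; pointedness makes
  it positive.\<close>

lemma pointed_polyhedron_positive_term: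
  assumes "pointed_rational_polyhedron n P"
  obtains t where "tvars t \<subseteq> {..<n}" "P = {x \<in> cube n. ev x t = 1}"
proof -
  have P: "hpoly n P" "P \<subseteq> cube n" "ones n \<in> P"
    using assms rational_polyhedron_hpoly unfolding pointed_rational_polyhedron_def by blast+
  obtain \<H> where H: "finite \<H>" "\<forall>H \<in> \<H>. finite H" "P = (\<Union>H \<in> \<H>. halfspaces n H)"
    using P(1) unfolding hpoly_def by (elim exE conjE)
  have "\<exists>f. PN n f \<and> (\<forall>x \<in> cube n. f x = 1 \<longleftrightarrow> x \<in> (\<Union>H \<in> \<H>. halfspaces n H))"
    using H(1,2)
  proof (induction \<H> rule: finite_induct)
    case empty
    have "PN n (\<lambda>x. 0)"
      using PN_neg[OF PN_ev[of One n]] by simp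
    then show ?case
      by (intro exI[of _ "\<lambda>x. 0"]) simp
  next
    case (insert H \<H>)
    then obtain f where f: "PN n f" "\<And>x. x \<in> cube n \<Longrightarrow> f x = 1 \<longleftrightarrow> x \<in> (\<Union>H \<in> \<H>. halfspaces n H)"
      by auto
    obtain g where g: "PN n g" "\<And>x. x \<in> cube n \<Longrightarrow> g x = 1 \<longleftrightarrow> x \<in> halfspaces n H"
      using PN_halfspaces[of H n] insert.prems by auto
    have "max (f x) (g x) = 1 \<longleftrightarrow> x \<in> (\<Union>H \<in> insert H \<H>. halfspaces n H)" if x: "x \<in> cube n" for x
    proof -
      have "max (f x) (g x) = 1 \<longleftrightarrow> f x = 1 \<or> g x = 1"
        using PN_range[OF f(1) x] PN_range[OF g(1) x] by (auto simp: max_def)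
      then show ?thesis
        using f(2)[OF x] g(2)[OF x] by auto
    qed
    moreover have "PN n (\<lambda>x. max (f x) (g x))"
      using f(1) g(1) by (rule PN_max)
    ultimately show ?case
      by (intro exI[of _ "\<lambda>x. max (f x) (g x)"] conjI ballI)
  qed
  then obtain f where f: "PN n f" "\<And>x. x \<in> cube n \<Longrightarrow> f x = 1 \<longleftrightarrow> x \<in> P"
    using H(3) by auto
  obtain t where t: "tvars t \<subseteq> {..<n}" "(\<forall>x \<in> cube n. f x = ev x t) \<or> (\<forall>x \<in> cube n. f x = 1 - ev x t)"
    using f(1) unfolding PN_def by blast
  \<comment> \<open>A negated term would have the value 0 here, by \<open>ev_ones\<close>.\<close>
  have "f (ones n) = 1"
    using f(2) P(3) ones_cube by blast
  then have "\<forall>x \<in> cube n. f x = ev x t"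
    using t ones_cube[of n] ev_ones[OF t(1)] by force
  then have "P = {x \<in> cube n. ev x t = 1}"
    using f(2) P(2) by auto
  then show ?thesis
    using that t(1) by blast
qed

section \<open>McNaughton functions\<close>

lemma McNaughtonI:
  assumes "\<And>x. x \<in> cube n \<Longrightarrow> f x \<in> {0..1}" "continuous_on (cube n) f" "finite L"
    and "\<And>x. x \<in> cube n \<Longrightarrow> \<exists>ab \<in> L. f x = aff n ab x"
  shows "restrict f (cube n) \<in> McNaughton n"
proof -
  have "continuous_on (cube n) (restrict f (cube n))"
    using assms(2) by (subst continuous_on_cong[OF refl, of _ _ f]) auto
  moreover have "\<forall>x \<in> cube n. \<exists>(a, b) \<in> L. restrict f (cube n) x = (\<Sum>i<n. of_int (a i) * x i) + of_int b"
    using assms(4) by (auto simp: aff_def case_prod_beta)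
  ultimately show ?thesis
    using assms(1,3) unfolding McNaughton_def by auto
qed

lemma McNaughtonE:
  assumes "f \<in> McNaughton n"
  obtains L where "\<And>x. x \<in> cube n \<Longrightarrow> f x \<in> {0..1}" "continuous_on (cube n) f" "finite L"
    "\<And>x. x \<in> cube n \<Longrightarrow> \<exists>ab \<in> L. f x = aff n ab x" "f \<in> extensional (cube n)"
proof -
  obtain L where "finite L"
    "\<forall>x \<in> cube n. \<exists>(a, b) \<in> L. f x = (\<Sum>i<n. of_int (a i) * x i) + of_int b"
    using assms unfolding McNaughton_def by blast
  then have L: "finite L" "\<And>x. x \<in> cube n \<Longrightarrow> \<exists>ab \<in> L. f x = aff n ab x"
    by (auto simp: aff_def case_prod_beta)
  have f: "f \<in> cube n \<rightarrow>\<^sub>E {0..1}" "continuous_on (cube n) f"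
    using assms unfolding McNaughton_def by blast+
  show ?thesis
    by (rule that[OF PiE_mem[OF f(1)] f(2) L]) (use f in \<open>auto simp: PiE_def\<close>)
qed

lemma continuous_on_coordinate: "continuous_on S (\<lambda>x :: point. x i)"
  by (rule continuous_on_subset[OF continuous_on_product_coordinates]) simp

lemma continuous_on_ev: "continuous_on S (\<lambda>x. ev x t)"
  by (induction t) (auto intro!: continuous_intros continuous_on_coordinate)

lemma ev_McNaughton:
  assumes "tvars t \<subseteq> {..<n}"
  shows "(\<lambda>x \<in> cube n. ev x t) \<in> McNaughton n"
proof -
  obtain \<C> where C: "finite \<C>" "\<And>x. x \<in> cube n \<Longrightarrow> \<exists>c \<in> \<C>. x \<in> halfspaces n (fst c)"
    "\<And>c x. c \<in> \<C> \<Longrightarrow> x \<in> halfspaces n (fst c) \<Longrightarrow> ev x t = aff n (snd c) x"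
    using PL_ev[OF assms] unfolding PL_def by blast
  show ?thesis
  proof (rule McNaughtonI)
    show "finite (snd ` \<C>)"
      using C(1) by simp
    show "\<exists>ab \<in> snd ` \<C>. ev x t = aff n ab x" if "x \<in> cube n" for x
      using C(2)[OF that] C(3) by blast
  qed (use assms continuous_on_ev ev_range in auto)
qed

lemma McNaughton_ops:
  assumes f: "f \<in> McNaughton n" and g: "g \<in> McNaughton n"
  shows "(\<lambda>x \<in> cube n. f x \<otimes>\<^bsub>standard_mv\<^esub> g x) \<in> McNaughton n"
    and "(\<lambda>x \<in> cube n. f x \<rightharpoonup>\<^bsub>standard_mv\<^esub> g x) \<in> McNaughton n"
    and "(\<lambda>x \<in> cube n. f x \<curlywedge>\<^bsub>standard_mv\<^esub> g x) \<in> McNaughton n"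
    and "(\<lambda>x \<in> cube n. f x \<curlyvee>\<^bsub>standard_mv\<^esub> g x) \<in> McNaughton n"
proof -
  obtain K where K: "\<And>x. x \<in> cube n \<Longrightarrow> f x \<in> {0..1}" "continuous_on (cube n) f" "finite K"
    "\<And>x. x \<in> cube n \<Longrightarrow> \<exists>ab \<in> K. f x = aff n ab x"
    by (rule McNaughtonE[OF f], rule that)
  obtain L where L: "\<And>x. x \<in> cube n \<Longrightarrow> g x \<in> {0..1}" "continuous_on (cube n) g" "finite L"
    "\<And>x. x \<in> cube n \<Longrightarrow> \<exists>ab \<in> L. g x = aff n ab x"
    by (rule McNaughtonE[OF g], rule that)
  let ?c = "\<lambda>c :: int. ((\<lambda>i :: nat. 0 :: int), c)"
  have c: "aff n (?c c) x = of_int c" for c x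
    by (simp add: aff_def)
  have r: "0 \<le> f x \<and> f x \<le> 1 \<and> 0 \<le> g x \<and> g x \<le> 1" if "x \<in> cube n" for x
    using K(1)[OF that] L(1)[OF that] by simp
  show "(\<lambda>x \<in> cube n. f x \<otimes>\<^bsub>standard_mv\<^esub> g x) \<in> McNaughton n"
  proof (rule McNaughtonI)
    let ?M = "insert (?c 0) ((\<lambda>(p, q). aff_add (aff_add p q) (?c (-1))) ` (K \<times> L))"
    show "finite ?M"
      using K(3) L(3) by simp
    fix x assume x: "x \<in> cube n"
    obtain p q where "p \<in> K" "f x = aff n p x" "q \<in> L" "g x = aff n q x"
      using K(4)[OF x] L(4)[OF x] by blast
    then show "\<exists>ab \<in> ?M. f x \<otimes>\<^bsub>standard_mv\<^esub> g x = aff n ab x"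
      by (simp add: max_def c) (metis (no_types, lifting) aff_add c SigmaI case_prod_conv of_int_minus of_int_1 diff_conv_add_uminus)
    show "f x \<otimes>\<^bsub>standard_mv\<^esub> g x \<in> {0..1}"
      using r[OF x] by auto
  qed (use K(2) L(2) in \<open>auto intro!: continuous_intros\<close>)
  show "(\<lambda>x \<in> cube n. f x \<rightharpoonup>\<^bsub>standard_mv\<^esub> g x) \<in> McNaughton n"
  proof (rule McNaughtonI)
    let ?M = "insert (?c 1) ((\<lambda>(p, q). aff_add (aff_add (?c 1) (aff_neg p)) q) ` (K \<times> L))"
    show "finite ?M"
      using K(3) L(3) by simp
    fix x assume x: "x \<in> cube n"
    obtain p q where "p \<in> K" "f x = aff n p x" "q \<in> L" "g x = aff n q x"
      using K(4)[OF x] L(4)[OF x] by blast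
    then show "\<exists>ab \<in> ?M. f x \<rightharpoonup>\<^bsub>standard_mv\<^esub> g x = aff n ab x"
      by (force simp: min_def c)
    show "f x \<rightharpoonup>\<^bsub>standard_mv\<^esub> g x \<in> {0..1}"
      using r[OF x] by auto
  qed (use K(2) L(2) in \<open>auto intro!: continuous_intros\<close>)
  show "(\<lambda>x \<in> cube n. f x \<curlywedge>\<^bsub>standard_mv\<^esub> g x) \<in> McNaughton n"
  proof (rule McNaughtonI)
    show "finite (K \<union> L)"
      using K(3) L(3) by simp
    fix x assume x: "x \<in> cube n"
    show "\<exists>ab \<in> K \<union> L. f x \<curlywedge>\<^bsub>standard_mv\<^esub> g x = aff n ab x"
      using K(4)[OF x] L(4)[OF x] by (auto simp: min_def)
    show "f x \<curlywedge>\<^bsub>standard_mv\<^esub> g x \<in> {0..1}"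
      using r[OF x] by auto
  qed (use K(2) L(2) in \<open>auto intro!: continuous_intros\<close>)
  show "(\<lambda>x \<in> cube n. f x \<curlyvee>\<^bsub>standard_mv\<^esub> g x) \<in> McNaughton n"
  proof (rule McNaughtonI)
    show "finite (K \<union> L)"
      using K(3) L(3) by simp
    fix x assume x: "x \<in> cube n"
    show "\<exists>ab \<in> K \<union> L. f x \<curlyvee>\<^bsub>standard_mv\<^esub> g x = aff n ab x"
      using K(4)[OF x] L(4)[OF x] by (auto simp: max_def)
    show "f x \<curlyvee>\<^bsub>standard_mv\<^esub> g x \<in> {0..1}"
      using r[OF x] by auto
  qed (use K(2) L(2) in \<open>auto intro!: continuous_intros\<close>)
qed

text \<open>A piece of the composite arises from one piece of \<open>F\<close> and one piece of each
  component of \<open>k\<close>, so only finitely many affine forms occur.\<close>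

lemma McNaughton_comp:
  assumes F: "F \<in> McNaughton n" and k: "\<And>y. y \<in> cube m \<Longrightarrow> k y \<in> cube n"
    and kM: "\<And>i. i < n \<Longrightarrow> (\<lambda>y \<in> cube m. k y i) \<in> McNaughton m"
  shows "(\<lambda>y \<in> cube m. F (k y)) \<in> McNaughton m"
proof -
  obtain K where K: "\<And>x. x \<in> cube n \<Longrightarrow> F x \<in> {0..1}" "continuous_on (cube n) F" "finite K"
    "\<And>x. x \<in> cube n \<Longrightarrow> \<exists>ab \<in> K. F x = aff n ab x"
    by (rule McNaughtonE[OF F], rule that)
  have "\<forall>i \<in> {..<n}. \<exists>L. finite L \<and> (\<forall>y \<in> cube m. \<exists>ab \<in> L. k y i = aff m ab y)"
  proof
    fix i assume "i \<in> {..<n}"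
    then show "\<exists>L. finite L \<and> (\<forall>y \<in> cube m. \<exists>ab \<in> L. k y i = aff m ab y)"
      using McNaughtonE[OF kM[of i]] by (metis lessThan_iff restrict_apply')
  qed
  from bchoice[OF this] obtain L where L: "\<And>i. i < n \<Longrightarrow> finite (L i)"
    "\<And>i y. i < n \<Longrightarrow> y \<in> cube m \<Longrightarrow> \<exists>ab \<in> L i. k y i = aff m ab y"
    by (metis lessThan_iff)
  define comp where "comp = (\<lambda>(p :: (nat \<Rightarrow> int) \<times> int, c :: nat \<Rightarrow> (nat \<Rightarrow> int) \<times> int).
    (\<lambda>j. \<Sum>i<n. fst p i * fst (c i) j, (\<Sum>i<n. fst p i * snd (c i)) + snd p))"
  have comp: "aff m (comp (p, c)) y = (\<Sum>i<n. of_int (fst p i) * aff m (c i) y) + of_int (snd p)" for p c y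
    by (simp add: comp_def aff_def distrib_left sum.distrib sum_distrib_left sum_distrib_right
        sum.swap[of _ "{..<n}" "{..<m}"] mult.assoc)
  let ?M = "comp ` (K \<times> PiE {..<n} L)"
  show ?thesis
  proof (rule McNaughtonI)
    show "finite ?M"
      using K(3) L(1) by (intro finite_imageI finite_cartesian_product finite_PiE) auto
    fix y assume y: "y \<in> cube m"
    obtain p where p: "p \<in> K" "F (k y) = aff n p (k y)"
      using K(4)[OF k[OF y]] by blast
    have "\<forall>i \<in> {..<n}. \<exists>ab. ab \<in> L i \<and> k y i = aff m ab y"
      using L(2)[OF _ y] by blast
    from bchoice[OF this] obtain c where c: "\<And>i. i < n \<Longrightarrow> c i \<in> L i" "\<And>i. i < n \<Longrightarrow> k y i = aff m (c i) y"
      by (metis lessThan_iff)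
    have "F (k y) = aff m (comp (p, restrict c {..<n})) y"
      unfolding comp p(2) by (simp add: aff_def[of n] c(2))
    moreover have "restrict c {..<n} \<in> PiE {..<n} L"
      using c(1) by auto
    ultimately show "\<exists>ab \<in> ?M. F (k y) = aff m ab y"
      using p(1) by blast
    show "F (k y) \<in> {0..1}"
      using K(1)[OF k[OF y]] .
  next
    \<comment> \<open>The product topology has a coordinate for every natural number; those from
      \<open>n\<close> on are constantly 0.\<close>
    have "continuous_on (cube m) (\<lambda>y. k y i)" for i
    proof (cases "i < n")
      case True
      have "continuous_on (cube m) (\<lambda>y \<in> cube m. k y i)"
        using kM[OF True] by (simp add: McNaughton_def)
      then show ?thesis
        by (subst (asm) continuous_on_cong[OF refl, of _ _ "\<lambda>y. k y i"]) auto
    next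
      case False
      then have "k y i = 0" if "y \<in> cube m" for y
        using k[OF that] by (simp add: cube_def space_def)
      then show ?thesis
        by (subst continuous_on_cong[OF refl, of _ _ "\<lambda>y. 0"]) auto
    qed
    then have "continuous_on (cube m) k"
      by (rule continuous_on_coordinatewise_then_product)
    then show "continuous_on (cube m) (\<lambda>y. F (k y))"
      by (rule continuous_on_compose2[OF K(2)]) (use k in blast)
  qed
qed

section \<open>Positive MV-algebras and their homomorphisms\<close>

lemma pointwise_mv_simps [simp]:
  "carrier (pointwise_mv X S) = S" "\<one>\<^bsub>pointwise_mv X S\<^esub> = (\<lambda>x \<in> X. 1)"
  "mvzero (pointwise_mv X S) = (\<lambda>x \<in> X. 0)"
  "f \<otimes>\<^bsub>pointwise_mv X S\<^esub> g = (\<lambda>x \<in> X. max 0 (f x + g x - 1))"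
  "f \<rightharpoonup>\<^bsub>pointwise_mv X S\<^esub> g = (\<lambda>x \<in> X. min 1 (1 - f x + g x))"
  "f \<curlywedge>\<^bsub>pointwise_mv X S\<^esub> g = (\<lambda>x \<in> X. min (f x) (g x))"
  "f \<curlyvee>\<^bsub>pointwise_mv X S\<^esub> g = (\<lambda>x \<in> X. max (f x) (g x))"
  by (simp_all add: pointwise_mv_def)

lemma pointwise_wajsberg:
  assumes S: "S \<subseteq> X \<rightarrow>\<^sub>E {0..1}" and cl: "closed_ops (pointwise_mv X S)"
  shows "wajsberg_hoop (pointwise_mv X S)"
proof -
  let ?A = "pointwise_mv X S"
  interpret I: wajsberg_hoop standard_mv
    by (rule wajsberg_hoop_standard_mv)
  have r: "f x \<in> carrier standard_mv" if "f \<in> S" "x \<in> X" for f x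
    using S that by fastforce
  have e: "f \<in> extensional X" if "f \<in> S" for f
    using S that by (auto simp: PiE_def)
  show ?thesis
  proof (intro wajsberg_hoop.intro comm_monoidI wajsberg_hoop_axioms.intro)
    show "\<one>\<^bsub>?A\<^esub> \<in> carrier ?A"
      by (rule closed_opsD(1)[OF cl])
    fix f assume f: "f \<in> carrier ?A"
    show "\<one>\<^bsub>?A\<^esub> \<otimes>\<^bsub>?A\<^esub> f = f"
      using f e[of f] r[of f] by (intro extensionalityI[of _ X]) auto
    show "f \<rightharpoonup>\<^bsub>?A\<^esub> f = \<one>\<^bsub>?A\<^esub>"
      by auto
    fix g assume g: "g \<in> carrier ?A"
    show "f \<otimes>\<^bsub>?A\<^esub> g \<in> carrier ?A" "f \<rightharpoonup>\<^bsub>?A\<^esub> g \<in> carrier ?A"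
      using closed_opsD(2,3)[OF cl f g] .
    show "f \<otimes>\<^bsub>?A\<^esub> g = g \<otimes>\<^bsub>?A\<^esub> f"
      by (auto simp: add.commute)
    show "f \<otimes>\<^bsub>?A\<^esub> (f \<rightharpoonup>\<^bsub>?A\<^esub> g) = g \<otimes>\<^bsub>?A\<^esub> (g \<rightharpoonup>\<^bsub>?A\<^esub> f)"
      using I.divisibility[OF r r] f g by (auto intro!: restrict_ext)
    show "(f \<rightharpoonup>\<^bsub>?A\<^esub> g) \<rightharpoonup>\<^bsub>?A\<^esub> g = (g \<rightharpoonup>\<^bsub>?A\<^esub> f) \<rightharpoonup>\<^bsub>?A\<^esub> f"
      using I.wajsberg[OF r r] f g by (auto intro!: restrict_ext)
    show "f \<curlywedge>\<^bsub>?A\<^esub> g = f \<otimes>\<^bsub>?A\<^esub> (f \<rightharpoonup>\<^bsub>?A\<^esub> g)"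
      using I.hmeet_eq[OF r r] f g by (auto intro!: restrict_ext)
    show "f \<curlyvee>\<^bsub>?A\<^esub> g = (f \<rightharpoonup>\<^bsub>?A\<^esub> g) \<rightharpoonup>\<^bsub>?A\<^esub> g"
      using I.hjoin_eq[OF r r] f g by (auto intro!: restrict_ext)
    fix h assume h: "h \<in> carrier ?A"
    show "f \<otimes>\<^bsub>?A\<^esub> g \<otimes>\<^bsub>?A\<^esub> h = f \<otimes>\<^bsub>?A\<^esub> (g \<otimes>\<^bsub>?A\<^esub> h)"
      using I.m_assoc[OF r r r] f g h by (auto intro!: restrict_ext)
    show "(f \<otimes>\<^bsub>?A\<^esub> g) \<rightharpoonup>\<^bsub>?A\<^esub> h = f \<rightharpoonup>\<^bsub>?A\<^esub> (g \<rightharpoonup>\<^bsub>?A\<^esub> h)"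
      using I.currying[OF r r r] f g h by (auto intro!: restrict_ext)
  qed
qed

lemma teval_pointwise:
  assumes "\<And>i. i \<in> tvars t \<Longrightarrow> v i \<in> extensional X"
  shows "teval (pointwise_mv X S) v t = (\<lambda>x \<in> X. ev (\<lambda>i. v i x) t)"
  using assms by (induction t) (auto simp: extensional_restrict)

definition term_fun :: "point set \<Rightarrow> hterm \<Rightarrow> point \<Rightarrow> real" where
  "term_fun P t = (\<lambda>x \<in> P. ev x t)"

lemma term_fun_apply [simp]: "x \<in> P \<Longrightarrow> term_fun P t x = ev x t"
  by (simp add: term_fun_def)

lemma term_fun_extensional [simp]: "term_fun P t \<in> extensional P"
  by (simp add: term_fun_def)

lemma term_fun_eq_iff: "term_fun P s = term_fun P t \<longleftrightarrow> (\<forall>x \<in> P. ev x s = ev x t)"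
  by (metis term_fun_apply term_fun_def restrict_ext)

lemma teval_term_fun: "teval (pointwise_mv P S) (\<lambda>i. term_fun P (Var i)) t = term_fun P t"
  by (subst teval_pointwise) (auto simp: term_fun_def intro!: restrict_ext teval_cong)

lemma carrier_free_mv: "carrier (free_mv n) = McNaughton n"
  by (simp add: free_mv_def)

lemma positive_eq: "positive n = term_fun (cube n) ` {t. tvars t \<subseteq> {..<n}}"
proof -
  have "proj n = (\<lambda>i. term_fun (cube n) (Var i))"
    by (simp add: fun_eq_iff proj_def term_fun_def)
  then have "teval (free_mv n) (proj n) t = term_fun (cube n) t" for t
    by (simp add: free_mv_def teval_term_fun)
  then show ?thesis
    using ev_McNaughton by (auto simp: positive_def carrier_free_mv term_fun_def)
qed

text \<open>Kept as an \<open>mv\<close> record so that its operations are literally those of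
  \<open>restrict_mv n P\<close>. For pointed \<open>P\<close> the field \<open>mvzero\<close> lies
  outside the carrier, since terms have the value 1 at \<open>ones n\<close>.\<close>

definition pos_hoop :: "nat \<Rightarrow> point set \<Rightarrow> (point \<Rightarrow> real) mv" where
  "pos_hoop n P = pointwise_mv P (term_fun P ` {t. tvars t \<subseteq> {..<n}})"

lemma restrict_term_fun: "P \<subseteq> Q \<Longrightarrow> restrict (term_fun Q t) P = term_fun P t"
  by (simp add: term_fun_def Int_absorb1)

lemma restrict_positive:
  "P \<subseteq> cube n \<Longrightarrow> (\<lambda>h. restrict h P) ` positive n = carrier (pos_hoop n P)"
  by (simp add: positive_eq pos_hoop_def image_image restrict_term_fun)

lemma carrier_restrict_mv: "carrier (restrict_mv n P) = (\<lambda>F. restrict F P) ` McNaughton n"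
  by (simp add: restrict_mv_def carrier_free_mv)

lemma restrict_mv_eq: "restrict_mv n P = pointwise_mv P (carrier (restrict_mv n P))"
  by (simp add: restrict_mv_def)

lemma term_fun_restrict_mv:
  assumes "P \<subseteq> cube n" "tvars t \<subseteq> {..<n}"
  shows "term_fun P t \<in> carrier (restrict_mv n P)"
proof -
  have "term_fun P t = restrict (\<lambda>x \<in> cube n. ev x t) P"
    using assms(1) by (simp add: term_fun_def Int_absorb1)
  then show ?thesis
    using ev_McNaughton[OF assms(2)] unfolding carrier_restrict_mv by (rule image_eqI)
qed

lemma zero_McNaughton: "(\<lambda>x \<in> cube n. 0) \<in> McNaughton n"
  by (rule McNaughtonI[of _ _ "{(\<lambda>i. 0, 0)}"]) (auto simp: aff_def)

lemma zero_restrict_mv: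
  assumes "P \<subseteq> cube n"
  shows "mvzero (restrict_mv n P) \<in> carrier (restrict_mv n P)"
proof -
  have "mvzero (restrict_mv n P) = restrict (\<lambda>x \<in> cube n. 0) P"
    using assms by (simp add: restrict_mv_def Int_absorb1)
  then show ?thesis
    using zero_McNaughton unfolding carrier_restrict_mv by (intro image_eqI)
qed

lemma closed_ops_pos_hoop: "closed_ops (pos_hoop n P)"
proof -
  have "(\<lambda>x \<in> P. 1) = term_fun P One"
    "(\<lambda>x \<in> P. max 0 (term_fun P s x + term_fun P t x - 1)) = term_fun P (Mult s t)"
    "(\<lambda>x \<in> P. min 1 (1 - term_fun P s x + term_fun P t x)) = term_fun P (Imp s t)"
    "(\<lambda>x \<in> P. min (term_fun P s x) (term_fun P t x)) = term_fun P (Meet s t)"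
    "(\<lambda>x \<in> P. max (term_fun P s x) (term_fun P t x)) = term_fun P (Join s t)" for s t
    by (auto simp: term_fun_def)
  then show ?thesis
    by (auto simp: closed_ops_def pos_hoop_def intro!: imageI)
qed

lemma closed_ops_restrict_mv:
  assumes P: "P \<subseteq> cube n"
  shows "closed_ops (restrict_mv n P)"
proof -
  have one: "(\<lambda>x \<in> P. 1) \<in> carrier (restrict_mv n P)"
    using term_fun_restrict_mv[OF P, of One] by (simp add: term_fun_def)
  have op: "(\<lambda>x \<in> P. h (restrict f P x) (restrict g P x)) \<in> (\<lambda>F. restrict F P) ` McNaughton n"
    if "(\<lambda>x \<in> cube n. h (f x) (g x)) \<in> McNaughton n" for h f g
    by (rule image_eqI[OF _ that]) (use P in \<open>auto simp: fun_eq_iff restrict_def\<close>)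
  have "(\<lambda>x \<in> P. max 0 (f x + g x - 1)) \<in> carrier (restrict_mv n P) \<and>
    (\<lambda>x \<in> P. min 1 (1 - f x + g x)) \<in> carrier (restrict_mv n P) \<and>
    (\<lambda>x \<in> P. min (f x) (g x)) \<in> carrier (restrict_mv n P) \<and>
    (\<lambda>x \<in> P. max (f x) (g x)) \<in> carrier (restrict_mv n P)"
    if fg: "f \<in> carrier (restrict_mv n P)" "g \<in> carrier (restrict_mv n P)" for f g
  proof -
    obtain F G where F: "F \<in> McNaughton n" "f = restrict F P" and G: "G \<in> McNaughton n" "g = restrict G P"
      using fg unfolding carrier_restrict_mv by blast
    note M = McNaughton_ops[OF F(1) G(1), simplified]
    show ?thesis
      unfolding carrier_restrict_mv F(2) G(2)
      using op[of "\<lambda>a b. max 0 (a + b - 1)", OF M(1)] op[of "\<lambda>a b. min 1 (1 - a + b)", OF M(2)]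
        op[of min, OF M(3)] op[of max, OF M(4)] by (intro conjI)
  qed
  then have "closed_ops (pointwise_mv P (carrier (restrict_mv n P)))"
    unfolding closed_ops_def using one by simp
  then show ?thesis
    unfolding restrict_mv_eq[symmetric] .
qed

lemma pos_hoop_presented:
  assumes P: "P \<subseteq> cube n"
  shows "presented n P (pos_hoop n P) (\<lambda>i. term_fun P (Var i))"
proof -
  have "term_fun P t \<in> P \<rightarrow>\<^sub>E {0..1}" if "tvars t \<subseteq> {..<n}" for t
    using ev_range[OF _ that] P by (auto simp: term_fun_def)
  then have "wajsberg_hoop (pos_hoop n P)"
    using closed_ops_pos_hoop[of n P] unfolding pos_hoop_def by (intro pointwise_wajsberg) auto
  then show ?thesis
    unfolding presented_def
    by (auto simp: pos_hoop_def teval_term_fun term_fun_eq_iff)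
qed

text \<open>A single relation is enough: the polyhedron is the set where one positive term
  \<open>t\<close> equals 1.\<close>

lemma pos_hoop_finitely_presented:
  assumes P: "pointed_rational_polyhedron n P"
  shows "finitely_presented (pos_hoop n P)"
proof -
  have PC: "P \<subseteq> cube n"
    using P by (simp add: pointed_rational_polyhedron_def)
  obtain t where t: "tvars t \<subseteq> {..<n}" "P = {x \<in> cube n. ev x t = 1}"
    using P by (rule pointed_polyhedron_positive_term)
  then have "P = sol n {(t, One)}"
    by (simp add: sol_def)
  then have "presented n (sol n {(t, One)}) (pos_hoop n P) (\<lambda>i. term_fun P (Var i))"
    using pos_hoop_presented[OF PC] by simp
  moreover have "\<forall>(p, q) \<in> {(t, One)}. tvars p \<subseteq> {..<n} \<and> tvars q \<subseteq> {..<n}"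
    using t(1) by simp
  ultimately show ?thesis
    unfolding finitely_presented_iff[OF presentedD(1)[OF pos_hoop_presented[OF PC]]]
    by (intro exI conjI) simp_all
qed

section \<open>Homomorphisms as evaluations and substitutions\<close>

lemma mv_hom_hoop_hom: "\<alpha> \<in> mv_hom A B \<Longrightarrow> \<alpha> \<in> hoop_hom A B"
  by (simp add: mv_hom_def)

lemma restrict_mv_extensional: "f \<in> carrier (restrict_mv k R) \<Longrightarrow> f \<in> extensional R"
  by (auto simp: carrier_restrict_mv)

lemma restrict_mv_range:
  assumes "f \<in> carrier (restrict_mv k R)" "x \<in> R" "R \<subseteq> cube k"
  shows "f x \<in> {0..1}"
proof -
  obtain F where "F \<in> McNaughton k" "f = restrict F R"
    using assms(1) unfolding carrier_restrict_mv by blast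
  then show ?thesis
    using assms(2,3) by (auto elim!: McNaughtonE)
qed

text \<open>A homomorphism commutes with terms, and with their negations because these are
  implications into the constant 0, which it preserves. The zeros from index \<open>k\<close> on
  make the arguments of \<open>g\<close> points of the cube.\<close>

lemma mv_hom_PN:
  assumes P: "P \<subseteq> cube n" and Q: "Q \<subseteq> cube m"
    and \<alpha>: "\<alpha> \<in> mv_hom (restrict_mv n P) (restrict_mv m Q)"
    and g: "PN k g" and f: "\<And>i. i < k \<Longrightarrow> f i \<in> carrier (restrict_mv n P)"
  shows "(\<lambda>x \<in> P. g (\<lambda>i. if i < k then f i x else 0)) \<in> carrier (restrict_mv n P)"
    and "q \<in> Q \<Longrightarrow> \<alpha> (\<lambda>x \<in> P. g (\<lambda>i. if i < k then f i x else 0)) q = g (\<lambda>i. if i < k then \<alpha> (f i) q else 0)"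
proof -
  let ?A = "restrict_mv n P" and ?B = "restrict_mv m Q"
  note clA = closed_ops_restrict_mv[OF P] and hom = hoop_homD[OF mv_hom_hoop_hom[OF \<alpha>]]
  obtain t where t: "tvars t \<subseteq> {..<k}" "(\<forall>x \<in> cube k. g x = ev x t) \<or> (\<forall>x \<in> cube k. g x = 1 - ev x t)"
    using g unfolding PN_def by blast
  have fC: "f i \<in> carrier ?A" if "i \<in> tvars t" for i
    using that t(1) f by auto
  let ?e = "teval ?A f t"
  have eC: "?e \<in> carrier ?A"
    using fC by (rule teval_closed[OF clA])
  have e: "?e = (\<lambda>x \<in> P. ev (\<lambda>i. if i < k then f i x else 0) t)"
  proof -
    have "?e = (\<lambda>x \<in> P. ev (\<lambda>i. f i x) t)"
      by (subst restrict_mv_eq, rule teval_pointwise) (use fC restrict_mv_extensional in blast)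
    also have "\<dots> = (\<lambda>x \<in> P. ev (\<lambda>i. if i < k then f i x else 0) t)"
      using t(1) by (intro restrict_ext teval_cong) auto
    finally show ?thesis .
  qed
  have \<alpha>e: "\<alpha> ?e = (\<lambda>q \<in> Q. ev (\<lambda>i. if i < k then \<alpha> (f i) q else 0) t)"
  proof -
    have "\<alpha> ?e = teval ?B (\<lambda>i. \<alpha> (f i)) t"
      by (rule hoop_hom_teval[OF mv_hom_hoop_hom[OF \<alpha>] clA fC])
    also have "\<dots> = (\<lambda>q \<in> Q. ev (\<lambda>i. \<alpha> (f i) q) t)"
      by (subst restrict_mv_eq, rule teval_pointwise) (use fC hom(3) restrict_mv_extensional in blast)
    also have "\<dots> = (\<lambda>q \<in> Q. ev (\<lambda>i. if i < k then \<alpha> (f i) q else 0) t)"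
      using t(1) by (intro restrict_ext teval_cong) auto
    finally show ?thesis .
  qed
  have cubeA: "(\<lambda>i. if i < k then f i x else 0) \<in> cube k" if "x \<in> P" for x
    using restrict_mv_range[OF f that P] by (auto simp: cube_def space_def)
  have cubeB: "(\<lambda>i. if i < k then \<alpha> (f i) q else 0) \<in> cube k" if "q \<in> Q" for q
    using restrict_mv_range[OF hom(3)[OF f] that Q] by (auto simp: cube_def space_def)
  let ?z = "mvzero ?A"
  have z: "?z \<in> carrier ?A" "?z = (\<lambda>x \<in> P. 0)" "\<alpha> ?z = (\<lambda>x \<in> Q. 0)"
  proof -
    show "?z = (\<lambda>x \<in> P. 0)"
      by (simp add: restrict_mv_def)
    show "?z \<in> carrier ?A"
      by (rule zero_restrict_mv[OF P])
    show "\<alpha> ?z = (\<lambda>x \<in> Q. 0)"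
      using \<alpha> by (simp add: mv_hom_def restrict_mv_def)
  qed
  let ?n = "?e \<rightharpoonup>\<^bsub>?A\<^esub> ?z"
  have n: "?n = (\<lambda>x \<in> P. 1 - ev (\<lambda>i. if i < k then f i x else 0) t)"
    using ev_range[OF cubeA t(1)] unfolding z(2) e
    by (subst restrict_mv_eq) (auto intro!: restrict_ext)
  have \<alpha>n: "\<alpha> ?n = (\<lambda>q \<in> Q. 1 - ev (\<lambda>i. if i < k then \<alpha> (f i) q else 0) t)"
  proof -
    have "\<alpha> ?n = \<alpha> ?e \<rightharpoonup>\<^bsub>?B\<^esub> \<alpha> ?z"
      by (rule hom(5)[OF eC z(1)])
    then show ?thesis
      using ev_range[OF cubeB t(1)] unfolding z(3) \<alpha>e
      by (subst (asm) restrict_mv_eq) (auto intro!: restrict_ext)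
  qed
  from t(2) have "(\<lambda>x \<in> P. g (\<lambda>i. if i < k then f i x else 0)) \<in> carrier ?A \<and>
     (\<forall>q \<in> Q. \<alpha> (\<lambda>x \<in> P. g (\<lambda>i. if i < k then f i x else 0)) q = g (\<lambda>i. if i < k then \<alpha> (f i) q else 0))"
  proof
    assume g: "\<forall>x \<in> cube k. g x = ev x t"
    then have "(\<lambda>x \<in> P. g (\<lambda>i. if i < k then f i x else 0)) = ?e"
      unfolding e using cubeA by (intro restrict_ext) simp
    then show ?thesis
      using eC \<alpha>e g cubeB by simp
  next
    assume g: "\<forall>x \<in> cube k. g x = 1 - ev x t"
    then have "(\<lambda>x \<in> P. g (\<lambda>i. if i < k then f i x else 0)) = ?n"
      unfolding n using cubeA by (intro restrict_ext) simp
    then show ?thesis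
      using closed_opsD(3)[OF clA eC z(1)] \<alpha>n g cubeB by simp
  qed
  then show "(\<lambda>x \<in> P. g (\<lambda>i. if i < k then f i x else 0)) \<in> carrier ?A"
    "q \<in> Q \<Longrightarrow> \<alpha> (\<lambda>x \<in> P. g (\<lambda>i. if i < k then f i x else 0)) q = g (\<lambda>i. if i < k then \<alpha> (f i) q else 0)"
    by blast+
qed

text \<open>Each coordinate contributes a rising and a falling clipped ramp; their minimum over all
  coordinates is the bump.\<close>

lemma PN_bump:
  assumes x: "x \<in> cube n" and e: "\<And>i. i < n \<Longrightarrow> 0 < e i"
  shows "\<exists>u. PN n u \<and> u x = 1 \<and> (\<forall>y \<in> cube n. (\<exists>i < n. e i \<le> \<bar>y i - x i\<bar>) \<longrightarrow> u y = 0)"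
proof -
  have "\<exists>u. PN n u \<and> u x = 1 \<and> (\<forall>y \<in> cube n. (\<exists>i < k. e i \<le> \<bar>y i - x i\<bar>) \<longrightarrow> u y = 0)" if "k \<le> n" for k
    using that
  proof (induction k)
    case 0
    have "PN n (\<lambda>x. 1)"
      using PN_ev[of One n] by simp
    then show ?case
      by (intro exI[of _ "\<lambda>x. 1"]) simp
  next
    case (Suc k)
    then obtain u where u: "PN n u" "u x = 1" "\<And>y. y \<in> cube n \<Longrightarrow> \<exists>i < k. e i \<le> \<bar>y i - x i\<bar> \<Longrightarrow> u y = 0"
      by (meson Suc_leD)
    have k: "k < n" "0 < e k"
      using Suc.prems e by auto
    \<comment> \<open>Leaving the box must change \<open>d\<close> times the coordinate by at least
      2: one unit is lost to rounding \<open>real d * x k\<close> to an integer, and the other takes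
      the ramp from 1 down to 0.\<close>
    obtain d :: nat where d: "2 / e k \<le> real d"
      using real_arch_simple by blast
    then have de: "2 \<le> real d * e k"
      using k(2) by (simp add: field_simps)
    let ?l = "(unit_vec (int d) k, 1 - \<lfloor>real d * x k\<rfloor>)"
    let ?r = "(unit_vec (- int d) k, 1 + \<lceil>real d * x k\<rceil>)"
    let ?u = "\<lambda>y. min (u y) (min (clip (aff n ?l y)) (clip (aff n ?r y)))"
    have aff: "aff n ?l y = real d * y k + 1 - of_int \<lfloor>real d * x k\<rfloor>"
      "aff n ?r y = of_int \<lceil>real d * x k\<rceil> + 1 - real d * y k" for y
      using k(1) by (simp_all add: aff_unit_vec)
    have "PN n ?u"
      using u(1) by (intro PN_min PN_clip_aff)
    moreover have "?u x = 1"
    proof -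
      have "1 \<le> aff n ?l x" "1 \<le> aff n ?r x"
        unfolding aff by linarith+
      then show ?thesis
        using u(2) by (simp add: clip_def)
    qed
    moreover have "?u y = 0" if y: "y \<in> cube n" and i: "\<exists>i < Suc k. e i \<le> \<bar>y i - x i\<bar>" for y
    proof -
      have nonneg: "0 \<le> u y" "0 \<le> clip r" for r
        using PN_range[OF u(1) y] by (auto simp: clip_def)
      show ?thesis
      proof (cases "\<exists>i < k. e i \<le> \<bar>y i - x i\<bar>")
        case True
        then show ?thesis
          using u(3)[OF y] nonneg by simp
      next
        case False
        then have "e k \<le> \<bar>y k - x k\<bar>"
          using i less_Suc_eq by auto
        then have "real d * e k \<le> real d * \<bar>y k - x k\<bar>"
          by (intro mult_left_mono) auto
        then have *: "2 \<le> \<bar>real d * y k - real d * x k\<bar>"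
          using de by (simp add: abs_mult flip: right_diff_distrib)
        have "aff n ?l y \<le> 0 \<or> aff n ?r y \<le> 0"
          unfolding aff using * by linarith
        then have "clip (aff n ?l y) = 0 \<or> clip (aff n ?r y) = 0"
          by (auto simp: clip_def)
        then show ?thesis
          using nonneg(1) nonneg(2)[of "aff n ?l y"] nonneg(2)[of "aff n ?r y"] by linarith
      qed
    qed
    ultimately show ?case
      by blast
  qed
  then show ?thesis
    by blast
qed

text \<open>A basic open set of the product topology contains a box of open intervals; coordinates
  from \<open>n\<close> on agree throughout the cube, so only the first \<open>n\<close> radii
  enter.\<close>

lemma continuous_on_cube_box:
  fixes F :: "point \<Rightarrow> real"
  assumes F: "continuous_on (cube n) F" and x: "x \<in> cube n" "r < F x"
  obtains e where "\<And>i. i < n \<Longrightarrow> 0 < e i"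
    "\<And>y. \<lbrakk>y \<in> cube n; \<And>i. i < n \<Longrightarrow> \<bar>y i - x i\<bar> < e i\<rbrakk> \<Longrightarrow> r < F y"
proof -
  obtain U where U: "open U" "U \<inter> cube n = F -` {r<..} \<inter> cube n"
    using F open_greaterThan[of r] unfolding continuous_on_open_invariant by blast
  have "x \<in> U"
    using U(2) x by auto
  moreover have "openin (product_topology (\<lambda>i. euclidean) UNIV) U"
    using U(1) by (simp add: open_fun_def)
  ultimately have "\<exists>X. x \<in> PiE UNIV X \<and> (\<forall>i. open (X i)) \<and> finite {i. X i \<noteq> UNIV} \<and> PiE UNIV X \<subseteq> U"
    using product_topology_open_contains_basis[of "\<lambda>i. euclidean" UNIV U x] by simp
  then obtain X where X: "x \<in> PiE UNIV X" "\<And>i. open (X i)" "PiE UNIV X \<subseteq> U"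
    by blast
  have "\<exists>e > 0. \<forall>z. dist z (x i) < e \<longrightarrow> z \<in> X i" for i
    using X(1) X(2)[of i] unfolding open_dist by auto
  then obtain e where e: "\<And>i. 0 < e i" "\<And>i z. dist z (x i) < e i \<Longrightarrow> z \<in> X i"
    by metis
  have "r < F y" if y: "y \<in> cube n" "\<And>i. i < n \<Longrightarrow> \<bar>y i - x i\<bar> < e i" for y
  proof -
    have "y i \<in> X i" for i
    proof (cases "i < n")
      case True
      then show ?thesis
        using y(2)[OF True] by (intro e(2)) (simp add: dist_real_def)
    next
      case False
      then have "y i = x i"
        using x(1) y(1) by (simp add: cube_def space_def)
      then show ?thesis
        using X(1) by auto
    qed
    then have "y \<in> U"
      using X(3) by auto
    then show ?thesis
      using U(2) y(1) by auto
  qed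
  then show ?thesis
    using that e(1) by blast
qed

text \<open>A homomorphism into the unit interval is determined by its values on the coordinates: if its
  value on \<open>F\<close> were smaller than \<open>F x\<close>, separate the two by \<open>a / b\<close> and let \<open>g(z) = clip (1 + b z - a)\<close>.
  A bump function \<open>u\<close> at \<open>x\<close> lies below \<open>g \<circ> F\<close>, but is mapped to 1, while \<open>g \<circ> F\<close> is not.\<close>

lemma mv_hom_evaluation_le:
  assumes P: "P \<subseteq> cube n" and Q: "Q \<subseteq> cube m"
    and \<alpha>: "\<alpha> \<in> mv_hom (restrict_mv n P) (restrict_mv m Q)"
    and q: "q \<in> Q" and F: "F \<in> McNaughton n"
  shows "F (\<lambda>i. if i < n then \<alpha> (term_fun P (Var i)) q else 0) \<le> \<alpha> (restrict F P) q"
proof (rule ccontr)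
  let ?A = "restrict_mv n P" and ?B = "restrict_mv m Q"
  let ?x = "\<lambda>i. if i < n then \<alpha> (term_fun P (Var i)) q else 0"
  let ?f = "restrict F P"
  let ?s = "\<alpha> ?f q"
  note clA = closed_ops_restrict_mv[OF P]
    and hom = hoop_homD[OF mv_hom_hoop_hom[OF \<alpha>]]
  have fC: "?f \<in> carrier ?A"
    using F by (auto simp: carrier_restrict_mv)
  have var: "term_fun P (Var i) \<in> carrier ?A" if "i < n" for i
    using that by (intro term_fun_restrict_mv[OF P]) simp
  have xC: "?x \<in> cube n"
    using restrict_mv_range[OF hom(3)[OF var] q Q] by (auto simp: cube_def space_def)
  have s: "?s \<in> {0..1}"
    using restrict_mv_range[OF hom(3)[OF fC] q Q] .
  assume "\<not> F ?x \<le> ?s"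
  then obtain r where r: "?s < of_rat r" "of_rat r < F ?x"
    using of_rat_dense[of ?s "F ?x"] by auto
  obtain a b :: int where ab: "r = Rat.Fract a b" "0 < b"
    by (cases r) auto
  have rab: "of_rat r = (of_int a / of_int b :: real)"
    using ab by (simp add: of_rat_rat)
  have contF: "continuous_on (cube n) F"
    using F by (rule McNaughtonE)
  obtain e where e: "\<And>i. i < n \<Longrightarrow> 0 < e i"
    "\<And>y. \<lbrakk>y \<in> cube n; \<And>i. i < n \<Longrightarrow> \<bar>y i - ?x i\<bar> < e i\<rbrakk> \<Longrightarrow> of_rat r < F y"
    using continuous_on_cube_box[OF contF xC r(2)] by blast
  obtain u where u: "PN n u" "u ?x = 1"
    "\<forall>y \<in> cube n. (\<exists>i < n. e i \<le> \<bar>y i - ?x i\<bar>) \<longrightarrow> u y = 0"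
    using PN_bump[of ?x n e, OF xC e(1)] by blast
  let ?ab = "(unit_vec b 0, 1 - a)"
  define g where "g z = clip (of_int b * z + 1 - of_int a)" for z :: real
  have g_aff: "clip (aff 1 ?ab x) = g (x 0)" for x
    by (simp add: aff_unit_vec g_def add_diff_eq)
  have g: "PN 1 (\<lambda>x. g (x 0))"
    using PN_clip_aff[of 1 ?ab] unfolding g_aff .
  define G where "G = (\<lambda>x \<in> P. g (?f x))"
  define W where "W = (\<lambda>x \<in> P. u x)"
  have G: "G \<in> carrier ?A" "\<alpha> G q = g ?s"
    using mv_hom_PN[OF P Q \<alpha> g, of "\<lambda>i. ?f"] fC q by (simp_all add: G_def)
  have guard: "(\<lambda>i. if i < n then term_fun P (Var i) x else 0) = x" if "x \<in> P" for x
    using that P by (auto simp: cube_def space_def fun_eq_iff)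
  have "(\<lambda>x \<in> P. u (\<lambda>i. if i < n then term_fun P (Var i) x else 0)) = W"
    unfolding W_def using guard by (intro restrict_ext) simp
  \<comment> \<open>\<open>W\<close> is \<open>u\<close> applied to the coordinate functions, so its
    image at \<open>q\<close> is \<open>u\<close> at the point whose coordinates are their
    images.\<close>
  then have W: "W \<in> carrier ?A" "\<alpha> W q = 1"
    using mv_hom_PN[OF P Q \<alpha> u(1), of "\<lambda>i. term_fun P (Var i)"] var q u(2) by simp_all
  \<comment> \<open>Outside the box \<open>W\<close> vanishes; inside it \<open>F\<close> exceeds
    the separating rational, so \<open>G\<close> has its maximal value 1.\<close>
  have le: "W y \<le> G y" if y: "y \<in> P" for y
  proof -
    have yC: "y \<in> cube n"
      using y P by blast
    show ?thesis
    proof (cases "\<exists>i < n. e i \<le> \<bar>y i - ?x i\<bar>")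
      case True
      then have "u y = 0"
        using u(3) yC by blast
      then show ?thesis
        using y by (simp add: W_def G_def g_def clip_def)
    next
      case False
      then have "of_rat r < F y"
        using e(2)[OF yC] by force
      then have "of_int a < of_int b * F y"
        using ab(2) unfolding rab by (simp add: field_simps)
      then have "g (F y) = 1"
        by (simp add: g_def clip_def)
      then show ?thesis
        using y PN_range[OF u(1) yC] by (simp add: W_def G_def)
    qed
  qed
  have one: "W \<rightharpoonup>\<^bsub>?A\<^esub> G = \<one>\<^bsub>?A\<^esub>"
    by (subst (1 2) restrict_mv_eq) (use le in \<open>auto simp: min_def intro!: restrict_ext\<close>)
  have "\<alpha> W \<rightharpoonup>\<^bsub>?B\<^esub> \<alpha> G = \<one>\<^bsub>?B\<^esub>"
    using hom(5)[OF W(1) G(1)] hom(2) unfolding one by simp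
  then have "(\<alpha> W \<rightharpoonup>\<^bsub>?B\<^esub> \<alpha> G) q = \<one>\<^bsub>?B\<^esub> q"
    by simp
  then have "min 1 (1 - \<alpha> W q + \<alpha> G q) = 1"
    using q by (subst (asm) (1 2) restrict_mv_eq) simp
  then have "1 \<le> g ?s"
    using W(2) G(2) by (simp add: min_def split: if_splits)
  moreover have "of_int b * ?s < of_int a"
    using r(1) ab(2) unfolding rab by (simp add: field_simps)
  then have "g ?s < 1"
    by (simp add: g_def clip_def)
  ultimately show False
    by simp
qed

text \<open>The reverse inequality is \<open>mv_hom_evaluation_le\<close> for \<open>1 - F\<close>,
  which the homomorphism respects because it preserves 0.\<close>

lemma mv_hom_evaluation:
  assumes P: "P \<subseteq> cube n" and Q: "Q \<subseteq> cube m"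
    and \<alpha>: "\<alpha> \<in> mv_hom (restrict_mv n P) (restrict_mv m Q)"
    and q: "q \<in> Q" and F: "F \<in> McNaughton n"
  shows "\<alpha> (restrict F P) q = F (\<lambda>i. if i < n then \<alpha> (term_fun P (Var i)) q else 0)"
proof -
  let ?A = "restrict_mv n P" and ?B = "restrict_mv m Q"
  let ?x = "\<lambda>i. if i < n then \<alpha> (term_fun P (Var i)) q else 0"
  note clA = closed_ops_restrict_mv[OF P]
    and hom = hoop_homD[OF mv_hom_hoop_hom[OF \<alpha>]]
  have var: "term_fun P (Var i) \<in> carrier ?A" if "i < n" for i
    using that by (intro term_fun_restrict_mv[OF P]) simp
  have xC: "?x \<in> cube n"
    using restrict_mv_range[OF hom(3)[OF var] q Q] by (auto simp: cube_def space_def)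
  have fC: "restrict F P \<in> carrier ?A"
    using F by (auto simp: carrier_restrict_mv)
  have Frange: "F x \<in> {0..1}" if "x \<in> cube n" for x
    by (rule McNaughtonE[OF F]) (use that in blast)
  have NM: "(\<lambda>x \<in> cube n. 1 - F x) \<in> McNaughton n"
  proof -
    have "(\<lambda>x \<in> cube n. F x \<rightharpoonup>\<^bsub>standard_mv\<^esub> (\<lambda>x \<in> cube n. 0) x) = (\<lambda>x \<in> cube n. 1 - F x)"
      using Frange by (intro restrict_ext) simp
    then show ?thesis
      using McNaughton_ops(2)[OF F zero_McNaughton] by simp
  qed
  have z: "mvzero ?A = restrict (\<lambda>x \<in> cube n. 0) P"
    using P by (simp add: restrict_mv_def Int_absorb1)
  note zC = zero_restrict_mv[OF P]
  have "restrict (\<lambda>x \<in> cube n. 1 - F x) P = restrict F P \<rightharpoonup>\<^bsub>?A\<^esub> mvzero ?A"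
    unfolding z using P Frange by (subst restrict_mv_eq) (auto simp: fun_eq_iff restrict_def)
  then have "\<alpha> (restrict (\<lambda>x \<in> cube n. 1 - F x) P) = \<alpha> (restrict F P) \<rightharpoonup>\<^bsub>?B\<^esub> \<alpha> (mvzero ?A)"
    using hom(5)[OF fC zC] by simp
  also have "\<alpha> (mvzero ?A) = (\<lambda>x \<in> Q. 0)"
    using \<alpha> by (simp add: mv_hom_def restrict_mv_def)
  finally have "\<alpha> (restrict (\<lambda>x \<in> cube n. 1 - F x) P) q = (\<alpha> (restrict F P) \<rightharpoonup>\<^bsub>?B\<^esub> (\<lambda>x \<in> Q. 0)) q"
    by (rule fun_cong)
  also have "\<dots> = min 1 (1 - \<alpha> (restrict F P) q)"
    using q by (subst restrict_mv_eq) simp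
  finally have "1 - F ?x \<le> min 1 (1 - \<alpha> (restrict F P) q)"
    using mv_hom_evaluation_le[OF P Q \<alpha> q NM] xC by simp
  then show ?thesis
    using mv_hom_evaluation_le[OF P Q \<alpha> q F] by simp
qed

lemma pos_hoop_subset: "P \<subseteq> cube n \<Longrightarrow> carrier (pos_hoop n P) \<subseteq> carrier (restrict_mv n P)"
  using term_fun_restrict_mv by (auto simp: pos_hoop_def)

text \<open>The points at which a homomorphism evaluates are determined by the images of the
  coordinate functions, and these are positive.\<close>

lemma mv_hom_faithful:
  assumes P: "P \<subseteq> cube n" and Q: "Q \<subseteq> cube m"
    and \<alpha>: "\<alpha> \<in> mv_hom (restrict_mv n P) (restrict_mv m Q)"
    and \<beta>: "\<beta> \<in> mv_hom (restrict_mv n P) (restrict_mv m Q)"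
    and eq: "\<And>f. f \<in> carrier (pos_hoop n P) \<Longrightarrow> \<alpha> f = \<beta> f"
  shows "\<alpha> = \<beta>"
proof (rule extensionalityI)
  note homA = hoop_homD[OF mv_hom_hoop_hom[OF \<alpha>]] and homB = hoop_homD[OF mv_hom_hoop_hom[OF \<beta>]]
  show "\<alpha> \<in> extensional (carrier (restrict_mv n P))" "\<beta> \<in> extensional (carrier (restrict_mv n P))"
    by (rule homA(1), rule homB(1))
  fix f assume f: "f \<in> carrier (restrict_mv n P)"
  then obtain F where F: "F \<in> McNaughton n" "f = restrict F P"
    unfolding carrier_restrict_mv by blast
  have "term_fun P (Var i) \<in> carrier (pos_hoop n P)" if "i < n" for i
    using that by (auto simp: pos_hoop_def)
  then have "(\<lambda>i. if i < n then \<alpha> (term_fun P (Var i)) q else 0) = (\<lambda>i. if i < n then \<beta> (term_fun P (Var i)) q else 0)" for q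
    using eq by auto
  then have "\<alpha> f q = \<beta> f q" if "q \<in> Q" for q
    unfolding F(2) mv_hom_evaluation[OF P Q \<alpha> that F(1)] mv_hom_evaluation[OF P Q \<beta> that F(1)] by simp
  then show "\<alpha> f = \<beta> f"
    using restrict_mv_extensional[OF homA(3)[OF f]] restrict_mv_extensional[OF homB(3)[OF f]]
    by (intro extensionalityI[of _ Q])
qed

lemma hoop_hom_extends:
  assumes P: "pointed_rational_polyhedron n P" and Q: "Q \<subseteq> cube m"
    and \<beta>: "\<beta> \<in> hoop_hom (pos_hoop n P) (pos_hoop m Q)"
  obtains \<alpha> where "\<alpha> \<in> mv_hom (restrict_mv n P) (restrict_mv m Q)"
    "\<And>f. f \<in> carrier (pos_hoop n P) \<Longrightarrow> \<alpha> f = \<beta> f"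
proof -
  let ?A = "restrict_mv n P" and ?B = "restrict_mv m Q"
  have PC: "P \<subseteq> cube n"
    using P by (simp add: pointed_rational_polyhedron_def)
  note clA = closed_ops_restrict_mv[OF PC] and hom = hoop_homD[OF \<beta>]
  obtain t where t: "tvars t \<subseteq> {..<n}" "P = {x \<in> cube n. ev x t = 1}"
    using P by (rule pointed_polyhedron_positive_term)
  have var: "term_fun P (Var i) \<in> carrier (pos_hoop n P)" if "i < n" for i
    using that by (auto simp: pos_hoop_def)
  have "\<forall>i \<in> {..<n}. \<exists>s. tvars s \<subseteq> {..<m} \<and> \<beta> (term_fun P (Var i)) = term_fun Q s"
    using hom(3)[OF var] by (auto simp: pos_hoop_def)
  from bchoice[OF this] obtain s where s: "\<And>i. i < n \<Longrightarrow> tvars (s i) \<subseteq> {..<m}"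
    "\<And>i. i < n \<Longrightarrow> \<beta> (term_fun P (Var i)) = term_fun Q (s i)"
    by auto
  define k where "k y i = (if i < n then ev y (s i) else 0)" for y i
  have kC: "k y \<in> cube n" if "y \<in> cube m" for y
    using ev_range[OF that s(1)] by (auto simp: cube_def space_def k_def)
  have \<beta>_term: "\<beta> (term_fun P r) = (\<lambda>q \<in> Q. ev (k q) r)" if r: "tvars r \<subseteq> {..<n}" for r
  proof -
    have "\<beta> (term_fun P r) = \<beta> (teval (pos_hoop n P) (\<lambda>i. term_fun P (Var i)) r)"
      by (simp add: pos_hoop_def teval_term_fun)
    also have "\<dots> = teval (pos_hoop m Q) (\<lambda>i. \<beta> (term_fun P (Var i))) r"
      using r var by (intro hoop_hom_teval[OF \<beta> closed_ops_pos_hoop]) blast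
    also have "\<dots> = teval (pos_hoop m Q) (\<lambda>i. term_fun Q (s i)) r"
      using r s(2) by (intro teval_cong) blast
    also have "\<dots> = (\<lambda>q \<in> Q. ev (\<lambda>i. term_fun Q (s i) q) r)"
      unfolding pos_hoop_def by (rule teval_pointwise) simp
    also have "\<dots> = (\<lambda>q \<in> Q. ev (k q) r)"
      using r by (intro restrict_ext teval_cong) (auto simp: k_def)
    finally show ?thesis .
  qed
  \<comment> \<open>\<open>P\<close> is the set where the positive term \<open>t\<close> equals 1,
    and \<beta> preserves the equation \<open>t = 1\<close>; hence it holds at
    \<open>k q\<close>.\<close>
  have kP: "k q \<in> P" if q: "q \<in> Q" for q
  proof -
    have "term_fun P t = term_fun P One"
      using t(2) by (simp add: term_fun_eq_iff)
    then have "\<beta> (term_fun P t) q = \<beta> (term_fun P One) q"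
      by simp
    then have "ev (k q) t = 1"
      using q by (simp add: \<beta>_term t(1))
    then show ?thesis
      using t(2) kC q Q by blast
  qed
  define \<alpha> where "\<alpha> = (\<lambda>f \<in> carrier ?A. \<lambda>q \<in> Q. f (k q))"
  have \<alpha>C: "(\<lambda>q \<in> Q. f (k q)) \<in> carrier ?B" if fA: "f \<in> carrier ?A" for f
  proof -
    obtain F where F: "F \<in> McNaughton n" "f = restrict F P"
      using fA unfolding carrier_restrict_mv by blast
    have "(\<lambda>y \<in> cube m. k y i) \<in> McNaughton m" if "i < n" for i
      using ev_McNaughton[OF s(1)[OF that]] that by (simp add: k_def)
    then have "(\<lambda>y \<in> cube m. F (k y)) \<in> McNaughton m"
      by (intro McNaughton_comp[OF F(1)] kC)
    moreover have "(\<lambda>q \<in> Q. f (k q)) = restrict (\<lambda>y \<in> cube m. F (k y)) Q"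
      using kP Q by (auto simp: F(2) fun_eq_iff restrict_def)
    ultimately show ?thesis
      unfolding carrier_restrict_mv by (intro image_eqI)
  qed
  have "\<alpha> \<in> hoop_hom ?A ?B"
  proof (rule hoop_homI)
    show "\<alpha> \<in> extensional (carrier ?A)"
      by (simp add: \<alpha>_def)
    show "\<alpha> \<one>\<^bsub>?A\<^esub> = \<one>\<^bsub>?B\<^esub>"
      using closed_opsD(1)[OF clA] kP by (auto simp: \<alpha>_def restrict_mv_def fun_eq_iff restrict_def)
    show "\<alpha> f \<in> carrier ?B" if "f \<in> carrier ?A" for f
      using that \<alpha>C by (simp add: \<alpha>_def)
    fix f g assume fg: "f \<in> carrier ?A" "g \<in> carrier ?A"
    note C = closed_opsD[OF clA]
    have ops: "f \<otimes>\<^bsub>?A\<^esub> g = (\<lambda>x \<in> P. max 0 (f x + g x - 1))" "f \<rightharpoonup>\<^bsub>?A\<^esub> g = (\<lambda>x \<in> P. min 1 (1 - f x + g x))"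
      "f \<curlywedge>\<^bsub>?A\<^esub> g = (\<lambda>x \<in> P. min (f x) (g x))" "f \<curlyvee>\<^bsub>?A\<^esub> g = (\<lambda>x \<in> P. max (f x) (g x))"
      "h \<otimes>\<^bsub>?B\<^esub> h' = (\<lambda>x \<in> Q. max 0 (h x + h' x - 1))" "h \<rightharpoonup>\<^bsub>?B\<^esub> h' = (\<lambda>x \<in> Q. min 1 (1 - h x + h' x))"
      "h \<curlywedge>\<^bsub>?B\<^esub> h' = (\<lambda>x \<in> Q. min (h x) (h' x))" "h \<curlyvee>\<^bsub>?B\<^esub> h' = (\<lambda>x \<in> Q. max (h x) (h' x))" for h h'
      by (simp_all add: restrict_mv_def)
    show "\<alpha> (f \<otimes>\<^bsub>?A\<^esub> g) = \<alpha> f \<otimes>\<^bsub>?B\<^esub> \<alpha> g" "\<alpha> (f \<rightharpoonup>\<^bsub>?A\<^esub> g) = \<alpha> f \<rightharpoonup>\<^bsub>?B\<^esub> \<alpha> g"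
      "\<alpha> (f \<curlywedge>\<^bsub>?A\<^esub> g) = \<alpha> f \<curlywedge>\<^bsub>?B\<^esub> \<alpha> g" "\<alpha> (f \<curlyvee>\<^bsub>?A\<^esub> g) = \<alpha> f \<curlyvee>\<^bsub>?B\<^esub> \<alpha> g"
      using C(2)[OF fg] C(3)[OF fg] C(4)[OF fg] C(5)[OF fg] fg kP unfolding \<alpha>_def ops
      by (auto intro!: restrict_ext)
  qed
  moreover have "\<alpha> (mvzero ?A) = mvzero ?B"
  proof -
    have "mvzero ?A \<in> carrier ?A"
      by (rule zero_restrict_mv[OF PC])
    then have "\<alpha> (mvzero ?A) = (\<lambda>q \<in> Q. mvzero ?A (k q))"
      by (simp add: \<alpha>_def)
    also have "\<dots> = (\<lambda>q \<in> Q. 0)"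
      using kP by (intro restrict_ext) (simp add: restrict_mv_def)
    finally show ?thesis
      by (simp add: restrict_mv_def)
  qed
  ultimately have "\<alpha> \<in> mv_hom ?A ?B"
    by (simp add: mv_hom_def)
  moreover have "\<alpha> f = \<beta> f" if fP: "f \<in> carrier (pos_hoop n P)" for f
  proof -
    obtain r where r: "tvars r \<subseteq> {..<n}" "f = term_fun P r"
      using fP by (auto simp: pos_hoop_def)
    have "f \<in> carrier ?A"
      using fP pos_hoop_subset[OF PC] by blast
    then show ?thesis
      using kP unfolding \<alpha>_def r(2) \<beta>_term[OF r(1)] by (auto intro!: restrict_ext)
  qed
  ultimately show ?thesis
    using that by blast
qed

text \<open>By \<open>restrict_mv_inject\<close> the polyhedra quantified in
  \<open>positive_hom\<close> are the given ones, and restrictions of positive functions form the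
  carrier of \<open>pos_hoop\<close>.\<close>

lemma positive_hom_iff:
  assumes P: "pointed_rational_polyhedron n P" and Q: "pointed_rational_polyhedron m Q"
  shows "\<alpha> \<in> positive_hom (restrict_mv n P) (restrict_mv m Q) \<longleftrightarrow>
    \<alpha> \<in> mv_hom (restrict_mv n P) (restrict_mv m Q) \<and> \<alpha> ` carrier (pos_hoop n P) \<subseteq> carrier (pos_hoop m Q)"
proof -
  have C: "P \<subseteq> cube n" "Q \<subseteq> cube m"
    using P Q by (simp_all add: pointed_rational_polyhedron_def)
  have "\<alpha> ` carrier (pos_hoop n P) \<subseteq> carrier (pos_hoop m Q) \<longleftrightarrow>
    (\<forall>h \<in> positive n. \<exists>k \<in> positive m. \<alpha> (restrict h P) = restrict k Q)"
    unfolding restrict_positive[OF C(1), symmetric] restrict_positive[OF C(2), symmetric]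
    by (auto simp: image_iff subset_eq)
  moreover have "(\<exists>n' P' m' Q'. pointed_rational_polyhedron n' P' \<and> restrict_mv n P = restrict_mv n' P' \<and>
     pointed_rational_polyhedron m' Q' \<and> restrict_mv m Q = restrict_mv m' Q' \<and>
     (\<forall>h \<in> positive n'. \<exists>k \<in> positive m'. \<alpha> (restrict h P') = restrict k Q')) \<longleftrightarrow>
    (\<forall>h \<in> positive n. \<exists>k \<in> positive m. \<alpha> (restrict h P) = restrict k Q)"
    using restrict_mv_inject P Q by metis
  ultimately show ?thesis
    unfolding positive_hom_def by simp
qed

section \<open>The equivalence\<close>

lemma cat_functor_id: "category C \<Longrightarrow> cat_functor C C id_ftor"
  by (simp add: cat_functor_def cat_functor_axioms_def id_ftor_def)

lemma cat_functor_comp: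
  assumes "cat_functor C D F" "cat_functor D E G"
  shows "cat_functor C E (comp_ftor G F)"
proof -
  interpret F: cat_functor C D F by fact
  interpret G: cat_functor D E G by fact
  show ?thesis
    by unfold_locales
      (simp_all add: comp_ftor_def F.on_obj_closed F.on_arr_closed F.on_arr_Ident F.on_arr_Comp
        G.on_obj_closed G.on_arr_closed G.on_arr_Ident G.on_arr_Comp)
qed

locale fully_faithful_surjective = cat_functor D C G
  for D :: "('p, 'n) cat" and C :: "('o, 'm) cat" and G +
  assumes full: "\<lbrakk>X \<in> Obj D; Y \<in> Obj D; f \<in> Hom C (on_obj G X) (on_obj G Y)\<rbrakk>
      \<Longrightarrow> \<exists>g \<in> Hom D X Y. on_arr G X Y g = f"
    and faithful: "\<lbrakk>X \<in> Obj D; Y \<in> Obj D; g \<in> Hom D X Y; g' \<in> Hom D X Y; on_arr G X Y g = on_arr G X Y g'\<rbrakk>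
      \<Longrightarrow> g = g'"
    and surjective: "A \<in> Obj C \<Longrightarrow> \<exists>X \<in> Obj D. \<exists>u. is_iso C A (on_obj G X) u"
begin

definition pre :: "'o \<Rightarrow> 'p" where
  "pre A = (SOME X. X \<in> Obj D \<and> (\<exists>u. is_iso C A (on_obj G X) u))"

abbreviation T :: "'o \<Rightarrow> 'o" where
  "T A \<equiv> on_obj G (pre A)"

definition to_iso :: "'o \<Rightarrow> 'm" where
  "to_iso A = (SOME u. is_iso C A (T A) u)"

definition from_iso :: "'o \<Rightarrow> 'm" where
  "from_iso A = (SOME v. v \<in> Hom C (T A) A \<and> Comp C A (T A) A v (to_iso A) = Ident C A \<and>
     Comp C (T A) A (T A) (to_iso A) v = Ident C (T A))"

definition lift_arr :: "'p \<Rightarrow> 'p \<Rightarrow> 'm \<Rightarrow> 'n" where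
  "lift_arr X Y f = (SOME g. g \<in> Hom D X Y \<and> on_arr G X Y g = f)"

lemma pre_closed: "A \<in> Obj C \<Longrightarrow> pre A \<in> Obj D"
  and to_iso_iso: "A \<in> Obj C \<Longrightarrow> is_iso C A (T A) (to_iso A)"
proof -
  assume "A \<in> Obj C"
  then have "\<exists>X. X \<in> Obj D \<and> (\<exists>u. is_iso C A (on_obj G X) u)"
    using surjective by blast
  then have *: "pre A \<in> Obj D \<and> (\<exists>u. is_iso C A (T A) u)"
    unfolding pre_def by (rule someI_ex)
  then show "pre A \<in> Obj D"
    by simp
  show "is_iso C A (T A) (to_iso A)"
    using conjunct2[OF *] unfolding to_iso_def by (rule someI_ex)
qed

lemma T_closed: "A \<in> Obj C \<Longrightarrow> T A \<in> Obj C"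
  by (intro on_obj_closed pre_closed)

lemma to_iso_Hom: "A \<in> Obj C \<Longrightarrow> to_iso A \<in> Hom C A (T A)"
  using to_iso_iso by (simp add: is_iso_def)

lemma from_iso:
  assumes "A \<in> Obj C"
  shows "from_iso A \<in> Hom C (T A) A" "Comp C A (T A) A (from_iso A) (to_iso A) = Ident C A"
    "Comp C (T A) A (T A) (to_iso A) (from_iso A) = Ident C (T A)"
proof -
  have "\<exists>v. v \<in> Hom C (T A) A \<and> Comp C A (T A) A v (to_iso A) = Ident C A \<and>
     Comp C (T A) A (T A) (to_iso A) v = Ident C (T A)"
    using to_iso_iso[OF assms] unfolding is_iso_def by blast
  then have "from_iso A \<in> Hom C (T A) A \<and> Comp C A (T A) A (from_iso A) (to_iso A) = Ident C A \<and>
     Comp C (T A) A (T A) (to_iso A) (from_iso A) = Ident C (T A)"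
    unfolding from_iso_def by (rule someI_ex)
  then show "from_iso A \<in> Hom C (T A) A" "Comp C A (T A) A (from_iso A) (to_iso A) = Ident C A"
    "Comp C (T A) A (T A) (to_iso A) (from_iso A) = Ident C (T A)"
    by blast+
qed

lemma lift_arr:
  assumes "X \<in> Obj D" "Y \<in> Obj D" "f \<in> Hom C (on_obj G X) (on_obj G Y)"
  shows "lift_arr X Y f \<in> Hom D X Y" "on_arr G X Y (lift_arr X Y f) = f"
proof -
  have "\<exists>g. g \<in> Hom D X Y \<and> on_arr G X Y g = f"
    using full[OF assms] by blast
  then have "lift_arr X Y f \<in> Hom D X Y \<and> on_arr G X Y (lift_arr X Y f) = f"
    unfolding lift_arr_def by (rule someI_ex)
  then show "lift_arr X Y f \<in> Hom D X Y" "on_arr G X Y (lift_arr X Y f) = f"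
    by blast+
qed

text \<open>What \<open>G\<close> must make of the image of \<open>f\<close> under the
  quasi-inverse. Functoriality and naturality are checked for these arrows in \<open>C\<close> and
  then reflected along the faithful \<open>G\<close>.\<close>

definition conj_arr :: "'o \<Rightarrow> 'o \<Rightarrow> 'm \<Rightarrow> 'm" where
  "conj_arr A B f = Comp C (T A) A (T B) (Comp C A B (T B) (to_iso B) f) (from_iso A)"

lemma conj_arr_Hom:
  assumes "A \<in> Obj C" "B \<in> Obj C" "f \<in> Hom C A B"
  shows "conj_arr A B f \<in> Hom C (T A) (T B)"
  unfolding conj_arr_def using assms
  by (intro D.Comp_in_Hom[of _ A] D.Comp_in_Hom[of A B]) (auto simp: T_closed to_iso_Hom from_iso)

lemma conj_arr_to_iso:
  assumes "A \<in> Obj C" "B \<in> Obj C" "f \<in> Hom C A B"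
  shows "Comp C A (T A) (T B) (conj_arr A B f) (to_iso A) = Comp C A B (T B) (to_iso B) f"
proof -
  have uf: "Comp C A B (T B) (to_iso B) f \<in> Hom C A (T B)"
    using assms by (intro D.Comp_in_Hom) (auto simp: T_closed to_iso_Hom)
  have "Comp C A (T A) (T B) (conj_arr A B f) (to_iso A)
      = Comp C A A (T B) (Comp C A B (T B) (to_iso B) f) (Comp C A (T A) A (from_iso A) (to_iso A))"
    unfolding conj_arr_def using assms uf
    by (intro D.Comp_assoc[symmetric]) (auto simp: T_closed to_iso_Hom from_iso)
  then show ?thesis
    using assms uf by (simp add: from_iso D.Comp_Ident_right T_closed)
qed

lemma from_iso_conj_arr:
  assumes "A \<in> Obj C" "B \<in> Obj C" "f \<in> Hom C A B"
  shows "Comp C (T A) (T B) B (from_iso B) (conj_arr A B f) = Comp C (T A) A B f (from_iso A)"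
proof -
  have uf: "Comp C A B (T B) (to_iso B) f \<in> Hom C A (T B)"
    using assms by (intro D.Comp_in_Hom) (auto simp: T_closed to_iso_Hom)
  have "Comp C (T A) (T B) B (from_iso B) (conj_arr A B f)
      = Comp C (T A) A B (Comp C A (T B) B (from_iso B) (Comp C A B (T B) (to_iso B) f)) (from_iso A)"
    unfolding conj_arr_def using assms uf
    by (intro D.Comp_assoc) (auto simp: T_closed to_iso_Hom from_iso)
  also have "Comp C A (T B) B (from_iso B) (Comp C A B (T B) (to_iso B) f)
      = Comp C A B B (Comp C B (T B) B (from_iso B) (to_iso B)) f"
    using assms by (intro D.Comp_assoc) (auto simp: T_closed to_iso_Hom from_iso)
  finally show ?thesis
    using assms by (simp add: from_iso D.Comp_Ident_left)
qed

lemma conj_arr_Ident: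
  assumes "A \<in> Obj C"
  shows "conj_arr A A (Ident C A) = Ident C (T A)"
  using assms by (simp add: conj_arr_def D.Comp_Ident_right T_closed to_iso_Hom from_iso)

lemma conj_arr_Comp:
  assumes A: "A \<in> Obj C" "B \<in> Obj C" "E \<in> Obj C" "f \<in> Hom C A B" "g \<in> Hom C B E"
  shows "conj_arr A E (Comp C A B E g f) = Comp C (T A) (T B) (T E) (conj_arr B E g) (conj_arr A B f)"
proof -
  note mem = T_closed to_iso_Hom from_iso(1) D.Comp_in_Hom
  have uf: "Comp C A B (T B) (to_iso B) f \<in> Hom C A (T B)"
    using assms by (intro mem)
  have "Comp C (T A) (T B) (T E) (conj_arr B E g) (conj_arr A B f)
      = Comp C (T A) A (T E) (Comp C A (T B) (T E) (conj_arr B E g) (Comp C A B (T B) (to_iso B) f)) (from_iso A)"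
    unfolding conj_arr_def[of A B] using assms uf
    by (intro D.Comp_assoc) (auto simp: T_closed from_iso conj_arr_Hom)
  also have "Comp C A (T B) (T E) (conj_arr B E g) (Comp C A B (T B) (to_iso B) f)
      = Comp C A B (T E) (Comp C B (T B) (T E) (conj_arr B E g) (to_iso B)) f"
    using assms by (intro D.Comp_assoc) (auto simp: T_closed to_iso_Hom conj_arr_Hom)
  also have "\<dots> = Comp C A B (T E) (Comp C B E (T E) (to_iso E) g) f"
    using assms by (simp add: conj_arr_to_iso)
  also have "\<dots> = Comp C A E (T E) (to_iso E) (Comp C A B E g f)"
    using assms by (intro D.Comp_assoc[symmetric]) (auto simp: T_closed to_iso_Hom)
  finally show ?thesis
    by (simp add: conj_arr_def[of A E])
qed

definition F :: "('o, 'm, 'p, 'n) ftor" where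
  "F = \<lparr>on_obj = pre, on_arr = (\<lambda>A B f. lift_arr (pre A) (pre B) (conj_arr A B f))\<rparr>"

lemma on_obj_F [simp]: "on_obj F A = pre A"
  by (simp add: F_def)

lemma on_arr_F:
  assumes "A \<in> Obj C" "B \<in> Obj C" "f \<in> Hom C A B"
  shows "on_arr F A B f \<in> Hom D (pre A) (pre B)"
    "on_arr G (pre A) (pre B) (on_arr F A B f) = conj_arr A B f"
  using lift_arr[OF pre_closed pre_closed conj_arr_Hom] assms by (simp_all add: F_def)

lemma cat_functor_F: "cat_functor C D F"
proof (intro cat_functor.intro cat_functor_axioms.intro)
  show "category C" "category D"
    by unfold_locales
  show "on_obj F A \<in> Obj D" if "A \<in> Obj C" for A
    using that by (simp add: pre_closed)
  show "on_arr F A B f \<in> Hom D (on_obj F A) (on_obj F B)" if "A \<in> Obj C" "B \<in> Obj C" "f \<in> Hom C A B" for A B f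
    using on_arr_F[OF that] by simp
  show "on_arr F A A (Ident C A) = Ident D (on_obj F A)" if A: "A \<in> Obj C" for A
  proof -
    note i = D.Ident_in_Hom[OF A]
    show ?thesis
      using on_arr_F[OF A A i] A pre_closed[OF A]
      by (intro faithful[of "pre A" "pre A"]) (simp_all add: C.Ident_in_Hom conj_arr_Ident on_arr_Ident)
  qed
  fix A B E f g
  assume *: "A \<in> Obj C" "B \<in> Obj C" "E \<in> Obj C" "f \<in> Hom C A B" "g \<in> Hom C B E"
  note gf = D.Comp_in_Hom[OF *]
  note p = pre_closed[OF *(1)] pre_closed[OF *(2)] pre_closed[OF *(3)]
  note Ff = on_arr_F[OF *(1,2,4)] and Fg = on_arr_F[OF *(2,3,5)] and Fgf = on_arr_F[OF *(1,3) gf]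
  have "on_arr F A E (Comp C A B E g f) = Comp D (pre A) (pre B) (pre E) (on_arr F B E g) (on_arr F A B f)"
  proof (rule faithful[OF p(1,3) Fgf(1)])
    show "Comp D (pre A) (pre B) (pre E) (on_arr F B E g) (on_arr F A B f) \<in> Hom D (pre A) (pre E)"
      using p Ff Fg by (intro C.Comp_in_Hom)
    show "on_arr G (pre A) (pre E) (on_arr F A E (Comp C A B E g f)) =
      on_arr G (pre A) (pre E) (Comp D (pre A) (pre B) (pre E) (on_arr F B E g) (on_arr F A B f))"
      using on_arr_Comp[OF p Ff(1) Fg(1)] Ff(2) Fg(2) Fgf(2) conj_arr_Comp[OF *] by simp
  qed
  then show "on_arr F A E (Comp C A B E g f) =
    Comp D (on_obj F A) (on_obj F B) (on_obj F E) (on_arr F B E g) (on_arr F A B f)"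
    by simp
qed

lemma unit_natural_iso: "natural_iso C C id_ftor (comp_ftor G F) to_iso"
proof (intro natural_iso.intro natural_iso_axioms.intro)
  show "cat_functor C C id_ftor"
    by (rule cat_functor_id) unfold_locales
  show "cat_functor C C (comp_ftor G F)"
    by (rule cat_functor_comp[OF cat_functor_F]) unfold_locales
  show "is_iso C (on_obj id_ftor A) (on_obj (comp_ftor G F) A) (to_iso A)" if "A \<in> Obj C" for A
    using to_iso_iso[OF that] by (simp add: id_ftor_def comp_ftor_def)
  fix A B f assume *: "A \<in> Obj C" "B \<in> Obj C" "f \<in> Hom C A B"
  show "Comp C (on_obj id_ftor A) (on_obj id_ftor B) (on_obj (comp_ftor G F) B) (to_iso B) (on_arr id_ftor A B f) =
    Comp C (on_obj id_ftor A) (on_obj (comp_ftor G F) A) (on_obj (comp_ftor G F) B)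
      (on_arr (comp_ftor G F) A B f) (to_iso A)"
    using conj_arr_to_iso[OF *] on_arr_F(2)[OF *] by (simp add: id_ftor_def comp_ftor_def)
qed

definition counit :: "'p \<Rightarrow> 'n" where
  "counit X = lift_arr (pre (on_obj G X)) X (from_iso (on_obj G X))"

lemma counit_natural_iso: "natural_iso D D (comp_ftor F G) id_ftor counit"
proof (intro natural_iso.intro natural_iso_axioms.intro)
  show "cat_functor D D id_ftor"
    by (rule cat_functor_id) unfold_locales
  show "cat_functor D D (comp_ftor F G)"
    by (rule cat_functor_comp[OF _ cat_functor_F]) unfold_locales
  have counit: "counit X \<in> Hom D (pre (on_obj G X)) X"
    "on_arr G (pre (on_obj G X)) X (counit X) = from_iso (on_obj G X)" if X: "X \<in> Obj D" for X
    unfolding counit_def using X on_obj_closed[OF X] by (auto intro!: lift_arr pre_closed from_iso)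
  show "is_iso D (on_obj (comp_ftor F G) X) (on_obj id_ftor X) (counit X)" if X: "X \<in> Obj D" for X
  proof -
    let ?A = "on_obj G X"
    let ?Y = "pre ?A"
    have A: "?A \<in> Obj C" and Y: "?Y \<in> Obj D"
      using on_obj_closed[OF X] pre_closed by auto
    \<comment> \<open>The inverse lifts the opposite isomorphism; both composites are identities
      because their images under \<open>G\<close> are.\<close>
    let ?g = "lift_arr X ?Y (to_iso ?A)"
    have g: "?g \<in> Hom D X ?Y" "on_arr G X ?Y ?g = to_iso ?A"
      using lift_arr[OF X Y] to_iso_Hom[OF A] by auto
    have "Comp D ?Y X ?Y ?g (counit X) = Ident D ?Y"
      using X Y g counit[OF X]
      by (intro faithful[OF Y Y])
        (simp_all add: C.Comp_in_Hom C.Ident_in_Hom on_arr_Comp on_arr_Ident from_iso[OF A])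
    moreover have "Comp D X ?Y X (counit X) ?g = Ident D X"
      using X Y g counit[OF X]
      by (intro faithful[OF X X])
        (simp_all add: C.Comp_in_Hom C.Ident_in_Hom on_arr_Comp on_arr_Ident from_iso[OF A])
    ultimately show ?thesis
      using g(1) counit(1)[OF X] by (auto simp: is_iso_def comp_ftor_def id_ftor_def)
  qed
  fix X Y f assume *: "X \<in> Obj D" "Y \<in> Obj D" "f \<in> Hom D X Y"
  let ?A = "on_obj G X" and ?B = "on_obj G Y"
  have A: "?A \<in> Obj C" "?B \<in> Obj C" and Gf: "on_arr G X Y f \<in> Hom C ?A ?B"
    using * by (auto simp: on_obj_closed on_arr_closed)
  note p = pre_closed[OF A(1)] pre_closed[OF A(2)]
  note FG = on_arr_F[OF A Gf]
  have "Comp D (pre ?A) (pre ?B) Y (counit Y) (on_arr F ?A ?B (on_arr G X Y f)) = Comp D (pre ?A) X Y f (counit X)"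
  proof (rule faithful[OF p(1) *(2)])
    show "Comp D (pre ?A) (pre ?B) Y (counit Y) (on_arr F ?A ?B (on_arr G X Y f)) \<in> Hom D (pre ?A) Y"
      using p * FG(1) counit(1)[OF *(2)] by (intro C.Comp_in_Hom)
    show "Comp D (pre ?A) X Y f (counit X) \<in> Hom D (pre ?A) Y"
      using p * counit(1)[OF *(1)] by (intro C.Comp_in_Hom)
    show "on_arr G (pre ?A) Y (Comp D (pre ?A) (pre ?B) Y (counit Y) (on_arr F ?A ?B (on_arr G X Y f))) =
      on_arr G (pre ?A) Y (Comp D (pre ?A) X Y f (counit X))"
      using on_arr_Comp[OF p *(2) FG(1) counit(1)[OF *(2)]] on_arr_Comp[OF p(1) *(1,2) counit(1)[OF *(1)] *(3)]
      by (simp add: FG(2) counit(2) * from_iso_conj_arr[OF A Gf])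
  qed
  then show "Comp D (on_obj (comp_ftor F G) X) (on_obj (comp_ftor F G) Y) (on_obj id_ftor Y) (counit Y)
      (on_arr (comp_ftor F G) X Y f) =
    Comp D (on_obj (comp_ftor F G) X) (on_obj id_ftor X) (on_obj id_ftor Y) (on_arr id_ftor X Y f) (counit X)"
    by (simp add: comp_ftor_def id_ftor_def)
qed

lemma equivalent: "categorically_equivalent C D"
proof -
  have "category C" "category D" "cat_functor D C G"
    by unfold_locales
  then show ?thesis
    unfolding categorically_equivalent_def
    using cat_functor_F unit_natural_iso counit_natural_iso by blast
qed

end

section \<open>The two categories\<close>

lemma concrete_category:
  fixes Ob :: "('a, 'c) hoop_scheme set"
  assumes cl: "\<And>A. A \<in> Ob \<Longrightarrow> closed_ops A"
    and sub: "\<And>A B. H A B \<subseteq> hoop_hom A B"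
    and id: "\<And>A. A \<in> Ob \<Longrightarrow> (\<lambda>x \<in> carrier A. x) \<in> H A A"
    and comp: "\<And>A B C f g. \<lbrakk>A \<in> Ob; B \<in> Ob; C \<in> Ob; f \<in> H A B; g \<in> H B C\<rbrakk>
      \<Longrightarrow> compose (carrier A) g f \<in> H A C"
  shows "category \<lparr>Obj = Ob, Hom = H, Ident = (\<lambda>A. \<lambda>x \<in> carrier A. x),
    Comp = (\<lambda>A B C g f. compose (carrier A) g f)\<rparr>"
proof -
  have h: "f \<in> extensional (carrier A)" "\<And>x. x \<in> carrier A \<Longrightarrow> f x \<in> carrier B" if "f \<in> H A B" for f A B
    using hoop_homD(1,3)[of f A B] sub that by blast+
  show ?thesis
  proof (unfold_locales, simp_all only: cat.select_convs)
    fix X Y f assume f: "f \<in> H X Y"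
    show "compose (carrier X) (\<lambda>x \<in> carrier Y. x) f = f"
      using h[OF f] by (intro extensionalityI[of _ "carrier X"]) (auto simp: compose_def)
    show "compose (carrier X) f (\<lambda>x \<in> carrier X. x) = f"
      using h[OF f] by (intro extensionalityI[of _ "carrier X"]) (auto simp: compose_def)
  next
    fix W X Y Z f g k assume "f \<in> H W X" "g \<in> H X Y" "k \<in> H Y Z"
    then show "compose (carrier W) k (compose (carrier W) g f) = compose (carrier W) (compose (carrier X) k g) f"
      using h(2)[of f W X] by (auto simp: compose_def intro!: restrict_ext)
  qed (use id comp in blast)+
qed

lemma category_WH_fp: "category WH_fp"
  unfolding WH_fp_def
  by (rule concrete_category)
    (auto intro: wajsberg_hoop.closed_ops hoop_hom_id hoop_hom_comp)

lemma mv_hom_comp: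
  assumes "f \<in> mv_hom A B" "g \<in> mv_hom B C" "closed_ops A" "mvzero A \<in> carrier A"
  shows "compose (carrier A) g f \<in> mv_hom A C"
proof -
  have "compose (carrier A) g f (mvzero A) = mvzero C"
    using assms by (simp add: mv_hom_def compose_def)
  moreover have "compose (carrier A) g f \<in> hoop_hom A C"
    using assms(1-3) by (intro hoop_hom_comp[of _ _ B]) (simp_all add: mv_hom_def)
  ultimately show ?thesis
    by (simp add: mv_hom_def)
qed

lemma positive_mvE:
  assumes "positive_mv M"
  obtains n P where "pointed_rational_polyhedron n P" "P \<subseteq> cube n" "M = restrict_mv n P"
  using assms unfolding positive_mv_def pointed_rational_polyhedron_def by blast

lemma category_MV_pos: "category MV_pos"
  unfolding MV_pos_def
proof (rule concrete_category; (unfold mem_Collect_eq)?)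
  fix M assume "positive_mv M"
  then obtain n P where P: "pointed_rational_polyhedron n P" "P \<subseteq> cube n" "M = restrict_mv n P"
    by (rule positive_mvE)
  show cl: "closed_ops M"
    using closed_ops_restrict_mv P by simp
  have "(\<lambda>x \<in> carrier M. x) \<in> mv_hom M M"
    using hoop_hom_id[OF cl] zero_restrict_mv[OF P(2)] by (simp add: mv_hom_def P(3))
  then show "(\<lambda>x \<in> carrier M. x) \<in> positive_hom M M"
    unfolding P(3) positive_hom_iff[OF P(1,1)] using pos_hoop_subset[OF P(2)] by auto
next
  fix M N :: "(point \<Rightarrow> real) mv"
  show "positive_hom M N \<subseteq> hoop_hom M N"
    by (auto simp: positive_hom_def mv_hom_def)
next
  fix K M N :: "(point \<Rightarrow> real) mv" and f g
  assume "positive_mv K" "positive_mv M" "positive_mv N"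
  then obtain k P m Q n S where K: "pointed_rational_polyhedron k P" "P \<subseteq> cube k" "K = restrict_mv k P"
    and M: "pointed_rational_polyhedron m Q" "M = restrict_mv m Q"
    and N: "pointed_rational_polyhedron n S" "N = restrict_mv n S"
    by (elim positive_mvE) (rule that)
  assume "f \<in> positive_hom K M" "g \<in> positive_hom M N"
  then have f: "f \<in> mv_hom K M" "f ` carrier (pos_hoop k P) \<subseteq> carrier (pos_hoop m Q)"
    and g: "g \<in> mv_hom M N" "g ` carrier (pos_hoop m Q) \<subseteq> carrier (pos_hoop n S)"
    unfolding K(3) M(2) N(2) positive_hom_iff[OF K(1) M(1)] positive_hom_iff[OF M(1) N(1)] by blast+
  have "compose (carrier K) g f \<in> mv_hom K N"
    using closed_ops_restrict_mv[OF K(2)] zero_restrict_mv[OF K(2)] f g by (intro mv_hom_comp) (simp_all add: K(3))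
  moreover have "compose (carrier K) g f x = g (f x)" if "x \<in> carrier (pos_hoop k P)" for x
    using that pos_hoop_subset[OF K(2)] by (auto simp: compose_def K(3))
  then have "compose (carrier K) g f ` carrier (pos_hoop k P) \<subseteq> carrier (pos_hoop n S)"
    using f(2) g(2) by auto
  ultimately show "compose (carrier K) g f \<in> positive_hom K N"
    unfolding K(3) N(2) positive_hom_iff[OF K(1) N(1)] by blast
qed

lemma is_iso_WH_fp:
  assumes A: "A \<in> Obj WH_fp" and B: "B \<in> Obj WH_fp"
    and f: "f \<in> hoop_hom A B" and bij: "bij_betw f (carrier A) (carrier B)"
  shows "is_iso WH_fp A B f"
proof -
  have cl: "closed_ops A" "closed_ops B"
    using A B by (auto simp: WH_fp_def intro: wajsberg_hoop.closed_ops)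
  let ?g = "\<lambda>y \<in> carrier B. inv_into (carrier A) f y"
  have "compose (carrier A) ?g f = (\<lambda>x \<in> carrier A. x)"
    using hoop_homD(3)[OF f] bij by (auto simp: compose_def bij_betw_def intro!: restrict_ext)
  moreover have "compose (carrier B) f ?g = (\<lambda>x \<in> carrier B. x)"
    using bij by (auto simp: compose_def bij_betw_def f_inv_into_f intro!: restrict_ext)
  moreover have "?g \<in> hoop_hom B A"
    by (rule hoop_hom_inverse[OF f bij cl])
  ultimately show ?thesis
    using f unfolding is_iso_def WH_fp_def by (auto intro!: bexI[of _ ?g])
qed

section \<open>Copies of hoops along injections\<close>

definition transport :: "('a \<Rightarrow> 'b) \<Rightarrow> ('a, 'c) hoop_scheme \<Rightarrow> 'b hoop" where
  "transport \<iota> A = (let k = inv_into (carrier A) \<iota> in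
     \<lparr>carrier = \<iota> ` carrier A, monoid.mult = (\<lambda>x y. \<iota> (k x \<otimes>\<^bsub>A\<^esub> k y)), one = \<iota> \<one>\<^bsub>A\<^esub>,
      imp = (\<lambda>x y. \<iota> (k x \<rightharpoonup>\<^bsub>A\<^esub> k y)), hmeet = (\<lambda>x y. \<iota> (k x \<curlywedge>\<^bsub>A\<^esub> k y)),
      hjoin = (\<lambda>x y. \<iota> (k x \<curlyvee>\<^bsub>A\<^esub> k y))\<rparr>)"

lemma transport_simps:
  assumes "inj_on \<iota> (carrier A)"
  shows "carrier (transport \<iota> A) = \<iota> ` carrier A" "\<one>\<^bsub>transport \<iota> A\<^esub> = \<iota> \<one>\<^bsub>A\<^esub>"
    and "\<lbrakk>x \<in> carrier A; y \<in> carrier A\<rbrakk> \<Longrightarrow> \<iota> x \<otimes>\<^bsub>transport \<iota> A\<^esub> \<iota> y = \<iota> (x \<otimes>\<^bsub>A\<^esub> y)"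
    and "\<lbrakk>x \<in> carrier A; y \<in> carrier A\<rbrakk> \<Longrightarrow> \<iota> x \<rightharpoonup>\<^bsub>transport \<iota> A\<^esub> \<iota> y = \<iota> (x \<rightharpoonup>\<^bsub>A\<^esub> y)"
    and "\<lbrakk>x \<in> carrier A; y \<in> carrier A\<rbrakk> \<Longrightarrow> \<iota> x \<curlywedge>\<^bsub>transport \<iota> A\<^esub> \<iota> y = \<iota> (x \<curlywedge>\<^bsub>A\<^esub> y)"
    and "\<lbrakk>x \<in> carrier A; y \<in> carrier A\<rbrakk> \<Longrightarrow> \<iota> x \<curlyvee>\<^bsub>transport \<iota> A\<^esub> \<iota> y = \<iota> (x \<curlyvee>\<^bsub>A\<^esub> y)"
  using assms by (simp_all add: transport_def Let_def)

lemma transport_hom: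
  assumes cl: "closed_ops A" and inj: "inj_on \<iota> (carrier A)"
  shows "restrict \<iota> (carrier A) \<in> hoop_hom A (transport \<iota> A)"
    and "bij_betw (restrict \<iota> (carrier A)) (carrier A) (carrier (transport \<iota> A))"
proof -
  show "restrict \<iota> (carrier A) \<in> hoop_hom A (transport \<iota> A)"
    by (rule hoop_homI) (simp_all add: transport_simps[OF inj] closed_opsD[OF cl])
  show "bij_betw (restrict \<iota> (carrier A)) (carrier A) (carrier (transport \<iota> A))"
    using inj by (simp add: bij_betw_def transport_simps[OF inj] inj_on_restrict_eq)
qed

lemma transport_wajsberg:
  assumes A: "wajsberg_hoop A" and inj: "inj_on \<iota> (carrier A)"
  shows "wajsberg_hoop (transport \<iota> A)"
proof -
  interpret wajsberg_hoop A by fact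
  note [simp] = transport_simps[OF inj]
  show ?thesis
  proof (intro wajsberg_hoop.intro comm_monoidI wajsberg_hoop_axioms.intro; (simp only: transport_simps[OF inj])?; (elim imageE)?; clarify?)
    fix x y z assume xyz: "x \<in> carrier A" "y \<in> carrier A" "z \<in> carrier A"
    show "\<iota> x \<otimes>\<^bsub>transport \<iota> A\<^esub> \<iota> y \<otimes>\<^bsub>transport \<iota> A\<^esub> \<iota> z = \<iota> x \<otimes>\<^bsub>transport \<iota> A\<^esub> (\<iota> y \<otimes>\<^bsub>transport \<iota> A\<^esub> \<iota> z)"
      using xyz by (simp add: m_assoc)
    show "(\<iota> x \<otimes>\<^bsub>transport \<iota> A\<^esub> \<iota> y) \<rightharpoonup>\<^bsub>transport \<iota> A\<^esub> \<iota> z = \<iota> x \<rightharpoonup>\<^bsub>transport \<iota> A\<^esub> (\<iota> y \<rightharpoonup>\<^bsub>transport \<iota> A\<^esub> \<iota> z)"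
      using xyz by (simp add: currying)
  next
    fix x y assume xy: "x \<in> carrier A" "y \<in> carrier A"
    show "\<iota> x \<otimes>\<^bsub>transport \<iota> A\<^esub> \<iota> y \<in> \<iota> ` carrier A" "\<iota> x \<rightharpoonup>\<^bsub>transport \<iota> A\<^esub> \<iota> y \<in> \<iota> ` carrier A"
      using xy by simp_all
    show "\<iota> x \<otimes>\<^bsub>transport \<iota> A\<^esub> \<iota> y = \<iota> y \<otimes>\<^bsub>transport \<iota> A\<^esub> \<iota> x"
      using xy by (simp add: m_comm)
    show "\<iota> x \<otimes>\<^bsub>transport \<iota> A\<^esub> (\<iota> x \<rightharpoonup>\<^bsub>transport \<iota> A\<^esub> \<iota> y) = \<iota> y \<otimes>\<^bsub>transport \<iota> A\<^esub> (\<iota> y \<rightharpoonup>\<^bsub>transport \<iota> A\<^esub> \<iota> x)"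
      using xy by (simp add: divisibility[of x y])
    show "(\<iota> x \<rightharpoonup>\<^bsub>transport \<iota> A\<^esub> \<iota> y) \<rightharpoonup>\<^bsub>transport \<iota> A\<^esub> \<iota> y = (\<iota> y \<rightharpoonup>\<^bsub>transport \<iota> A\<^esub> \<iota> x) \<rightharpoonup>\<^bsub>transport \<iota> A\<^esub> \<iota> x"
      using xy by (simp add: wajsberg[of x y])
    show "\<iota> x \<curlywedge>\<^bsub>transport \<iota> A\<^esub> \<iota> y = \<iota> x \<otimes>\<^bsub>transport \<iota> A\<^esub> (\<iota> x \<rightharpoonup>\<^bsub>transport \<iota> A\<^esub> \<iota> y)"
      using xy by (simp add: hmeet_eq)
    show "\<iota> x \<curlyvee>\<^bsub>transport \<iota> A\<^esub> \<iota> y = (\<iota> x \<rightharpoonup>\<^bsub>transport \<iota> A\<^esub> \<iota> y) \<rightharpoonup>\<^bsub>transport \<iota> A\<^esub> \<iota> y"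
      using xy by (simp add: hjoin_eq)
  next
    fix x assume x: "x \<in> carrier A"
    show "\<iota> \<one>\<^bsub>A\<^esub> \<otimes>\<^bsub>transport \<iota> A\<^esub> \<iota> x = \<iota> x" "\<iota> x \<rightharpoonup>\<^bsub>transport \<iota> A\<^esub> \<iota> x = \<iota> \<one>\<^bsub>A\<^esub>"
      using x by simp_all
  qed simp
qed

lemma transport_finitely_presented:
  assumes A: "wajsberg_hoop A" "finitely_presented A" and inj: "inj_on \<iota> (carrier A)"
  shows "finitely_presented (transport \<iota> A)"
proof -
  have W: "wajsberg_hoop (transport \<iota> A)"
    by (rule transport_wajsberg[OF A(1) inj])
  note cl = wajsberg_hoop.closed_ops[OF A(1)] wajsberg_hoop.closed_ops[OF W]
  note hom = transport_hom[OF cl(1) inj]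
  let ?g = "\<lambda>y \<in> carrier (transport \<iota> A). inv_into (carrier A) (restrict \<iota> (carrier A)) y"
  have "?g \<in> hoop_hom (transport \<iota> A) A"
    by (rule hoop_hom_inverse[OF hom cl])
  moreover have "bij_betw ?g (carrier (transport \<iota> A)) (carrier A)"
    using bij_betw_inv_into[OF hom(2)] by (subst bij_betw_cong[of _ _ "inv_into (carrier A) (restrict \<iota> (carrier A))"]) auto
  ultimately have iso: "hoop_isomorphic (transport \<iota> A) A"
    unfolding hoop_isomorphic_def by blast
  from A(2) obtain n R g where R: "finite R" "\<forall>(p, q) \<in> R. tvars p \<subseteq> {..<n} \<and> tvars q \<subseteq> {..<n}"
    and g: "presented n (sol n R) A g"
    unfolding finitely_presented_iff[OF A(1)] by (elim exE conjE)
  from presented_transfer[OF W iso g] obtain h where "presented n (sol n R) (transport \<iota> A) h"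
    by (elim exE)
  then show ?thesis
    unfolding finitely_presented_iff[OF W] using R by (intro exI conjI)
qed

instance hterm :: countable
  by countable_datatype

text \<open>Objects of \<open>MV_pos\<close> are bare algebras; the description is unique because
  the algebra determines \<open>n\<close> and \<open>P\<close>.\<close>

definition pos_part :: "(point \<Rightarrow> real) mv \<Rightarrow> (point \<Rightarrow> real) mv" where
  "pos_part M = (THE H. \<exists>n P. pointed_rational_polyhedron n P \<and> M = restrict_mv n P \<and> H = pos_hoop n P)"

lemma pos_part_eq:
  assumes "pointed_rational_polyhedron n P"
  shows "pos_part (restrict_mv n P) = pos_hoop n P"
  unfolding pos_part_def
proof (rule the_equality)
  show "\<exists>n' P'. pointed_rational_polyhedron n' P' \<and> restrict_mv n P = restrict_mv n' P' \<and> pos_hoop n P = pos_hoop n' P'"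
    using assms by blast
  fix H assume "\<exists>n' P'. pointed_rational_polyhedron n' P' \<and> restrict_mv n P = restrict_mv n' P' \<and> H = pos_hoop n' P'"
  then show "H = pos_hoop n P"
    using restrict_mv_inject[OF assms] by blast
qed

text \<open>There are countably many terms, hence countably many term functions, and an infinite
  type contains a copy of \<open>nat\<close>.\<close>

lemma pos_hoop_embedding_exists:
  assumes "infinite (UNIV :: 'a set)"
  shows "\<exists>\<iota> :: (point \<Rightarrow> real) \<Rightarrow> 'a. inj_on \<iota> (carrier (pos_hoop n P))"
proof -
  let ?S = "carrier (pos_hoop n P)"
  have "countable ?S"
    unfolding pos_hoop_def by simp
  then obtain e :: "(point \<Rightarrow> real) \<Rightarrow> nat" where e: "inj_on e ?S"
    by (auto simp: countable_def)
  obtain k :: "nat \<Rightarrow> 'a" where "inj k"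
    using infinite_countable_subset[OF assms] by blast
  then have "inj_on (k \<circ> e) ?S"
    using e by (intro comp_inj_on) (auto intro: inj_on_subset)
  then show ?thesis
    by blast
qed

text \<open>Objects of \<open>WH_fp\<close> have carriers inside the type \<open>'a\<close>, so
  functions on points must be encoded there. One injection is fixed for each algebra, and the
  functor acts on arrows through these injections.\<close>

definition embed :: "(point \<Rightarrow> real) mv \<Rightarrow> (point \<Rightarrow> real) \<Rightarrow> 'a" where
  "embed M = (SOME \<iota>. inj_on \<iota> (carrier (pos_part M)))"

definition pos_ftor :: "((point \<Rightarrow> real) mv, (point \<Rightarrow> real) \<Rightarrow> point \<Rightarrow> real, 'a hoop, 'a \<Rightarrow> 'a) ftor" where
  "pos_ftor = \<lparr>on_obj = (\<lambda>M. transport (embed M) (pos_part M)),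
     on_arr = (\<lambda>M N \<alpha>. \<lambda>x \<in> embed M ` carrier (pos_part M).
       embed N (\<alpha> (inv_into (carrier (pos_part M)) (embed M) x)))\<rparr>"

section \<open>The functor of positive parts\<close>

locale infinite_type =
  fixes ty :: "'a itself"
  assumes infinite_type: "infinite (UNIV :: 'a set)"
begin

abbreviation emb :: "(point \<Rightarrow> real) mv \<Rightarrow> (point \<Rightarrow> real) \<Rightarrow> 'a" where
  "emb \<equiv> embed"

abbreviation G :: "((point \<Rightarrow> real) mv, (point \<Rightarrow> real) \<Rightarrow> point \<Rightarrow> real, 'a hoop, 'a \<Rightarrow> 'a) ftor" where
  "G \<equiv> pos_ftor"

lemma pos_part:
  assumes "positive_mv M"
  shows "wajsberg_hoop (pos_part M)" "finitely_presented (pos_part M)"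
    "inj_on (emb M) (carrier (pos_part M))" "carrier (pos_part M) \<subseteq> carrier M"
proof -
  obtain n P where P: "pointed_rational_polyhedron n P" "P \<subseteq> cube n" "M = restrict_mv n P"
    using assms by (rule positive_mvE)
  have eq: "pos_part M = pos_hoop n P"
    using P by (simp add: pos_part_eq)
  show "wajsberg_hoop (pos_part M)"
    unfolding eq by (rule presentedD(1)[OF pos_hoop_presented[OF P(2)]])
  show "finitely_presented (pos_part M)"
    unfolding eq using P(1) by (rule pos_hoop_finitely_presented)
  show "carrier (pos_part M) \<subseteq> carrier M"
    unfolding eq unfolding P(3) by (rule pos_hoop_subset[OF P(2)])
  have "\<exists>\<iota> :: (point \<Rightarrow> real) \<Rightarrow> 'a. inj_on \<iota> (carrier (pos_part M))"
    unfolding eq by (rule pos_hoop_embedding_exists[OF infinite_type])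
  then show "inj_on (emb M) (carrier (pos_part M))"
    unfolding embed_def by (rule someI_ex)
qed

lemma positive_hom_pos_part:
  assumes M: "positive_mv M" and N: "positive_mv N"
  shows "\<alpha> \<in> positive_hom M N \<longleftrightarrow> \<alpha> \<in> mv_hom M N \<and> \<alpha> ` carrier (pos_part M) \<subseteq> carrier (pos_part N)"
proof -
  obtain n P where P: "pointed_rational_polyhedron n P" "P \<subseteq> cube n" "M = restrict_mv n P"
    using M by (rule positive_mvE)
  obtain m Q where Q: "pointed_rational_polyhedron m Q" "Q \<subseteq> cube m" "N = restrict_mv m Q"
    using N by (rule positive_mvE)
  show ?thesis
    unfolding P(3) Q(3) pos_part_eq[OF P(1)] pos_part_eq[OF Q(1)] by (rule positive_hom_iff[OF P(1) Q(1)])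
qed

text \<open>The hoop operations of the positive part coincide with those of the whole algebra, so
  only closure of the carriers is at stake.\<close>

lemma restrict_pos_part_hom:
  assumes M: "positive_mv M" and N: "positive_mv N" and \<alpha>: "\<alpha> \<in> positive_hom M N"
  shows "restrict \<alpha> (carrier (pos_part M)) \<in> hoop_hom (pos_part M) (pos_part N)"
proof -
  obtain n P where P: "pointed_rational_polyhedron n P" "P \<subseteq> cube n" "M = restrict_mv n P"
    using M by (rule positive_mvE)
  obtain m Q where Q: "pointed_rational_polyhedron m Q" "Q \<subseteq> cube m" "N = restrict_mv m Q"
    using N by (rule positive_mvE)
  have h: "\<alpha> \<in> hoop_hom M N" "\<And>x. x \<in> carrier (pos_part M) \<Longrightarrow> \<alpha> x \<in> carrier (pos_part N)"
    using \<alpha> unfolding positive_hom_pos_part[OF M N] by (auto simp: mv_hom_def)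
  have sub: "x \<in> carrier M" if "x \<in> carrier (pos_part M)" for x
    using that pos_part(4)[OF M] by blast
  note cl = closed_opsD[OF wajsberg_hoop.closed_ops[OF pos_part(1)[OF M]]]
  have ops: "f \<otimes>\<^bsub>pos_part M\<^esub> g = f \<otimes>\<^bsub>M\<^esub> g" "f \<rightharpoonup>\<^bsub>pos_part M\<^esub> g = f \<rightharpoonup>\<^bsub>M\<^esub> g" "f \<curlywedge>\<^bsub>pos_part M\<^esub> g = f \<curlywedge>\<^bsub>M\<^esub> g"
    "f \<curlyvee>\<^bsub>pos_part M\<^esub> g = f \<curlyvee>\<^bsub>M\<^esub> g" "\<one>\<^bsub>pos_part M\<^esub> = \<one>\<^bsub>M\<^esub>"
    "f \<otimes>\<^bsub>pos_part N\<^esub> g = f \<otimes>\<^bsub>N\<^esub> g" "f \<rightharpoonup>\<^bsub>pos_part N\<^esub> g = f \<rightharpoonup>\<^bsub>N\<^esub> g" "f \<curlywedge>\<^bsub>pos_part N\<^esub> g = f \<curlywedge>\<^bsub>N\<^esub> g"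
    "f \<curlyvee>\<^bsub>pos_part N\<^esub> g = f \<curlyvee>\<^bsub>N\<^esub> g" "\<one>\<^bsub>pos_part N\<^esub> = \<one>\<^bsub>N\<^esub>" for f g
    unfolding P(3) Q(3) pos_part_eq[OF P(1)] pos_part_eq[OF Q(1)] by (simp_all add: pos_hoop_def restrict_mv_def)
  note hm = hoop_homD(2)[OF h(1)] hoop_homD(4-7)[OF h(1) sub sub]
  show ?thesis
  proof (rule hoop_homI)
    show "restrict \<alpha> (carrier (pos_part M)) \<one>\<^bsub>pos_part M\<^esub> = \<one>\<^bsub>pos_part N\<^esub>"
      using cl(1) hm(1) by (simp add: ops)
    fix x y assume xy: "x \<in> carrier (pos_part M)" "y \<in> carrier (pos_part M)"
    note C = cl(2-5)[OF xy]
    show "restrict \<alpha> (carrier (pos_part M)) (x \<otimes>\<^bsub>pos_part M\<^esub> y) =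
      restrict \<alpha> (carrier (pos_part M)) x \<otimes>\<^bsub>pos_part N\<^esub> restrict \<alpha> (carrier (pos_part M)) y"
      using xy C(1) hm(2)[OF xy] by (simp add: ops)
    show "restrict \<alpha> (carrier (pos_part M)) (x \<rightharpoonup>\<^bsub>pos_part M\<^esub> y) =
      restrict \<alpha> (carrier (pos_part M)) x \<rightharpoonup>\<^bsub>pos_part N\<^esub> restrict \<alpha> (carrier (pos_part M)) y"
      using xy C(2) hm(3)[OF xy] by (simp add: ops)
    show "restrict \<alpha> (carrier (pos_part M)) (x \<curlywedge>\<^bsub>pos_part M\<^esub> y) =
      restrict \<alpha> (carrier (pos_part M)) x \<curlywedge>\<^bsub>pos_part N\<^esub> restrict \<alpha> (carrier (pos_part M)) y"
      using xy C(3) hm(4)[OF xy] by (simp add: ops)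
    show "restrict \<alpha> (carrier (pos_part M)) (x \<curlyvee>\<^bsub>pos_part M\<^esub> y) =
      restrict \<alpha> (carrier (pos_part M)) x \<curlyvee>\<^bsub>pos_part N\<^esub> restrict \<alpha> (carrier (pos_part M)) y"
      using xy C(4) hm(5)[OF xy] by (simp add: ops)
  qed (use h(2) in auto)
qed

lemma on_obj_G [simp]: "on_obj G M = transport (emb M) (pos_part M)"
  by (simp add: pos_ftor_def)

lemma carrier_G: "positive_mv M \<Longrightarrow> carrier (on_obj G M) = emb M ` carrier (pos_part M)"
  by (simp add: transport_simps pos_part)

lemma on_arr_G:
  assumes "positive_mv M" "x \<in> carrier (pos_part M)"
  shows "on_arr G M N \<alpha> (emb M x) = emb N (\<alpha> x)"
  using assms pos_part(3)[OF assms(1)] by (simp add: pos_ftor_def)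

lemma on_arr_G_extensional: "positive_mv M \<Longrightarrow> on_arr G M N \<alpha> \<in> extensional (carrier (on_obj G M))"
  unfolding carrier_G by (simp add: pos_ftor_def)

lemma on_arr_G_hom:
  assumes M: "positive_mv M" and N: "positive_mv N" and \<alpha>: "\<alpha> \<in> positive_hom M N"
  shows "on_arr G M N \<alpha> \<in> hoop_hom (on_obj G M) (on_obj G N)"
proof -
  let ?\<alpha> = "restrict \<alpha> (carrier (pos_part M))"
  note cM = closed_opsD[OF wajsberg_hoop.closed_ops[OF pos_part(1)[OF M]]]
  note h = hoop_homD[OF restrict_pos_part_hom[OF M N \<alpha>]]
  note tM = transport_simps[OF pos_part(3)[OF M]] and tN = transport_simps[OF pos_part(3)[OF N]]
  have arr: "on_arr G M N \<alpha> (emb M x) = emb N (?\<alpha> x)" if "x \<in> carrier (pos_part M)" for x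
    using on_arr_G[OF M that] that by simp
  show ?thesis
  proof (rule hoop_homI)
    show "on_arr G M N \<alpha> \<in> extensional (carrier (on_obj G M))"
      by (rule on_arr_G_extensional[OF M])
    show "on_arr G M N \<alpha> \<one>\<^bsub>on_obj G M\<^esub> = \<one>\<^bsub>on_obj G N\<^esub>"
      using arr[OF cM(1)] h(2) by (simp add: tM(2) tN(2) del: restrict_apply)
    show "on_arr G M N \<alpha> x \<in> carrier (on_obj G N)" if "x \<in> carrier (on_obj G M)" for x
      using that arr h(3) unfolding carrier_G[OF M] carrier_G[OF N] by (auto simp del: restrict_apply)
    fix x y assume "x \<in> carrier (on_obj G M)" "y \<in> carrier (on_obj G M)"
    then obtain a b where a: "a \<in> carrier (pos_part M)" "x = emb M a" and b: "b \<in> carrier (pos_part M)" "y = emb M b"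
      unfolding carrier_G[OF M] by blast
    show "on_arr G M N \<alpha> (x \<otimes>\<^bsub>on_obj G M\<^esub> y) = on_arr G M N \<alpha> x \<otimes>\<^bsub>on_obj G N\<^esub> on_arr G M N \<alpha> y"
      "on_arr G M N \<alpha> (x \<rightharpoonup>\<^bsub>on_obj G M\<^esub> y) = on_arr G M N \<alpha> x \<rightharpoonup>\<^bsub>on_obj G N\<^esub> on_arr G M N \<alpha> y"
      "on_arr G M N \<alpha> (x \<curlywedge>\<^bsub>on_obj G M\<^esub> y) = on_arr G M N \<alpha> x \<curlywedge>\<^bsub>on_obj G N\<^esub> on_arr G M N \<alpha> y"
      "on_arr G M N \<alpha> (x \<curlyvee>\<^bsub>on_obj G M\<^esub> y) = on_arr G M N \<alpha> x \<curlyvee>\<^bsub>on_obj G N\<^esub> on_arr G M N \<alpha> y"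
      using a(1) b(1) h(3)[OF a(1)] h(3)[OF b(1)]
      by (simp_all add: a(2) b(2) tM(3-6) tN(3-6) arr cM h(4-7) del: restrict_apply)
  qed
qed

lemma WH_fp_simps:
  "Obj (WH_fp :: ('b hoop, 'b \<Rightarrow> 'b) cat) = {A. wajsberg_hoop A \<and> finitely_presented A}"
  "Hom WH_fp = hoop_hom" "Ident WH_fp A = (\<lambda>x \<in> carrier A. x)"
  "Comp WH_fp A B C g f = compose (carrier A) g f"
  by (simp_all add: WH_fp_def)

lemma MV_pos_simps:
  "Obj MV_pos = {A. positive_mv A}" "Hom MV_pos = positive_hom" "Ident MV_pos M = (\<lambda>x \<in> carrier M. x)"
  "Comp MV_pos K M N g f = compose (carrier K) g f"
  by (simp_all add: MV_pos_def)

lemma on_obj_G_WH_fp: "positive_mv M \<Longrightarrow> on_obj G M \<in> Obj WH_fp"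
  by (simp add: WH_fp_simps transport_wajsberg transport_finitely_presented pos_part)

lemma cat_functor_G: "cat_functor MV_pos WH_fp G"
proof (intro cat_functor.intro cat_functor_axioms.intro category_MV_pos category_WH_fp)
  show "on_obj G M \<in> Obj WH_fp" if "M \<in> Obj MV_pos" for M
    using that on_obj_G_WH_fp by (simp add: MV_pos_simps)
  show "on_arr G M N f \<in> Hom WH_fp (on_obj G M) (on_obj G N)"
    if "M \<in> Obj MV_pos" "N \<in> Obj MV_pos" "f \<in> Hom MV_pos M N" for M N f
    using that on_arr_G_hom unfolding MV_pos_simps WH_fp_simps by blast
  show "on_arr G M M (Ident MV_pos M) = Ident WH_fp (on_obj G M)" if "M \<in> Obj MV_pos" for M
  proof (rule extensionalityI)
    have M: "positive_mv M"
      using that by (simp add: MV_pos_simps)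
    show "on_arr G M M (Ident MV_pos M) \<in> extensional (carrier (on_obj G M))"
      by (rule on_arr_G_extensional[OF M])
    show "Ident WH_fp (on_obj G M) \<in> extensional (carrier (on_obj G M))"
      unfolding WH_fp_simps by (rule restrict_extensional)
    fix x assume x: "x \<in> carrier (on_obj G M)"
    then obtain a where a: "a \<in> carrier (pos_part M)" "x = emb M a"
      unfolding carrier_G[OF M] by blast
    then have "a \<in> carrier M"
      using pos_part(4)[OF M] by blast
    then show "on_arr G M M (Ident MV_pos M) x = Ident WH_fp (on_obj G M) x"
      using x unfolding WH_fp_simps by (simp add: a(2) on_arr_G[OF M a(1)] MV_pos_simps)
  qed
  fix K M N f g
  assume "K \<in> Obj MV_pos" "M \<in> Obj MV_pos" "N \<in> Obj MV_pos" "f \<in> Hom MV_pos K M" "g \<in> Hom MV_pos M N"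
  then have K: "positive_mv K" and M: "positive_mv M" and N: "positive_mv N"
    and f: "f \<in> positive_hom K M"
    unfolding MV_pos_simps by blast+
  show "on_arr G K N (Comp MV_pos K M N g f) =
    Comp WH_fp (on_obj G K) (on_obj G M) (on_obj G N) (on_arr G M N g) (on_arr G K M f)"
  proof (rule extensionalityI)
    show "on_arr G K N (Comp MV_pos K M N g f) \<in> extensional (carrier (on_obj G K))"
      by (rule on_arr_G_extensional[OF K])
    show "Comp WH_fp (on_obj G K) (on_obj G M) (on_obj G N) (on_arr G M N g) (on_arr G K M f) \<in> extensional (carrier (on_obj G K))"
      unfolding WH_fp_simps by (rule compose_extensional)
    fix x assume x: "x \<in> carrier (on_obj G K)"
    then obtain a where a: "a \<in> carrier (pos_part K)" "x = emb K a"
      unfolding carrier_G[OF K] by blast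
    then have aK: "a \<in> carrier K"
      using pos_part(4)[OF K] by blast
    have fa: "f a \<in> carrier (pos_part M)"
      using f a(1) unfolding positive_hom_pos_part[OF K M] by blast
    have "compose (carrier (on_obj G K)) (on_arr G M N g) (on_arr G K M f) x = on_arr G M N g (on_arr G K M f x)"
      using x by (simp only: compose_eq)
    then show "on_arr G K N (Comp MV_pos K M N g f) x =
      Comp WH_fp (on_obj G K) (on_obj G M) (on_obj G N) (on_arr G M N g) (on_arr G K M f) x"
      unfolding WH_fp_simps a(2) on_arr_G[OF K a(1)] on_arr_G[OF M fa] MV_pos_simps
      using aK by (simp add: compose_def)
  qed
qed

lemma G_faithful:
  assumes M: "positive_mv M" and N: "positive_mv N"
    and g: "g \<in> positive_hom M N" "g' \<in> positive_hom M N" and eq: "on_arr G M N g = on_arr G M N g'"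
  shows "g = g'"
proof -
  obtain n P where P: "pointed_rational_polyhedron n P" "P \<subseteq> cube n" "M = restrict_mv n P"
    using M by (rule positive_mvE)
  obtain m Q where Q: "pointed_rational_polyhedron m Q" "Q \<subseteq> cube m" "N = restrict_mv m Q"
    using N by (rule positive_mvE)
  have gg: "g \<in> mv_hom M N" "g ` carrier (pos_part M) \<subseteq> carrier (pos_part N)"
    "g' \<in> mv_hom M N" "g' ` carrier (pos_part M) \<subseteq> carrier (pos_part N)"
    using g unfolding positive_hom_pos_part[OF M N] by blast+
  have "g f = g' f" if f: "f \<in> carrier (pos_part M)" for f
  proof (rule inj_onD[OF pos_part(3)[OF N]])
    show "emb N (g f) = emb N (g' f)"
      using fun_cong[OF eq, of "emb M f"] unfolding on_arr_G[OF M f] .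
  qed (use gg f in blast)+
  then show ?thesis
    using gg P(2) Q(2) unfolding P(3) Q(3) pos_part_eq[OF P(1)] by (intro mv_hom_faithful)
qed

text \<open>Undoing the chosen injections turns \<open>f\<close> into a homomorphism of positive
  parts, and \<open>hoop_hom_extends\<close> continues it to all McNaughton functions; the extension
  is positive by construction.\<close>

lemma G_full:
  assumes M: "positive_mv M" and N: "positive_mv N"
    and f: "f \<in> hoop_hom (on_obj G M) (on_obj G N)"
  shows "\<exists>g \<in> positive_hom M N. on_arr G M N g = f"
proof -
  obtain n P where P: "pointed_rational_polyhedron n P" "P \<subseteq> cube n" "M = restrict_mv n P"
    using M by (rule positive_mvE)
  obtain m Q where Q: "pointed_rational_polyhedron m Q" "Q \<subseteq> cube m" "N = restrict_mv m Q"
    using N by (rule positive_mvE)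
  note pM = pos_part[OF M] and pN = pos_part[OF N]
  note clM = wajsberg_hoop.closed_ops[OF pM(1)] and clN = wajsberg_hoop.closed_ops[OF pN(1)]
  have clGN: "closed_ops (on_obj G N)"
    using transport_wajsberg[OF pN(1,3)] by (simp add: wajsberg_hoop.closed_ops)
  let ?i = "restrict (emb M) (carrier (pos_part M))"
  let ?j = "restrict (emb N) (carrier (pos_part N))"
  let ?k = "\<lambda>y \<in> carrier (on_obj G N). inv_into (carrier (pos_part N)) ?j y"
  have i: "?i \<in> hoop_hom (pos_part M) (on_obj G M)"
    using transport_hom(1)[OF clM pM(3)] by simp
  have j: "?j \<in> hoop_hom (pos_part N) (on_obj G N)" "bij_betw ?j (carrier (pos_part N)) (carrier (on_obj G N))"
    using transport_hom[OF clN pN(3)] by simp_all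
  have k: "?k \<in> hoop_hom (on_obj G N) (pos_part N)"
    by (rule hoop_hom_inverse[OF j clN clGN])
  define \<beta> where "\<beta> = compose (carrier (pos_part M)) ?k (compose (carrier (pos_part M)) f ?i)"
  have \<beta>: "\<beta> \<in> hoop_hom (pos_part M) (pos_part N)"
    unfolding \<beta>_def by (rule hoop_hom_comp[OF hoop_hom_comp[OF i f clM] k clM])
  obtain \<alpha> where \<alpha>: "\<alpha> \<in> mv_hom M N" "\<And>h. h \<in> carrier (pos_part M) \<Longrightarrow> \<alpha> h = \<beta> h"
    using hoop_hom_extends[OF P(1) Q(2), of \<beta>] \<beta>
    unfolding P(3) Q(3) pos_part_eq[OF P(1)] pos_part_eq[OF Q(1)] by blast
  have "\<alpha> ` carrier (pos_part M) \<subseteq> carrier (pos_part N)"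
    using \<alpha>(2) hoop_homD(3)[OF \<beta>] by auto
  then have pos: "\<alpha> \<in> positive_hom M N"
    using \<alpha>(1) unfolding positive_hom_pos_part[OF M N] by blast
  have "on_arr G M N \<alpha> = f"
  proof (rule extensionalityI)
    show "on_arr G M N \<alpha> \<in> extensional (carrier (on_obj G M))"
      by (rule on_arr_G_extensional[OF M])
    show "f \<in> extensional (carrier (on_obj G M))"
      using f by (rule hoop_homD)
    fix x assume x: "x \<in> carrier (on_obj G M)"
    then obtain a where a: "a \<in> carrier (pos_part M)" "x = emb M a"
      unfolding carrier_G[OF M] by blast
    have fx: "f x \<in> carrier (on_obj G N)"
      by (rule hoop_homD(3)[OF f x])
    have "\<beta> a = inv_into (carrier (pos_part N)) ?j (f x)"
      using a fx by (simp add: \<beta>_def compose_def)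
    then have "?j (\<beta> a) = f x"
      using fx j(2) by (simp add: bij_betw_inv_into_right del: restrict_apply)
    then have "emb N (\<beta> a) = f x"
      using hoop_homD(3)[OF \<beta> a(1)] by simp
    then show "on_arr G M N \<alpha> x = f x"
      unfolding a(2) on_arr_G[OF M a(1)] \<alpha>(2)[OF a(1)] .
  qed
  then show ?thesis
    using pos by blast
qed

text \<open>\<open>A\<close> and the positive functions on the solution set of its relations are
  presented by the same subset of the cube, so \<open>presented_isomorphic\<close> applies.\<close>

lemma G_surjective:
  assumes A: "A \<in> Obj (WH_fp :: ('a hoop, 'a \<Rightarrow> 'a) cat)"
  shows "\<exists>M. positive_mv M \<and> (\<exists>u. is_iso WH_fp A (on_obj G M) u)"
proof -
  have W: "wajsberg_hoop A" "finitely_presented A"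
    using A by (simp_all add: WH_fp_simps)
  then obtain n R g where R: "finite R" "\<forall>(p, q) \<in> R. tvars p \<subseteq> {..<n} \<and> tvars q \<subseteq> {..<n}"
    and g: "presented n (sol n R) A g"
    unfolding finitely_presented_iff[OF W(1)] by (elim exE conjE)
  let ?P = "sol n R"
  let ?M = "restrict_mv n ?P"
  have P: "pointed_rational_polyhedron n ?P"
    using R by (intro sol_pointed) auto
  then have PC: "?P \<subseteq> cube n"
    by (simp add: pointed_rational_polyhedron_def)
  have M: "positive_mv ?M"
    using P unfolding positive_mv_def by blast
  note pM = pos_part[OF M]
  have "presented n ?P (pos_part ?M) (\<lambda>i. term_fun ?P (Var i))"
    unfolding pos_part_eq[OF P] by (rule pos_hoop_presented[OF PC])
  then have "hoop_isomorphic A (pos_part ?M)"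
    by (rule presented_isomorphic[OF g])
  then obtain f where f: "f \<in> hoop_hom A (pos_part ?M)" "bij_betw f (carrier A) (carrier (pos_part ?M))"
    unfolding hoop_isomorphic_def by blast
  note t = transport_hom[OF wajsberg_hoop.closed_ops[OF pM(1)] pM(3)]
  let ?u = "compose (carrier A) (restrict (emb ?M) (carrier (pos_part ?M))) f"
  have "?u \<in> hoop_hom A (on_obj G ?M)"
    using hoop_hom_comp[OF f(1) t(1) wajsberg_hoop.closed_ops[OF W(1)]] by simp
  moreover have "bij_betw ?u (carrier A) (carrier (on_obj G ?M))"
    using bij_betw_trans[OF f(2) t(2)] by (subst bij_betw_cong[of _ _ "restrict (emb ?M) (carrier (pos_part ?M)) \<circ> f"]) (auto simp: compose_def)
  ultimately have "is_iso WH_fp A (on_obj G ?M) ?u"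
    by (rule is_iso_WH_fp[OF A on_obj_G_WH_fp[OF M]])
  then show ?thesis
    using M by blast
qed

lemma WH_fp_equivalent_MV_pos: "categorically_equivalent (WH_fp :: ('a hoop, 'a \<Rightarrow> 'a) cat) MV_pos"
proof -
  interpret fully_faithful_surjective MV_pos WH_fp G
  proof (intro fully_faithful_surjective.intro fully_faithful_surjective_axioms.intro cat_functor_G)
    show "\<exists>g \<in> Hom MV_pos X Y. on_arr G X Y g = f"
      if "X \<in> Obj MV_pos" "Y \<in> Obj MV_pos" "f \<in> Hom WH_fp (on_obj G X) (on_obj G Y)" for X Y f
      using that G_full unfolding MV_pos_simps WH_fp_simps by blast
    show "g = g'"
      if "X \<in> Obj MV_pos" "Y \<in> Obj MV_pos" "g \<in> Hom MV_pos X Y" "g' \<in> Hom MV_pos X Y"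
        "on_arr G X Y g = on_arr G X Y g'" for X Y g g'
      using that G_faithful unfolding MV_pos_simps by blast
    show "\<exists>X \<in> Obj MV_pos. \<exists>u. is_iso WH_fp A (on_obj G X) u" if "A \<in> Obj WH_fp" for A
      using G_surjective[OF that] unfolding MV_pos_simps by blast
  qed
  show ?thesis
    by (rule equivalent)
qed

end

theorem theorem3p12:
  assumes "infinite (UNIV :: 'a set)"
  shows "categorically_equivalent (WH_fp :: ('a hoop, 'a \<Rightarrow> 'a) cat) MV_pos"
proof -
  interpret infinite_type "TYPE('a)"
    by unfold_locales (rule assms)
  show ?thesis
    by (rule WH_fp_equivalent_MV_pos)
qed

end
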